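(* Let $p$ be a prime, $n>0$ an integer and $\phi:\mathbb Q_p^n\to\mathbb Q_p^n$ a topological automorphism (of the additive topological group $\mathbb Q_p^n$). Then $$s(\phi)=\prod_{|\lambda_i|_p>1}|\lambda_i|_p,$$ where $\{\lambda_1,\ldots,\lambda_n\}$ is the family of all eigenvalues of $\phi$ (listed with multiplicity), contained in a finite extension $K$ of $\mathbb Q_p$.
   Context: $\mathbb Q_p$ is the field of $p$-adic numbers with its usual locally compact topology. Every topological automorphism of the topological group $\mathbb Q_p^n$ is $\mathbb Q_p$-linear, hence given by an invertible $n\times n$ matrix over $\mathbb Q_p$; its eigenvalues are the roots of the characteristic polynomial of this matrix. $|\cdot|_p$ denotes the $p$-adic norm on $\mathbb Q_p$, normalized by $|p|_p=p^{-1}$, and also its unique extension to a norm on the finite extension $K$. An empty product equals $1$. Scale: for a totally disconnected locally compact group $G$ and a topological automorphism $\phi$ of $G$ (a group automorphism that is also a homeomorphism), let $\mathcal B(G)$ be the family of all compact open subgroups of $G$; the scale of $\phi$ is $s(\phi)=\min\{[\phi(U):U\cap\phi(U)]:U\in\mathcal B(G)\}$. Here $G=\mathbb Q_p^n$. *)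

theory Defs
  imports "HOL-Analysis.Analysis" "Berlekamp_Zassenhaus.Finite_Field"
begin

section \<open>The \<open>p\<close>-adic absolute value on the rationals\<close>

definition rat_padic_abs :: "nat \<Rightarrow> rat \<Rightarrow> real" where
  "rat_padic_abs p x =
     (if x = 0 then 0
      else real p powi (int (multiplicity (int p) (snd (quotient_of x))) -
                        int (multiplicity (int p) (fst (quotient_of x)))))"

lemma rat_padic_abs_Fract:
  assumes p: "prime p" and a: "a \<noteq> 0" and b: "b \<noteq> 0"
  shows "rat_padic_abs p (of_int a / of_int b) =
     real p powi (int (multiplicity (int p) b) - int (multiplicity (int p) a))"
proof -
  obtain n d where nd: "quotient_of (of_int a / of_int b) = (n, d)"
    by (cases "quotient_of (of_int a / of_int b)")
  have d: "d > 0" using quotient_of_denom_pos[OF nd] .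
  have eq: "(of_int a / of_int b :: rat) = of_int n / of_int d"
    using quotient_of_div[OF nd] .
  have "of_int (n * b) = (of_int (a * d) :: rat)"
    using eq b d by (simp add: field_simps)
  then have nb: "n * b = a * d" by (simp only: of_int_eq_iff)
  have n: "n \<noteq> 0" using nb a d by auto
  have pe: "prime_elem (int p)" using p by simp
  have "multiplicity (int p) n + multiplicity (int p) b
      = multiplicity (int p) a + multiplicity (int p) d"
    using arg_cong[OF nb, of "multiplicity (int p)"] pe n a b d
    by (simp add: prime_elem_multiplicity_mult_distrib)
  then show ?thesis
    using a b nd by (auto simp: rat_padic_abs_def intro!: arg_cong[where f = "\<lambda>k. real p powi k"])
qed

lemma rat_padic_abs_0 [simp]: "rat_padic_abs p 0 = 0"
  by (simp add: rat_padic_abs_def)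

lemma rat_padic_abs_pos: "prime p \<Longrightarrow> x \<noteq> 0 \<Longrightarrow> 0 < rat_padic_abs p x"
  by (simp add: rat_padic_abs_def prime_gt_0_nat)

lemma rat_padic_abs_nonneg: "prime p \<Longrightarrow> 0 \<le> rat_padic_abs p x"
  by (cases "x = 0") (auto dest: rat_padic_abs_pos[of p x])

lemma rat_padic_abs_eq_0_iff: "prime p \<Longrightarrow> rat_padic_abs p x = 0 \<longleftrightarrow> x = 0"
  using rat_padic_abs_pos[of p x] by (cases "x = 0") auto

lemma rat_int_quotientE:
  fixes x :: rat
  obtains a b where "x = of_int a / of_int b" "b > 0"
  by (metis quotient_of_denom_pos quotient_of_div surj_pair)

lemma rat_padic_abs_mult:
  assumes p: "prime p"
  shows "rat_padic_abs p (x * y) = rat_padic_abs p x * rat_padic_abs p y"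
proof (cases "x = 0 \<or> y = 0")
  case False
  obtain a b where x: "x = of_int a / of_int b" and b: "b > 0" by (rule rat_int_quotientE)
  obtain c d where y: "y = of_int c / of_int d" and d: "d > 0" by (rule rat_int_quotientE)
  have a: "a \<noteq> 0" and c: "c \<noteq> 0" using False x y by auto
  have xy: "x * y = of_int (a * c) / of_int (b * d)" by (simp add: x y)
  have pe: "prime_elem (int p)" using p by simp
  have p0: "real p \<noteq> 0" using p by (auto dest: prime_gt_0_nat)
  have "rat_padic_abs p (x * y) =
      real p powi (int (multiplicity (int p) (b * d)) - int (multiplicity (int p) (a * c)))"
    unfolding xy using a b c d by (intro rat_padic_abs_Fract p) auto
  also have "\<dots> = real p powi ((int (multiplicity (int p) b) - int (multiplicity (int p) a)) +
      (int (multiplicity (int p) d) - int (multiplicity (int p) c)))"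
    using pe a b c d by (simp add: prime_elem_multiplicity_mult_distrib algebra_simps)
  also have "\<dots> = rat_padic_abs p x * rat_padic_abs p y"
    using a b c d p p0 unfolding x y
    by (subst power_int_add) (auto simp: rat_padic_abs_Fract)
  finally show ?thesis .
qed auto

lemma rat_padic_abs_1 [simp]: "prime p \<Longrightarrow> rat_padic_abs p 1 = 1"
  using rat_padic_abs_Fract[of p 1 1] by simp

lemma rat_padic_abs_minus [simp]:
  assumes p: "prime p"
  shows "rat_padic_abs p (- x) = rat_padic_abs p x"
proof -
  have "rat_padic_abs p (- 1) = 1"
    using rat_padic_abs_Fract[of p "- 1" 1] p by (simp add: multiplicity_unit_right)
  then show ?thesis using rat_padic_abs_mult[OF p, of "- 1" x] by simp
qed

lemma rat_padic_abs_diff_commute: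
  "prime p \<Longrightarrow> rat_padic_abs p (x - y) = rat_padic_abs p (y - x)"
  using rat_padic_abs_minus[of p "x - y"] by simp

lemma rat_padic_abs_ultra:
  assumes p: "prime p"
  shows "rat_padic_abs p (x + y) \<le> max (rat_padic_abs p x) (rat_padic_abs p y)"
proof (cases "x = 0 \<or> y = 0 \<or> x + y = 0")
  case True
  then show ?thesis using rat_padic_abs_nonneg[OF p] by (auto simp: le_max_iff_disj)
next
  case False
  obtain a b where x: "x = of_int a / of_int b" and b: "b > 0" by (rule rat_int_quotientE)
  obtain c d where y: "y = of_int c / of_int d" and d: "d > 0" by (rule rat_int_quotientE)
  have x': "x = of_int (a * d) / of_int (b * d)" using d by (simp add: x)
  have y': "y = of_int (b * c) / of_int (b * d)" using b by (simp add: y)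
  have s': "x + y = of_int (a * d + b * c) / of_int (b * d)"
    by (simp add: x' y' add_divide_distrib)
  have nz: "a * d \<noteq> 0" "b * c \<noteq> 0" "a * d + b * c \<noteq> 0" "b * d \<noteq> 0"
  proof -
    show "a * d \<noteq> 0" using False x d by auto
    show "b * c \<noteq> 0" using False y b by auto
    show "b * d \<noteq> 0" using b d by auto
    show "a * d + b * c \<noteq> 0"
    proof
      assume "a * d + b * c = 0"
      then have "x + y = 0" unfolding s' by (simp only: of_int_0 div_0)
      then show False using False by simp
    qed
  qed
  let ?m = "multiplicity (int p)"
  have pu: "\<not> is_unit (int p)" using p prime_gt_1_nat[OF p] by simp
  have "int p ^ min (?m (a * d)) (?m (b * c)) dvd a * d + b * c"
    by (intro dvd_add multiplicity_dvd') auto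
  then have m: "min (?m (a * d)) (?m (b * c)) \<le> ?m (a * d + b * c)"
    using nz pu by (intro multiplicity_geI) auto
  have p1: "1 \<le> real p" using p prime_ge_1_nat[of p] by simp
  show ?thesis
  proof (cases "?m (a * d) \<le> ?m (b * c)")
    case True
    have "rat_padic_abs p (x + y) \<le> rat_padic_abs p x"
      unfolding s' using nz p True m p1
      by (subst x') (auto simp: rat_padic_abs_Fract simp del: of_int_mult of_int_add intro!: power_int_increasing)
    then show ?thesis by simp
  next
    case f: False
    have "rat_padic_abs p (x + y) \<le> rat_padic_abs p y"
      unfolding s' using nz p f m p1
      by (subst y') (auto simp: rat_padic_abs_Fract simp del: of_int_mult of_int_add intro!: power_int_increasing)
    then show ?thesis by simp
  qed
qed

lemma rat_padic_abs_triangle: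
  assumes "prime p"
  shows "rat_padic_abs p (x + y) \<le> rat_padic_abs p x + rat_padic_abs p y"
  using rat_padic_abs_ultra[OF assms, of x y] rat_padic_abs_nonneg[OF assms, of x]
    rat_padic_abs_nonneg[OF assms, of y] by linarith

lemma rat_padic_abs_reverse_triangle:
  assumes "prime p"
  shows "\<bar>rat_padic_abs p x - rat_padic_abs p y\<bar> \<le> rat_padic_abs p (x - y)"
  using rat_padic_abs_triangle[OF assms, of "x - y" y]
    rat_padic_abs_triangle[OF assms, of "y - x" x] rat_padic_abs_diff_commute[OF assms, of x y]
  by simp


section \<open>The field of \<open>p\<close>-adic numbers as the completion of the rationals\<close>

definition padic_cauchy :: "nat \<Rightarrow> (nat \<Rightarrow> rat) \<Rightarrow> bool" where
  "padic_cauchy p X \<longleftrightarrow> (\<forall>e>0. \<exists>N. \<forall>m\<ge>N. \<forall>n\<ge>N. rat_padic_abs p (X m - X n) < e)"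

definition padic_null :: "nat \<Rightarrow> (nat \<Rightarrow> rat) \<Rightarrow> bool" where
  "padic_null p X \<longleftrightarrow> (\<lambda>n. rat_padic_abs p (X n)) \<longlonglongrightarrow> 0"

context
  fixes p :: nat
  assumes p: "prime p"
begin

lemma padic_null_0: "padic_null p (\<lambda>n. 0)"
  by (simp add: padic_null_def)

lemma padic_null_le:
  assumes "padic_null p X" "\<And>n. rat_padic_abs p (Y n) \<le> rat_padic_abs p (X n)"
  shows "padic_null p Y"
  unfolding padic_null_def
  by (rule tendsto_sandwich[OF _ _ tendsto_const assms(1)[unfolded padic_null_def]])
     (auto simp: assms(2) rat_padic_abs_nonneg[OF p])

lemma padic_null_minus: "padic_null p X \<Longrightarrow> padic_null p (\<lambda>n. - X n)"
  by (simp add: padic_null_def p)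

lemma padic_null_add:
  assumes "padic_null p X" "padic_null p Y"
  shows "padic_null p (\<lambda>n. X n + Y n)"
  unfolding padic_null_def
proof (rule tendsto_sandwich[OF _ _ tendsto_const])
  show "(\<lambda>n. rat_padic_abs p (X n) + rat_padic_abs p (Y n)) \<longlonglongrightarrow> 0"
    using tendsto_add[OF assms[unfolded padic_null_def]] by simp
qed (auto simp: rat_padic_abs_nonneg[OF p] rat_padic_abs_triangle[OF p])

lemma padic_null_diff:
  "padic_null p X \<Longrightarrow> padic_null p Y \<Longrightarrow> padic_null p (\<lambda>n. X n - Y n)"
  using padic_null_add[OF _ padic_null_minus, of X Y] by simp

lemma padic_cauchy_const: "padic_cauchy p (\<lambda>n. c)"
  by (simp add: padic_cauchy_def)

lemma padic_cauchy_minus: "padic_cauchy p X \<Longrightarrow> padic_cauchy p (\<lambda>n. - X n)"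
  by (simp add: padic_cauchy_def) (metis p rat_padic_abs_diff_commute)

lemma padic_cauchy_add:
  assumes X: "padic_cauchy p X" and Y: "padic_cauchy p Y"
  shows "padic_cauchy p (\<lambda>n. X n + Y n)"
  unfolding padic_cauchy_def
proof (intro allI impI)
  fix e :: real assume e: "e > 0"
  obtain M where M: "\<And>m n. m \<ge> M \<Longrightarrow> n \<ge> M \<Longrightarrow> rat_padic_abs p (X m - X n) < e"
    using X e unfolding padic_cauchy_def by blast
  obtain N where N: "\<And>m n. m \<ge> N \<Longrightarrow> n \<ge> N \<Longrightarrow> rat_padic_abs p (Y m - Y n) < e"
    using Y e unfolding padic_cauchy_def by blast
  have "rat_padic_abs p (X m + Y m - (X n + Y n)) < e" if "m \<ge> max M N" "n \<ge> max M N" for m n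
  proof -
    have "X m + Y m - (X n + Y n) = (X m - X n) + (Y m - Y n)" by simp
    then have "rat_padic_abs p (X m + Y m - (X n + Y n)) \<le>
        max (rat_padic_abs p (X m - X n)) (rat_padic_abs p (Y m - Y n))"
      using rat_padic_abs_ultra[OF p, of "X m - X n" "Y m - Y n"] by (simp only:)
    also have "\<dots> < e" using M[of m n] N[of m n] that by simp
    finally show ?thesis .
  qed
  then show "\<exists>N. \<forall>m\<ge>N. \<forall>n\<ge>N. rat_padic_abs p (X m + Y m - (X n + Y n)) < e" by blast
qed

lemma padic_cauchy_convergent_abs:
  assumes X: "padic_cauchy p X"
  shows "convergent (\<lambda>n. rat_padic_abs p (X n))"
proof -
  have "Cauchy (\<lambda>n. rat_padic_abs p (X n))"
    unfolding Cauchy_def dist_real_def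
    using X rat_padic_abs_reverse_triangle[OF p] unfolding padic_cauchy_def
    by (meson order.strict_trans1)
  then show ?thesis by (simp add: Cauchy_convergent_iff)
qed

lemma padic_cauchy_bounded:
  assumes X: "padic_cauchy p X"
  obtains B where "B > 0" "\<And>n. rat_padic_abs p (X n) < B"
proof -
  have "Bseq (\<lambda>n. rat_padic_abs p (X n))"
    using padic_cauchy_convergent_abs[OF X] by (rule convergent_imp_Bseq)
  then obtain B where "B > 0" "\<And>n. norm (rat_padic_abs p (X n)) \<le> B"
    by (auto elim: BseqE)
  then have "rat_padic_abs p (X n) < B + 1" for n
    by (smt (verit) real_norm_def)
  then show ?thesis using that[of "B + 1"] \<open>B > 0\<close> by simp
qed

lemma padic_null_mult:
  assumes X: "padic_null p X" and Y: "padic_cauchy p Y"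
  shows "padic_null p (\<lambda>n. X n * Y n)"
proof -
  obtain B where B: "B > 0" "\<And>n. rat_padic_abs p (Y n) < B"
    using padic_cauchy_bounded[OF Y] by blast
  show ?thesis
    unfolding padic_null_def rat_padic_abs_mult[OF p]
  proof (rule tendsto_sandwich[OF _ _ tendsto_const])
    show "(\<lambda>n. rat_padic_abs p (X n) * B) \<longlonglongrightarrow> 0"
      using tendsto_mult_right[OF X[unfolded padic_null_def], of B] by simp
  qed (auto simp: rat_padic_abs_nonneg[OF p] less_imp_le[OF B(2)] intro!: always_eventually mult_left_mono)
qed

lemma padic_cauchy_mult:
  assumes X: "padic_cauchy p X" and Y: "padic_cauchy p Y"
  shows "padic_cauchy p (\<lambda>n. X n * Y n)"
  unfolding padic_cauchy_def
proof (intro allI impI)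
  fix e :: real assume e: "e > 0"
  obtain B where B: "B > 0" "\<And>n. rat_padic_abs p (X n) < B" using padic_cauchy_bounded[OF X] by blast
  obtain C where C: "C > 0" "\<And>n. rat_padic_abs p (Y n) < C" using padic_cauchy_bounded[OF Y] by blast
  have "e / C > 0" "e / B > 0" using e B C by auto
  then obtain M N where M: "\<And>m n. m \<ge> M \<Longrightarrow> n \<ge> M \<Longrightarrow> rat_padic_abs p (X m - X n) < e / C"
    and N: "\<And>m n. m \<ge> N \<Longrightarrow> n \<ge> N \<Longrightarrow> rat_padic_abs p (Y m - Y n) < e / B"
    using X Y unfolding padic_cauchy_def by meson
  have "rat_padic_abs p (X m * Y m - X n * Y n) < e" if "m \<ge> max M N" "n \<ge> max M N" for m n
  proof -
    have "X m * Y m - X n * Y n = X m * (Y m - Y n) + (X m - X n) * Y n"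
      by (simp add: algebra_simps)
    then have "rat_padic_abs p (X m * Y m - X n * Y n) \<le>
        max (rat_padic_abs p (X m) * rat_padic_abs p (Y m - Y n))
            (rat_padic_abs p (X m - X n) * rat_padic_abs p (Y n))"
      using rat_padic_abs_ultra[OF p, of "X m * (Y m - Y n)" "(X m - X n) * Y n"]
      by (simp add: rat_padic_abs_mult[OF p])
    also have "\<dots> < max (B * (e / B)) (e / C * C)"
      using M[of m n] N[of m n] that B C rat_padic_abs_nonneg[OF p]
      by (auto simp: less_max_iff_disj max_less_iff_conj intro!: max.strict_coboundedI1)
         (metis mult.commute mult_strict_mono' nonzero_mult_div_cancel_left
           times_divide_eq_right less_irrefl)+
    also have "\<dots> = e" using B C by simp
    finally show ?thesis .
  qed
  then show "\<exists>N. \<forall>m\<ge>N. \<forall>n\<ge>N. rat_padic_abs p (X m * Y m - X n * Y n) < e" by blast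
qed

lemma padic_cauchy_not_null:
  assumes X: "padic_cauchy p X" and nz: "\<not> padic_null p X"
  obtains b N where "b > 0" "\<And>n. n \<ge> N \<Longrightarrow> b < rat_padic_abs p (X n)"
proof -
  obtain L where L: "(\<lambda>n. rat_padic_abs p (X n)) \<longlonglongrightarrow> L"
    using padic_cauchy_convergent_abs[OF X] by (auto simp: convergent_def)
  have "L \<ge> 0" using L by (rule LIMSEQ_le_const) (auto simp: rat_padic_abs_nonneg[OF p])
  moreover have "L \<noteq> 0" using nz L by (auto simp: padic_null_def)
  ultimately have "L / 2 > 0" "L / 2 < L" by auto
  moreover from this(2) have "eventually (\<lambda>n. L / 2 < rat_padic_abs p (X n)) sequentially"
    using L by (rule order_tendstoD(1)[rotated])
  ultimately show ?thesis using that[of "L / 2"] unfolding eventually_sequentially by blast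
qed

lemma padic_cauchy_inverse:
  assumes X: "padic_cauchy p X" and nz: "\<not> padic_null p X"
  shows "padic_cauchy p (\<lambda>n. inverse (X n))"
  unfolding padic_cauchy_def
proof (intro allI impI)
  fix e :: real assume e: "e > 0"
  obtain b M where b: "b > 0" "\<And>n. n \<ge> M \<Longrightarrow> b < rat_padic_abs p (X n)"
    using padic_cauchy_not_null[OF X nz] by blast
  have "e * (b * b) > 0" using e b by simp
  then obtain N where N: "\<And>m n. m \<ge> N \<Longrightarrow> n \<ge> N \<Longrightarrow> rat_padic_abs p (X m - X n) < e * (b * b)"
    using X unfolding padic_cauchy_def by meson
  have "rat_padic_abs p (inverse (X m) - inverse (X n)) < e" if "m \<ge> max M N" "n \<ge> max M N" for m n
  proof -
    have bm: "b < rat_padic_abs p (X m)" and bn: "b < rat_padic_abs p (X n)" using b that by auto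
    then have nz: "X m \<noteq> 0" "X n \<noteq> 0" using b by auto
    have "X n - X m = (inverse (X m) - inverse (X n)) * (X m * X n)"
      using nz by (simp add: field_simps)
    then have "rat_padic_abs p (X n - X m) =
        rat_padic_abs p (inverse (X m) - inverse (X n)) * (rat_padic_abs p (X m) * rat_padic_abs p (X n))"
      by (simp add: rat_padic_abs_mult[OF p])
    moreover have "rat_padic_abs p (X n - X m) < e * (b * b)" using N that by auto
    moreover have "b * b < rat_padic_abs p (X m) * rat_padic_abs p (X n)"
      using bm bn b by (intro mult_strict_mono) auto
    ultimately show ?thesis
      using e by (smt (verit) mult_mono b(1) mult_pos_pos)
  qed
  then show "\<exists>N. \<forall>m\<ge>N. \<forall>n\<ge>N. rat_padic_abs p (inverse (X m) - inverse (X n)) < e" by blast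
qed

lemma padic_null_inverse_mult:
  assumes X: "padic_cauchy p X" and nz: "\<not> padic_null p X"
  shows "padic_null p (\<lambda>n. inverse (X n) * X n - 1)"
proof -
  obtain b M where b: "b > 0" "\<And>n. n \<ge> M \<Longrightarrow> b < rat_padic_abs p (X n)"
    using padic_cauchy_not_null[OF X nz] by blast
  have "X n \<noteq> 0" if "n \<ge> M" for n using b(1) b(2)[OF that] by auto
  then have "eventually (\<lambda>n. rat_padic_abs p (inverse (X n) * X n - 1) = 0) sequentially"
    unfolding eventually_sequentially by (intro exI[of _ M]) simp
  then show ?thesis unfolding padic_null_def by (rule tendsto_eventually)
qed

lemma padic_null_cong:
  assumes "padic_null p (\<lambda>n. X n - Y n)"
  shows "padic_null p X \<longleftrightarrow> padic_null p Y"
  using padic_null_diff[OF _ assms, of X] padic_null_add[OF _ assms, of Y] by auto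

lemma padic_null_diff_inverse:
  assumes X: "padic_cauchy p X" "\<not> padic_null p X"
    and Y: "padic_cauchy p Y" "\<not> padic_null p Y"
    and XY: "padic_null p (\<lambda>n. X n - Y n)"
  shows "padic_null p (\<lambda>n. inverse (X n) - inverse (Y n))"
proof -
  note iX = padic_cauchy_inverse[OF X] and iY = padic_cauchy_inverse[OF Y]
  have "padic_null p (\<lambda>n. (X n - Y n) * (inverse (X n) * inverse (Y n)))"
    by (intro padic_null_mult XY padic_cauchy_mult iX iY)
  moreover have "padic_null p (\<lambda>n. (inverse (X n) * X n - 1) * inverse (Y n))"
    by (intro padic_null_mult padic_null_inverse_mult X iY)
  moreover have "padic_null p (\<lambda>n. (inverse (Y n) * Y n - 1) * inverse (X n))"
    by (intro padic_null_mult padic_null_inverse_mult Y iX)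
  ultimately have "padic_null p (\<lambda>n. (inverse (Y n) * Y n - 1) * inverse (X n)
       - (inverse (X n) * X n - 1) * inverse (Y n)
       + (X n - Y n) * (inverse (X n) * inverse (Y n)))"
    by (intro padic_null_add padic_null_diff)
  then have "padic_null p (\<lambda>n. inverse (Y n) - inverse (X n))"
    by (simp add: algebra_simps)
  then show ?thesis using padic_null_minus by fastforce
qed

end

text \<open>The prime \<open>p\<close> is the cardinality of the index type \<open>'p\<close>, so that \<open>'p padic\<close> is the
  field of \<open>p\<close>-adic numbers: Cauchy sequences of rationals modulo null sequences, both with
  respect to the \<open>p\<close>-adic absolute value.\<close>

typedef (overloaded) 'p padic_seq = "{X. padic_cauchy CARD('p::prime_card) X}"
  using padic_cauchy_const[OF prime_card] by blast

setup_lifting type_definition_padic_seq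

instantiation padic_seq :: (prime_card) comm_ring_1
begin

lift_definition zero_padic_seq :: "'a padic_seq" is "\<lambda>n. 0"
  by (simp add: padic_cauchy_const prime_card)

lift_definition one_padic_seq :: "'a padic_seq" is "\<lambda>n. 1"
  by (simp add: padic_cauchy_const prime_card)

lift_definition plus_padic_seq :: "'a padic_seq \<Rightarrow> 'a padic_seq \<Rightarrow> 'a padic_seq"
  is "\<lambda>X Y n. X n + Y n"
  by (rule padic_cauchy_add[OF prime_card])

lift_definition uminus_padic_seq :: "'a padic_seq \<Rightarrow> 'a padic_seq" is "\<lambda>X n. - X n"
  by (rule padic_cauchy_minus[OF prime_card])

lift_definition minus_padic_seq :: "'a padic_seq \<Rightarrow> 'a padic_seq \<Rightarrow> 'a padic_seq"
  is "\<lambda>X Y n. X n - Y n"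
  using padic_cauchy_add[OF prime_card _ padic_cauchy_minus[OF prime_card]] by fastforce

lift_definition times_padic_seq :: "'a padic_seq \<Rightarrow> 'a padic_seq \<Rightarrow> 'a padic_seq"
  is "\<lambda>X Y n. X n * Y n"
  by (rule padic_cauchy_mult[OF prime_card])

instance
  by standard (transfer; simp add: fun_eq_iff algebra_simps)+

end

lift_definition padic_seq_null :: "'p::prime_card padic_seq \<Rightarrow> bool" is "padic_null CARD('p)" .

lift_definition padic_seq_inverse :: "'p::prime_card padic_seq \<Rightarrow> 'p padic_seq"
  is "\<lambda>X. if padic_null CARD('p) X then (\<lambda>n. 0) else (\<lambda>n. inverse (X n))"
  by (auto simp: padic_cauchy_const prime_card intro: padic_cauchy_inverse)

lift_definition padic_seq_norm :: "'p::prime_card padic_seq \<Rightarrow> real"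
  is "\<lambda>X. lim (\<lambda>n. rat_padic_abs CARD('p) (X n))" .

lemma padic_seq_null_0 [simp]: "padic_seq_null 0"
  by transfer (rule padic_null_0[OF prime_card])

lemma padic_seq_null_minus: "padic_seq_null X \<Longrightarrow> padic_seq_null (- X)"
  by transfer (rule padic_null_minus[OF prime_card])

lemma padic_seq_null_add: "padic_seq_null X \<Longrightarrow> padic_seq_null Y \<Longrightarrow> padic_seq_null (X + Y)"
  by transfer (rule padic_null_add[OF prime_card])

lemma padic_seq_null_mult: "padic_seq_null X \<Longrightarrow> padic_seq_null (X * Y)"
  by transfer (rule padic_null_mult[OF prime_card])

lemma padic_seq_not_null_1: "\<not> padic_seq_null 1"
  by transfer (simp add: padic_null_def prime_card LIMSEQ_const_iff)

lemma padic_seq_null_inverse_mult: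
  "\<not> padic_seq_null X \<Longrightarrow> padic_seq_null (padic_seq_inverse X * X - 1)"
  by transfer (simp add: padic_null_inverse_mult prime_card)

lemma padic_seq_inverse_cong:
  "padic_seq_null (X - Y) \<Longrightarrow> padic_seq_null (padic_seq_inverse X - padic_seq_inverse Y)"
proof transfer
  fix X Y :: "nat \<Rightarrow> rat"
  note p = prime_card[where 'a='a]
  assume "padic_cauchy CARD('a) X" "padic_cauchy CARD('a) Y" "padic_null CARD('a) (\<lambda>n. X n - Y n)"
  then show "padic_null CARD('a)
     (\<lambda>n. (if padic_null CARD('a) X then (\<lambda>n. 0) else (\<lambda>n. inverse (X n))) n -
          (if padic_null CARD('a) Y then (\<lambda>n. 0) else (\<lambda>n. inverse (Y n))) n)"
    using padic_null_cong[OF p, of X Y] padic_null_diff_inverse[OF p, of X Y]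
    by (auto simp: padic_null_0[OF p])
qed

lemma padic_cauchy_abs_tendsto:
  "padic_cauchy CARD('p::prime_card) X \<Longrightarrow>
    (\<lambda>n. rat_padic_abs CARD('p) (X n)) \<longlonglongrightarrow> lim (\<lambda>n. rat_padic_abs CARD('p) (X n))"
  using padic_cauchy_convergent_abs[OF prime_card] by (simp add: convergent_LIMSEQ_iff)

lemma padic_seq_norm_cong:
  "padic_seq_null (X - Y) \<Longrightarrow> padic_seq_norm X = padic_seq_norm Y"
proof transfer
  fix X Y :: "nat \<Rightarrow> rat"
  note p = prime_card[where 'a='a]
  let ?a = "rat_padic_abs CARD('a)"
  assume X: "padic_cauchy CARD('a) X" and XY: "padic_null CARD('a) (\<lambda>n. X n - Y n)"
  note L = padic_cauchy_abs_tendsto[OF X]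
  have "(\<lambda>n. ?a (X n - Y n)) \<longlonglongrightarrow> 0" using XY by (simp add: padic_null_def)
  then have "(\<lambda>n. ?a (Y n) - ?a (X n)) \<longlonglongrightarrow> 0"
    by (rule Lim_null_comparison[rotated])
       (use rat_padic_abs_reverse_triangle[OF p] in \<open>auto simp: abs_minus_commute\<close>)
  from tendsto_add[OF this L] show "lim (\<lambda>n. ?a (X n)) = lim (\<lambda>n. ?a (Y n))"
    by (simp add: limI)
qed

lemma padic_seq_norm_eq_0_iff: "padic_seq_norm X = 0 \<longleftrightarrow> padic_seq_null X"
  by transfer (auto simp: padic_null_def dest: padic_cauchy_abs_tendsto intro: limI)

lemma padic_seq_norm_minus: "padic_seq_norm (- X) = padic_seq_norm X"
  by transfer (simp add: prime_card)

lemma padic_seq_norm_mult: "padic_seq_norm (X * Y) = padic_seq_norm X * padic_seq_norm Y"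
  by transfer
     (auto simp: rat_padic_abs_mult prime_card intro!: limI tendsto_mult padic_cauchy_abs_tendsto)

lemma padic_seq_norm_ultrametric:
  "padic_seq_norm (X + Y) \<le> max (padic_seq_norm X) (padic_seq_norm Y)"
proof transfer
  fix X Y :: "nat \<Rightarrow> rat"
  let ?a = "rat_padic_abs CARD('a)"
  assume X: "padic_cauchy CARD('a) X" and Y: "padic_cauchy CARD('a) Y"
  show "lim (\<lambda>n. ?a (X n + Y n)) \<le> max (lim (\<lambda>n. ?a (X n))) (lim (\<lambda>n. ?a (Y n)))"
    by (rule LIMSEQ_le[OF padic_cauchy_abs_tendsto[OF padic_cauchy_add[OF prime_card X Y]]
          tendsto_max[OF padic_cauchy_abs_tendsto[OF X] padic_cauchy_abs_tendsto[OF Y]]])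
       (auto simp: rat_padic_abs_ultra[OF prime_card])
qed

definition padic_rel :: "'p::prime_card padic_seq \<Rightarrow> 'p padic_seq \<Rightarrow> bool" where
  "padic_rel X Y \<longleftrightarrow> padic_seq_null (X - Y)"

quotient_type (overloaded) 'p padic = "'p::prime_card padic_seq" / padic_rel
proof (rule equivpI)
  show "reflp (padic_rel :: 'p padic_seq \<Rightarrow> _)"
    by (simp add: reflp_def padic_rel_def)
  show "symp (padic_rel :: 'p padic_seq \<Rightarrow> _)"
    using padic_seq_null_minus by (fastforce simp: symp_def padic_rel_def)
  show "transp (padic_rel :: 'p padic_seq \<Rightarrow> _)"
    using padic_seq_null_add by (fastforce simp: transp_def padic_rel_def)
qed

instantiation padic :: (prime_card) field
begin

lift_definition zero_padic :: "'a padic" is 0 .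

lift_definition one_padic :: "'a padic" is 1 .

lift_definition plus_padic :: "'a padic \<Rightarrow> 'a padic \<Rightarrow> 'a padic" is "(+)"
  unfolding padic_rel_def by (metis add_diff_add padic_seq_null_add)

lift_definition uminus_padic :: "'a padic \<Rightarrow> 'a padic" is uminus
  unfolding padic_rel_def by (metis minus_diff_minus padic_seq_null_minus)

lift_definition minus_padic :: "'a padic \<Rightarrow> 'a padic \<Rightarrow> 'a padic" is "(-)"
proof -
  fix X X' Y Y' :: "'a padic_seq"
  assume "padic_rel X X'" "padic_rel Y Y'"
  then have "padic_seq_null ((X - X') + - (Y - Y'))"
    unfolding padic_rel_def by (intro padic_seq_null_add padic_seq_null_minus)
  then show "padic_rel (X - Y) (X' - Y')" by (simp add: padic_rel_def algebra_simps)
qed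

lift_definition times_padic :: "'a padic \<Rightarrow> 'a padic \<Rightarrow> 'a padic" is "(*)"
proof -
  fix X X' Y Y' :: "'a padic_seq"
  assume "padic_rel X X'" "padic_rel Y Y'"
  then have "padic_seq_null ((X - X') * Y + (Y - Y') * X')"
    unfolding padic_rel_def by (intro padic_seq_null_add padic_seq_null_mult)
  then show "padic_rel (X * Y) (X' * Y')" by (simp add: padic_rel_def algebra_simps)
qed

lift_definition inverse_padic :: "'a padic \<Rightarrow> 'a padic" is padic_seq_inverse
  unfolding padic_rel_def by (rule padic_seq_inverse_cong)

definition divide_padic :: "'a padic \<Rightarrow> 'a padic \<Rightarrow> 'a padic" where
  "divide_padic x y = x * inverse y"

instance
proof
  fix a b c :: "'a padic"
  note [simp] = padic_rel_def
  show "a + b + c = a + (b + c)" by transfer (simp add: add.assoc)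
  show "a + b = b + a" by transfer (simp add: add.commute)
  show "0 + a = a" by transfer simp
  show "- a + a = 0" by transfer simp
  show "a - b = a + - b" by transfer simp
  show "a * b * c = a * (b * c)" by transfer (simp add: mult.assoc)
  show "a * b = b * a" by transfer (simp add: mult.commute)
  show "1 * a = a" by transfer simp
  show "(a + b) * c = a * c + b * c" by transfer (simp add: distrib_right)
  show "(0 :: 'a padic) \<noteq> 1"
    by transfer (use padic_seq_null_minus padic_seq_not_null_1 in fastforce)
  show "a \<noteq> 0 \<Longrightarrow> inverse a * a = 1"
    by transfer (simp add: padic_seq_null_inverse_mult)
  show "a div b = a * inverse b" by (rule divide_padic_def)
  show "inverse (0 :: 'a padic) = 0"
  proof transfer
    have "padic_seq_inverse (0 :: 'a padic_seq) = 0"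
      by transfer (simp add: padic_null_0[OF prime_card])
    then show "padic_rel (padic_seq_inverse 0) (0 :: 'a padic_seq)" by simp
  qed
qed

end

text \<open>The extension of the \<open>p\<close>-adic absolute value by continuity.\<close>

lift_definition padic_norm :: "'p::prime_card padic \<Rightarrow> real" is padic_seq_norm
  unfolding padic_rel_def by (rule padic_seq_norm_cong)

lemma padic_norm_eq_0_iff: "padic_norm (x :: 'p::prime_card padic) = 0 \<longleftrightarrow> x = 0"
  by transfer (simp add: padic_rel_def padic_seq_norm_eq_0_iff)

lemma padic_norm_minus: "padic_norm (- x :: 'p::prime_card padic) = padic_norm x"
  by transfer (rule padic_seq_norm_minus)

lemma padic_norm_mult: "padic_norm (x * y :: 'p::prime_card padic) = padic_norm x * padic_norm y"
  by transfer (rule padic_seq_norm_mult)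

lemma padic_norm_ultrametric: "padic_norm (x + y :: 'p::prime_card padic) \<le> max (padic_norm x) (padic_norm y)"
  by transfer (rule padic_seq_norm_ultrametric)

lemma padic_norm_nonneg: "0 \<le> padic_norm (x :: 'p::prime_card padic)"
  using padic_norm_ultrametric[of x "- x"] padic_norm_eq_0_iff[of "0 :: 'p padic"]
  by (simp add: padic_norm_minus)

lemma padic_norm_prime: "padic_norm (of_nat CARD('p) :: 'p::prime_card padic) = 1 / real CARD('p)"
proof -
  note p = prime_card[where 'a='p]
  have seq: "Rep_padic_seq (of_nat k :: 'p padic_seq) = (\<lambda>n. of_nat k)" for k
    by (induction k) (simp_all add: zero_padic_seq.rep_eq one_padic_seq.rep_eq plus_padic_seq.rep_eq)
  have "(of_nat k :: 'p padic) = abs_padic (of_nat k)" for k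
    by (induction k) (simp_all add: zero_padic.abs_eq one_padic.abs_eq plus_padic.abs_eq)
  then have "padic_norm (of_nat CARD('p) :: 'p padic) = rat_padic_abs CARD('p) (of_nat CARD('p))"
    by (simp add: padic_norm.abs_eq padic_seq_norm.rep_eq seq)
  also have "\<dots> = 1 / real CARD('p)"
    using rat_padic_abs_Fract[OF p, of "int CARD('p)" 1] p
    by (auto simp: multiplicity_self power_int_minus field_simps dest: prime_gt_1_nat)
  finally show ?thesis .
qed

instantiation padic :: (prime_card) metric_space
begin

definition dist_padic :: "'a padic \<Rightarrow> 'a padic \<Rightarrow> real" where
  "dist_padic x y = padic_norm (x - y)"

definition uniformity_padic :: "('a padic \<times> 'a padic) filter" where
  "uniformity_padic = (INF e\<in>{0<..}. principal {(x, y). dist x y < e})"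

definition open_padic :: "'a padic set \<Rightarrow> bool" where
  "open_padic U \<longleftrightarrow> (\<forall>x\<in>U. eventually (\<lambda>(x', y). x' = x \<longrightarrow> y \<in> U) uniformity)"

instance
proof
  fix x y z :: "'a padic"
  show "dist x y = 0 \<longleftrightarrow> x = y" by (simp add: dist_padic_def padic_norm_eq_0_iff)
  have "padic_norm (x - y) \<le> max (padic_norm (x - z)) (padic_norm (- (y - z)))"
    using padic_norm_ultrametric[of "x - z" "- (y - z)"] by simp
  then show "dist x y \<le> dist x z + dist y z"
    using padic_norm_nonneg[of "x - z"] padic_norm_nonneg[of "y - z"]
    unfolding dist_padic_def padic_norm_minus by linarith
qed (rule uniformity_padic_def open_padic_def)+

end


section \<open>The scale of a topological automorphism\<close>

definition topological_automorphism :: "('a::{group_add, topological_space} \<Rightarrow> 'a) \<Rightarrow> bool" where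
  "topological_automorphism \<phi> \<longleftrightarrow>
     (\<forall>x y. \<phi> (x + y) = \<phi> x + \<phi> y) \<and> (\<exists>\<psi>. homeomorphism UNIV UNIV \<phi> \<psi>)"

definition add_subgroup :: "'a::group_add set \<Rightarrow> bool" where
  "add_subgroup H \<longleftrightarrow> 0 \<in> H \<and> (\<forall>x\<in>H. \<forall>y\<in>H. x + y \<in> H) \<and> (\<forall>x\<in>H. - x \<in> H)"

definition compact_open_subgroups :: "'a::{group_add, topological_space} set set" where
  "compact_open_subgroups = {U. add_subgroup U \<and> compact U \<and> open U}"

text \<open>The index \<open>[G : H]\<close> as the number of left cosets; it is only meaningful if that number is
  finite, which is the case below because \<open>\<phi> ` U\<close> is compact and \<open>U \<inter> \<phi> ` U\<close> is open.\<close>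

definition add_index :: "'a::group_add set \<Rightarrow> 'a set \<Rightarrow> nat" where
  "add_index G H = card ((\<lambda>x. (+) x ` H) ` G)"

definition aut_scale :: "('a::{group_add, topological_space} \<Rightarrow> 'a) \<Rightarrow> nat" where
  "aut_scale \<phi> =
     (LEAST k. \<exists>U \<in> compact_open_subgroups. k = add_index (\<phi> ` U) (U \<inter> \<phi> ` U))"


section \<open>Eigenvalues in a finite extension\<close>

definition charpoly :: "'a::comm_ring_1 ^ 'n ^ 'n \<Rightarrow> 'a poly" where
  "charpoly A = det (mat [:0, 1:] - map_matrix (\<lambda>a. [:a:]) A)"

definition finite_field_extension :: "('a::field \<Rightarrow> 'k::field) \<Rightarrow> bool" where
  "finite_field_extension \<iota> \<longleftrightarrow>
     field_hom \<iota> \<and> (\<exists>B. finite_dimensional_vector_space (\<lambda>c x. \<iota> c * x) B)"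

definition is_norm_extension :: "('p::prime_card padic \<Rightarrow> 'k::field) \<Rightarrow> ('k \<Rightarrow> real) \<Rightarrow> bool" where
  "is_norm_extension \<iota> N \<longleftrightarrow>
     (\<forall>x. 0 \<le> N x) \<and> (\<forall>x. N x = 0 \<longleftrightarrow> x = 0) \<and>
     (\<forall>x y. N (x * y) = N x * N y) \<and> (\<forall>x y. N (x + y) \<le> N x + N y) \<and>
     (\<forall>c. N (\<iota> c) = padic_norm c)"

text \<open>\<open>ev\<close> lists the roots of the characteristic polynomial with multiplicity; in particular this
  polynomial splits in the extension.\<close>

definition is_eigenvalue_family ::
    "('a::field \<Rightarrow> 'k::field) \<Rightarrow> 'a ^ 'n ^ 'n \<Rightarrow> ('n \<Rightarrow> 'k) \<Rightarrow> bool" where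
  "is_eigenvalue_family \<iota> A ev \<longleftrightarrow> map_poly \<iota> (charpoly A) = (\<Prod>i\<in>UNIV. [:- ev i, 1:])"

end

theory Submission
  imports Defs
begin

text \<open>Write \<open>A\<close> for the matrix of \<open>\<phi>\<close>. The idea is that a subgroup \<open>U\<close> of minimal index
\<open>[\<phi> U : U \<inter> \<phi> U]\<close> splits, up to overlap, into a part on which \<open>\<phi>\<close> expands and a part on
which it contracts, and that the index only sees the expanding part, where it is a determinant.

Let \<open>P\<close> be the intersection of all \<open>\<phi>\<^sup>j U\<close> and \<open>M\<close> the intersection of all \<open>\<phi>\<^sup>-\<^sup>j U\<close> with \<open>j \<ge> 0\<close>.
Passing from \<open>U\<close> to \<open>U \<inter> \<phi> U \<inter> \<dots> \<inter> \<phi>\<^sup>n U\<close> never increases the index, so minimality forces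
equality for every \<open>n\<close>, and compactness turns this into \<open>U = P + M\<close> and into
\<open>s(\<phi>) = [\<phi> P : P]\<close>; this is \<open>tidy_above_decomposition\<close>. Here \<open>P \<subseteq> \<phi> P\<close> and \<open>\<phi> M \<subseteq> M\<close>, and both
are compact.

Choose a basis of the vector space consisting of vectors of \<open>P\<close> that span the span of \<open>P\<close>,
completed by vectors of \<open>M\<close> (\<open>adapted_basis\<close>). The span of \<open>P\<close> is invariant, so \<open>A\<close> becomes block
triangular with diagonal blocks \<open>B\<close> on the span and \<open>D\<close> on the quotient, and its characteristic
polynomial is the product of those of \<open>B\<close> and \<open>D\<close>. An eigenvalue of \<open>B\<close> has norm at least one: it
belongs to an eigenvector supported on vectors of \<open>P\<close>, whose backward orbits stay in the compact
set \<open>P\<close>. Dually, an eigenvalue of \<open>D\<close> has norm at most one, because it belongs to a left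
eigenvector, and the forward orbits of vectors of \<open>M\<close> stay in \<open>M\<close>. Hence the eigenvalues of norm
greater than one multiply to the norm of \<open>det B\<close> (\<open>expanding_eigenvalue_product\<close>).

On the other side, \<open>[\<phi> P : P]\<close> is the factor by which \<open>B\<close> scales volume, and an invertible matrix
scales the volume of every compact open subgroup by the norm of its determinant
(\<open>lattice_volume_matrix_image\<close>). The volume is not a measure here but an index relative to the
integral vectors, and the scaling law is checked on generators of the general linear group.\<close>

section \<open>Indices of subgroups of abelian groups\<close>

lemma add_subgroup_diff: "add_subgroup H \<Longrightarrow> x \<in> H \<Longrightarrow> y \<in> H \<Longrightarrow> x - y \<in> H"
  for H :: "'a::ab_group_add set"
  unfolding add_subgroup_def by (metis ab_group_add_class.ab_diff_conv_add_uminus)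

lemma add_subgroup_zero: "add_subgroup H \<Longrightarrow> 0 \<in> H"
  and add_subgroup_add: "add_subgroup H \<Longrightarrow> x \<in> H \<Longrightarrow> y \<in> H \<Longrightarrow> x + y \<in> H"
  and add_subgroup_minus: "add_subgroup H \<Longrightarrow> x \<in> H \<Longrightarrow> - x \<in> H"
  unfolding add_subgroup_def by auto

lemma add_subgroup_Int: "add_subgroup H \<Longrightarrow> add_subgroup K \<Longrightarrow> add_subgroup (H \<inter> K)"
  unfolding add_subgroup_def by auto

lemma add_subgroup_INT: "(\<And>i. i \<in> I \<Longrightarrow> add_subgroup (H i)) \<Longrightarrow> add_subgroup (\<Inter>i\<in>I. H i)"
  unfolding add_subgroup_def by auto

lemma coset_eq_iff:
  fixes H :: "'a::ab_group_add set"
  assumes H: "add_subgroup H"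
  shows "(+) x ` H = (+) y ` H \<longleftrightarrow> x - y \<in> H"
proof
  assume "(+) x ` H = (+) y ` H"
  then have "x + 0 \<in> (+) y ` H" using add_subgroup_zero[OF H] by blast
  then obtain h where "x = y + h" "h \<in> H" by auto
  then show "x - y \<in> H" by simp
next
  have sub: "(+) x ` H \<subseteq> (+) y ` H" if "x - y \<in> H" for x y
  proof
    fix z assume "z \<in> (+) x ` H"
    then obtain h where h: "z = x + h" "h \<in> H" by auto
    have "z = y + ((x - y) + h)" using h by simp
    then show "z \<in> (+) y ` H" using add_subgroup_add[OF H that h(2)] by blast
  qed
  assume *: "x - y \<in> H"
  have "y - x \<in> H" using add_subgroup_minus[OF H *] by simp
  with * sub show "(+) x ` H = (+) y ` H" by blast
qed

text \<open>Sets of coset representatives, with \<open>H\<close> possibly reaching outside \<open>G\<close>, so that the cosets of one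
fixed \<open>H\<close> can be compared in different groups.\<close>
definition transversal :: "'a::ab_group_add set \<Rightarrow> 'a set \<Rightarrow> 'a set \<Rightarrow> bool" where
  "transversal R G H \<longleftrightarrow> R \<subseteq> G \<and> (\<forall>g\<in>G. \<exists>!r. r \<in> R \<and> g - r \<in> H)"

lemma add_index_transversal:
  fixes G H :: "'a::ab_group_add set"
  assumes H: "add_subgroup H" and R: "transversal R G H"
  shows "add_index G H = card R"
proof -
  have "inj_on (\<lambda>x. (+) x ` H) R"
    unfolding inj_on_def coset_eq_iff[OF H]
    using R add_subgroup_zero[OF H] unfolding transversal_def
    by (metis diff_self subsetD)
  moreover have "(\<lambda>x. (+) x ` H) ` G = (\<lambda>x. (+) x ` H) ` R"
  proof
    show "(\<lambda>x. (+) x ` H) ` R \<subseteq> (\<lambda>x. (+) x ` H) ` G"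
      using R unfolding transversal_def by blast
    show "(\<lambda>x. (+) x ` H) ` G \<subseteq> (\<lambda>x. (+) x ` H) ` R"
    proof
      fix c assume "c \<in> (\<lambda>x. (+) x ` H) ` G"
      then obtain g where g: "g \<in> G" "c = (+) g ` H" by auto
      then obtain r where r: "r \<in> R" "g - r \<in> H" using R unfolding transversal_def by blast
      then have "c = (+) r ` H" using g coset_eq_iff[OF H] by blast
      then show "c \<in> (\<lambda>x. (+) x ` H) ` R" using r by blast
    qed
  qed
  ultimately show ?thesis unfolding add_index_def by (simp add: card_image)
qed

lemma transversal_exists:
  fixes G H :: "'a::ab_group_add set"
  assumes H: "add_subgroup H"
  obtains R where "transversal R G H"
proof -
  obtain R where R: "R \<subseteq> G" "inj_on (\<lambda>x. (+) x ` H) R"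
      "(\<lambda>x. (+) x ` H) ` G = (\<lambda>x. (+) x ` H) ` R"
    using subset_image_inj[of "(\<lambda>x. (+) x ` H) ` G" "\<lambda>x. (+) x ` H" G] by auto
  have "\<exists>!r. r \<in> R \<and> g - r \<in> H" if g: "g \<in> G" for g
  proof -
    have "(+) g ` H \<in> (\<lambda>x. (+) x ` H) ` R" using g R(3) by blast
    then obtain r where r: "r \<in> R" "(+) g ` H = (+) r ` H" by auto
    show ?thesis
    proof (rule ex1I[of _ r])
      show "r \<in> R \<and> g - r \<in> H" using r coset_eq_iff[OF H] by blast
      fix s assume s: "s \<in> R \<and> g - s \<in> H"
      then have "(+) g ` H = (+) s ` H" using coset_eq_iff[OF H] by blast
      then show "s = r" using r s R(2) unfolding inj_on_def by metis
    qed
  qed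
  then have "transversal R G H" using R(1) by (simp add: transversal_def)
  then show ?thesis by (rule that)
qed

text \<open>Sums of representatives of \<open>G\<close> modulo \<open>H\<close> and of \<open>H\<close> modulo \<open>K\<close> represent \<open>G\<close> modulo \<open>K\<close>.
The equation holds for infinite indices too, since the cardinality of an infinite set is zero.\<close>
lemma add_index_mult:
  fixes G H K :: "'a::ab_group_add set"
  assumes G: "add_subgroup G" and H: "add_subgroup H" and K: "add_subgroup K"
    and "H \<subseteq> G" "K \<subseteq> H"
  shows "add_index G K = add_index G H * add_index H K"
proof -
  obtain R where R: "transversal R G H" by (rule transversal_exists[OF H])
  obtain T where T: "transversal T H K" by (rule transversal_exists[OF K])
  let ?f = "\<lambda>(r, t). r + t"
  have uniq: "r = r' \<and> t = t'"
    if "r \<in> R" "t \<in> T" "r' \<in> R" "t' \<in> T" "r + t - (r' + t') \<in> K" for r t r' t'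
  proof -
    have t: "t \<in> H" "t' \<in> H" using that T unfolding transversal_def by auto
    have "r - r' = (r + t - (r' + t')) - (t - t')" by (simp add: algebra_simps)
    then have "r - r' \<in> H"
      using that(5) assms(5) add_subgroup_diff[OF H] t by (metis subsetD)
    then have rr: "r = r'"
      using R that add_subgroup_zero[OF H] unfolding transversal_def
      by (metis diff_self subsetD)
    then have "t - t' \<in> K" using that(5) by simp
    then have "t = t'"
      using T that add_subgroup_zero[OF K] unfolding transversal_def
      by (metis diff_self subsetD)
    with rr show ?thesis by simp
  qed
  have "transversal (?f ` (R \<times> T)) G K"
    unfolding transversal_def
  proof (intro conjI ballI)
    show "?f ` (R \<times> T) \<subseteq> G"
    proof clarify
      fix r t assume "r \<in> R" "t \<in> T"
      then have "r \<in> G" "t \<in> G" using R T assms(4) by (auto simp: transversal_def)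
      then show "r + t \<in> G" by (rule add_subgroup_add[OF G])
    qed
    fix g assume g: "g \<in> G"
    obtain r where r: "r \<in> R" "g - r \<in> H" using R g unfolding transversal_def by metis
    obtain t where t: "t \<in> T" "g - r - t \<in> K" using T r unfolding transversal_def by metis
    show "\<exists>!x. x \<in> ?f ` (R \<times> T) \<and> g - x \<in> K"
    proof (rule ex1I[of _ "r + t"])
      show "r + t \<in> ?f ` (R \<times> T) \<and> g - (r + t) \<in> K" using r t by (force simp: algebra_simps)
      fix x assume "x \<in> ?f ` (R \<times> T) \<and> g - x \<in> K"
      then obtain r' t' where x: "x = r' + t'" "r' \<in> R" "t' \<in> T" "g - x \<in> K" by auto
      have "r + t - (r' + t') = (g - x) - (g - r - t)" using x by simp
      then have "r + t - (r' + t') \<in> K" using add_subgroup_diff[OF K] x t by metis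
      then show "x = r + t" using uniq r t x by metis
    qed
  qed
  then have "add_index G K = card (?f ` (R \<times> T))" by (rule add_index_transversal[OF K])
  also have "\<dots> = card (R \<times> T)"
  proof (rule card_image, rule inj_onI)
    fix x y assume "x \<in> R \<times> T" "y \<in> R \<times> T" "?f x = ?f y"
    then show "x = y"
      using uniq add_subgroup_zero[OF K] by (cases x; cases y) force
  qed
  also have "\<dots> = add_index G H * add_index H K"
    by (simp add: card_cartesian_product add_index_transversal[OF H R] add_index_transversal[OF K T])
  finally show ?thesis .
qed

text \<open>The second isomorphism theorem: the assumption says \<open>G \<subseteq> G' + H\<close>, so a transversal of \<open>G'\<close>
is also one of \<open>G\<close>.\<close>
lemma add_index_sum:
  fixes G G' H :: "'a::ab_group_add set"
  assumes H: "add_subgroup H" and G': "add_subgroup G'" and "G' \<subseteq> G"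
    and sum: "\<And>g. g \<in> G \<Longrightarrow> \<exists>g'\<in>G'. g - g' \<in> H"
  shows "add_index G H = add_index G' (G' \<inter> H)"
proof -
  have HG: "add_subgroup (G' \<inter> H)" by (rule add_subgroup_Int[OF G' H])
  obtain R where R: "transversal R G' (G' \<inter> H)" by (rule transversal_exists[OF HG])
  have RG: "R \<subseteq> G'" using R unfolding transversal_def by blast
  have "transversal R G H"
    unfolding transversal_def
  proof (intro conjI ballI)
    show "R \<subseteq> G" using RG assms(3) by blast
    fix g assume "g \<in> G"
    then obtain g' where g': "g' \<in> G'" "g - g' \<in> H" using sum by blast
    then obtain r where r: "r \<in> R" "g' - r \<in> G' \<inter> H"
        and u: "\<And>s. s \<in> R \<Longrightarrow> g' - s \<in> G' \<inter> H \<Longrightarrow> s = r"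
      using R unfolding transversal_def by metis
    show "\<exists>!r. r \<in> R \<and> g - r \<in> H"
    proof (rule ex1I[of _ r])
      have "g - r = (g - g') + (g' - r)" by simp
      then show "r \<in> R \<and> g - r \<in> H" using r g' add_subgroup_add[OF H] by (metis IntE)
      fix s assume s: "s \<in> R \<and> g - s \<in> H"
      have "g' - s = (g - s) - (g - g')" by simp
      then have "g' - s \<in> H" using s g' add_subgroup_diff[OF H] by metis
      then show "s = r" using s u g' RG add_subgroup_diff[OF G'] by blast
    qed
  qed
  then show ?thesis
    using add_index_transversal[OF H] add_index_transversal[OF HG R] by simp
qed

lemma add_subgroup_image:
  fixes f :: "'a::ab_group_add \<Rightarrow> 'b::ab_group_add"
  assumes "Modules.additive f" "add_subgroup H"
  shows "add_subgroup (f ` H)"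
proof -
  interpret f: Modules.additive f by fact
  show ?thesis
    unfolding add_subgroup_def ball_simps
    using add_subgroup_zero[OF assms(2)] add_subgroup_add[OF assms(2)] add_subgroup_minus[OF assms(2)]
    by (metis f.zero f.add f.minus imageI)
qed

lemma add_index_image:
  fixes f :: "'a::ab_group_add \<Rightarrow> 'b::ab_group_add"
  assumes f: "Modules.additive f" "inj f" and H: "add_subgroup H" and "H \<subseteq> G"
  shows "add_index (f ` G) (f ` H) = add_index G H"
proof -
  obtain R where R: "transversal R G H" by (rule transversal_exists[OF H])
  have iff: "f g - f r \<in> f ` H \<longleftrightarrow> g - r \<in> H" for g r
    using f(2) by (simp add: additive.diff[OF f(1), symmetric] inj_image_mem_iff)
  have "transversal (f ` R) (f ` G) (f ` H)"
    unfolding transversal_def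
  proof (intro conjI ballI)
    show "f ` R \<subseteq> f ` G" using R unfolding transversal_def by blast
    fix y assume "y \<in> f ` G"
    then obtain g where g: "g \<in> G" "y = f g" by auto
    then obtain r where r: "r \<in> R" "g - r \<in> H" "\<And>s. s \<in> R \<Longrightarrow> g - s \<in> H \<Longrightarrow> s = r"
      using R unfolding transversal_def by metis
    show "\<exists>!z. z \<in> f ` R \<and> y - z \<in> f ` H"
    proof (rule ex1I[of _ "f r"])
      show "f r \<in> f ` R \<and> y - f r \<in> f ` H" using r(1,2) unfolding g(2) iff by blast
      fix z assume "z \<in> f ` R \<and> y - z \<in> f ` H"
      then obtain s where "z = f s" "s \<in> R" "f g - f s \<in> f ` H" using g(2) by blast
      then show "z = f r" using r(3)[of s] iff by blast
    qed
  qed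
  then have "add_index (f ` G) (f ` H) = card (f ` R)"
    by (intro add_index_transversal add_subgroup_image f H)
  also have "\<dots> = card R" using f(2) by (metis card_image inj_on_subset subset_UNIV)
  finally show ?thesis using add_index_transversal[OF H R] by simp
qed

lemma open_translation_group:
  fixes U :: "'a::topological_ab_group_add set"
  assumes "open U" shows "open ((+) x ` U)"
proof -
  have "(+) x ` U = (\<lambda>y. y - x) -` U"
    by (auto simp: image_iff) (metis add.commute diff_add_cancel)
  moreover have "continuous_on UNIV (\<lambda>y. y - x)" by (intro continuous_intros)
  ultimately show ?thesis using open_vimage[OF assms, of "\<lambda>y. y - x"] by simp
qed

text \<open>Finiteness of the index: the cosets of \<open>H\<close> form an open cover of the compact group \<open>G\<close>, and
distinct cosets are disjoint.\<close>
lemma add_index_pos: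
  fixes G H :: "'a::topological_ab_group_add set"
  assumes G: "compact G" "add_subgroup G" and H: "open H" "add_subgroup H"
  shows "0 < add_index G H"
proof -
  let ?C = "(\<lambda>x. (+) x ` H) ` G"
  have "G \<subseteq> \<Union>?C" using add_subgroup_zero[OF H(2)] by force
  moreover have "\<forall>c\<in>?C. open c" using open_translation_group[OF H(1)] by auto
  ultimately obtain D where D: "D \<subseteq> ?C" "finite D" "G \<subseteq> \<Union>D"
    using compactE[OF G(1)] by metis
  have "?C \<subseteq> D"
  proof
    fix c assume "c \<in> ?C"
    then obtain g where g: "g \<in> G" "c = (+) g ` H" by auto
    then obtain d where d: "d \<in> D" "g \<in> d" using D by auto
    then obtain x where x: "d = (+) x ` H" using D by auto
    then have "g - x \<in> H" using d by auto
    then have "c = d" using g x coset_eq_iff[OF H(2)] by blast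
    then show "c \<in> D" using d by simp
  qed
  then have "finite ?C" using D(2) finite_subset by blast
  moreover have "?C \<noteq> {}" using add_subgroup_zero[OF G(2)] by blast
  ultimately show ?thesis unfolding add_index_def by (simp add: card_gt_0_iff)
qed

section \<open>A subgroup of minimal index splits\<close>

text \<open>Compactness allows the passage to the limit in a decomposition of \<open>x\<close> along a decreasing sequence
of compact sets.\<close>
lemma nested_compact_difference:
  fixes K :: "nat \<Rightarrow> 'a::{topological_ab_group_add, t2_space} set"
  assumes K: "\<And>n. compact (K n)" "\<And>n. K (Suc n) \<subseteq> K n" and H: "closed H"
    and ex: "\<And>n. \<exists>y\<in>K n. x - y \<in> H"
  shows "\<exists>y\<in>\<Inter>n. K n. x - y \<in> H"
proof -
  define C where "C n = K n \<inter> (\<lambda>y. x - y) -` H" for n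
  have anti: "K n \<subseteq> K m" if "m \<le> n" for m n
    using lift_Suc_antimono_le[of K m n] K(2) that by blast
  have C_closed: "closed (C n)" for n
    unfolding C_def
    by (intro closed_Int compact_imp_closed K closed_vimage H continuous_intros)
  have "K 0 \<inter> (\<Inter>n\<in>UNIV. C n) \<noteq> {}"
  proof (rule compact_imp_fip_image[OF K(1) C_closed])
    fix I :: "nat set" assume I: "finite I"
    obtain y where y: "y \<in> K (Max (insert 0 I))" "x - y \<in> H" using ex by blast
    have "y \<in> C n" if "n \<in> insert 0 I" for n
    proof -
      have "n \<le> Max (insert 0 I)" using that I by (intro Max_ge) auto
      then have "y \<in> K n" using anti y by blast
      then show ?thesis using y by (simp add: C_def)
    qed
    then show "K 0 \<inter> (\<Inter>n\<in>I. C n) \<noteq> {}" by (auto simp: C_def)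
  qed
  then show ?thesis unfolding C_def by blast
qed

lemma compact_INT:
  fixes K :: "'i \<Rightarrow> 'a::t2_space set"
  assumes "i \<in> I" "\<And>i. i \<in> I \<Longrightarrow> compact (K i)"
  shows "compact (\<Inter>i\<in>I. K i)"
proof -
  have "compact (K i \<inter> (\<Inter>i\<in>I. K i))"
    using assms by (intro compact_Int_closed closed_INT) (auto intro: compact_imp_closed)
  moreover have "K i \<inter> (\<Inter>i\<in>I. K i) = (\<Inter>i\<in>I. K i)" using assms by blast
  ultimately show ?thesis by simp
qed

lemma add_index_restrict:
  fixes G H :: "'a::ab_group_add set"
  assumes "add_subgroup H" "add_subgroup G"
  shows "add_index G H = add_index G (G \<inter> H)"
  by (rule add_index_sum[OF assms]) (use add_subgroup_zero[OF assms(1)] in force)+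

text \<open>The tidying argument of Willis, cut down to what a subgroup \<open>U\<close> of minimal index provides.
The groups \<open>V\<^sub>n = U \<inter> \<phi> U \<inter> \<dots> \<inter> \<phi>\<^sup>n U\<close> satisfy \<open>V\<^sub>n \<inter> \<phi> V\<^sub>n = U \<inter> \<phi> V\<^sub>n\<close>. Therefore the index of
\<open>V\<^sub>n\<close> counts those cosets of \<open>U \<inter> \<phi> U\<close> in \<open>\<phi> U\<close> that meet \<open>\<phi> V\<^sub>n\<close>, and by minimality these are
all of them. In the limit \<open>\<phi> U = \<phi> P + (U \<inter> \<phi> U)\<close>, which yields the value of the scale, and pulling
this back by \<open>\<phi>\<close> repeatedly pushes the second summand into \<open>M\<close>.
The equation \<open>\<phi> P \<inter> U = P\<close> is what later keeps \<open>\<phi> P\<close> inside the span of \<open>P\<close>.\<close>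
lemma tidy_above_decomposition:
  fixes f :: "'a::{topological_ab_group_add, t2_space} \<Rightarrow> 'a"
  assumes f: "topological_automorphism f"
    and ne: "(compact_open_subgroups :: 'a set set) \<noteq> {}"
  obtains U P M where "U \<in> compact_open_subgroups"
    "add_subgroup P" "compact P" "P \<subseteq> f ` P" "f ` P \<inter> U = P"
    "add_subgroup M" "compact M" "f ` M \<subseteq> M"
    "\<forall>x\<in>U. \<exists>y\<in>M. x - y \<in> P"
    "aut_scale f = add_index (f ` P) P"
proof -
  from f obtain g where add: "\<And>x y. f (x + y) = f x + f y" and fg: "homeomorphism UNIV UNIV f g"
    unfolding topological_automorphism_def by blast
  interpret f: Modules.additive f by standard (rule add)
  have cont: "continuous_on UNIV f" "continuous_on UNIV g"
    and gf: "g (f x) = x" "f (g x) = x" for x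
    using fg unfolding homeomorphism_def by auto
  have inj: "inj f" using gf by (metis injI)
  have addp: "Modules.additive (f ^^ j)" for j
    by standard (induction j, auto simp: add)
  have contp: "continuous_on UNIV (f ^^ j)" for j
    by (induction j) (auto intro: continuous_on_compose2[OF cont(1)])
  have open_f: "open (f ` V)" if "open V" for V
  proof -
    have "f ` V = g -` V" using gf by (auto simp: image_iff) metis
    then show ?thesis using that cont(2) by (metis open_vimage)
  qed
  have open_p: "open ((f ^^ j) ` V)" if "open V" for j V
  proof (induction j)
    case (Suc j)
    have "(f ^^ Suc j) ` V = f ` (f ^^ j) ` V" by (simp add: image_comp)
    then show ?case using open_f[OF Suc] by simp
  qed (use that in simp)
  let ?k = "aut_scale f"
  have "\<exists>U \<in> compact_open_subgroups. ?k = add_index (f ` U) (U \<inter> f ` U)"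
    unfolding aut_scale_def by (rule LeastI_ex) (use ne in blast)
  then obtain U where Uc: "U \<in> compact_open_subgroups" and k: "?k = add_index (f ` U) (U \<inter> f ` U)" by blast
  then have U: "add_subgroup U" "compact U" "open U" unfolding compact_open_subgroups_def by auto
  have least: "?k \<le> add_index (f ` V) (V \<inter> f ` V)" if "V \<in> compact_open_subgroups" for V
    unfolding aut_scale_def by (rule Least_le) (use that in blast)
  define Uf where "Uf n = (\<Inter>j\<in>{..n}. (f ^^ j) ` U)" for n
  define P where "P = (\<Inter>n. Uf n)"
  have P_alt: "P = (\<Inter>j. (f ^^ j) ` U)" unfolding P_def Uf_def by auto
  have sgp: "add_subgroup ((f ^^ j) ` U)" for j by (rule add_subgroup_image[OF addp U(1)])
  have cp: "compact ((f ^^ j) ` U)" for j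
    using contp U(2) by (meson compact_continuous_image continuous_on_subset subset_UNIV)
  have Uf_comp: "compact (Uf n)" for n unfolding Uf_def
    by (rule compact_INT[of 0]) (auto intro: cp)
  have Uf_mem: "Uf n \<in> compact_open_subgroups" for n
    unfolding compact_open_subgroups_def
    using Uf_comp[of n] by (auto simp: Uf_def intro!: add_subgroup_INT sgp open_INT open_p U)
  have Uf_dec: "Uf (Suc n) \<subseteq> Uf n" for n unfolding Uf_def by (rule INF_superset_mono) auto
  have Uf_U: "Uf n \<subseteq> U" for n unfolding Uf_def by force
  have fUf: "f ` Uf n \<inter> U = Uf n \<inter> f ` Uf n" for n
  proof -
    have "f ` Uf n = (\<Inter>j\<in>{..n}. (f ^^ Suc j) ` U)"
      unfolding Uf_def by (subst image_INT[of f UNIV]) (auto simp: inj image_comp)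
    then have "f ` Uf n = (\<Inter>j\<in>Suc ` {..n}. (f ^^ j) ` U)" by simp
    then have "f ` Uf n \<inter> U = (\<Inter>j\<in>insert 0 (Suc ` {..n}). (f ^^ j) ` U)" by auto
    also have "\<dots> \<subseteq> Uf n" unfolding Uf_def
    proof (rule INF_superset_mono)
      show "{..n} \<subseteq> insert 0 (Suc ` {..n})"
      proof
        fix j assume "j \<in> {..n}"
        then show "j \<in> insert 0 (Suc ` {..n})" by (cases j) auto
      qed
    qed simp
    finally show ?thesis using Uf_U by blast
  qed
  define H where "H = U \<inter> f ` U"
  have Hs: "add_subgroup H" unfolding H_def
    by (rule add_subgroup_Int[OF U(1) add_subgroup_image[OF f.additive_axioms U(1)]])
  have fU: "compact (f ` U)" "add_subgroup (f ` U)"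
    using cp[of 1] sgp[of 1] by auto
  have Hclosed: "closed H" unfolding H_def using fU U by (intro closed_Int compact_imp_closed)
  have Hopen: "open H" unfolding H_def by (intro open_Int U open_f)
  have fin: "finite ((\<lambda>x. (+) x ` H) ` f ` U)"
    using add_index_pos[OF fU Hopen Hs] unfolding add_index_def by (meson card_gt_0_iff)
  \<comment> \<open>By minimality, \<open>f (Uf n)\<close> meets no fewer cosets of \<open>H\<close> than \<open>f U\<close>, hence the same ones.\<close>
  have stepN: "\<exists>y\<in>f ` Uf n. x - y \<in> H" if x: "x \<in> f ` U" for x n
  proof -
    have s: "add_subgroup (f ` Uf n)"
      using Uf_mem[of n] add_subgroup_image[OF f.additive_axioms] unfolding compact_open_subgroups_def by blast
    have "f ` Uf n \<inter> H = Uf n \<inter> f ` Uf n" using fUf[of n] Uf_U[of n] unfolding H_def by blast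
    then have "add_index (f ` Uf n) H = add_index (f ` Uf n) (Uf n \<inter> f ` Uf n)"
      using add_index_restrict[OF Hs s] by simp
    then have "card ((\<lambda>x. (+) x ` H) ` f ` U) \<le> card ((\<lambda>x. (+) x ` H) ` f ` Uf n)"
      using least[OF Uf_mem[of n]] k unfolding H_def add_index_def by simp
    moreover have "(\<lambda>x. (+) x ` H) ` f ` Uf n \<subseteq> (\<lambda>x. (+) x ` H) ` f ` U"
      by (intro image_mono Uf_U)
    ultimately have "(\<lambda>x. (+) x ` H) ` f ` Uf n = (\<lambda>x. (+) x ` H) ` f ` U"
      by (intro card_seteq fin) auto
    then obtain y where "y \<in> f ` Uf n" "(+) x ` H = (+) y ` H" using x by (metis (no_types, lifting) imageE imageI)
    then show ?thesis using coset_eq_iff[OF Hs] by blast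
  qed
  have fP: "f ` P = (\<Inter>n. f ` Uf n)" unfolding P_def
    by (subst image_INT[of f UNIV]) (auto simp: inj)
  have step: "\<exists>y\<in>f ` P. x - y \<in> H" if x: "x \<in> f ` U" for x
    unfolding fP
  proof (rule nested_compact_difference[OF _ _ Hclosed])
    show "compact (f ` Uf n)" for n
      using Uf_comp cont by (meson compact_continuous_image continuous_on_subset subset_UNIV)
    show "f ` Uf (Suc n) \<subseteq> f ` Uf n" for n by (intro image_mono Uf_dec)
  qed (rule stepN[OF x])
  have P: "add_subgroup P" "compact P" unfolding P_alt
    by (auto intro!: add_subgroup_INT sgp compact_INT[of 0] cp)
  have PU: "P \<subseteq> U"
    using INT_lower[of 0 UNIV "\<lambda>j. (f ^^ j) ` U"] unfolding P_alt by simp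
  have fPU: "f ` P \<inter> U = P"
  proof -
    have "P \<subseteq> f ` Uf n" for n
    proof -
      have "f ` Uf n = (\<Inter>j\<in>{..n}. (f ^^ Suc j) ` U)"
        unfolding Uf_def by (subst image_INT[of f UNIV]) (auto simp: inj image_comp)
      then show ?thesis unfolding P_alt by blast
    qed
    then have "P \<subseteq> f ` P" unfolding fP by (intro INT_greatest)
    moreover have "f ` P \<inter> U \<subseteq> Uf n" for n
    proof -
      have "f ` P \<subseteq> f ` Uf n" unfolding fP by (rule INT_lower) simp
      then show ?thesis using fUf[of n] by fast
    qed
    then have "f ` P \<inter> U \<subseteq> P" unfolding P_def by (intro INT_greatest)
    ultimately show ?thesis using PU by blast
  qed
  then have PfP: "P \<subseteq> f ` P" by blast
  define MN where "MN n = (\<Inter>j\<in>{..n}. (f ^^ j) -` U)" for n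
  define M where "M = (\<Inter>n. MN n)"
  have MN_dec: "MN (Suc n) \<subseteq> MN n" for n unfolding MN_def by (rule INF_superset_mono) auto
  have MN_U: "MN n \<subseteq> U" for n unfolding MN_def by force
  have MN_closed: "closed (MN n)" for n unfolding MN_def
    using contp U compact_imp_closed by (intro closed_INT ballI closed_vimage) auto
  have MN_comp: "compact (MN n)" for n
    using compact_Int_closed[OF U(2) MN_closed[of n]] MN_U[of n] by (simp add: inf.absorb2)
  have sgv: "add_subgroup ((f ^^ j) -` U)" for j
    using U(1) additive.add[OF addp, of j] additive.zero[OF addp, of j] additive.minus[OF addp, of j]
    unfolding add_subgroup_def by simp
  have M: "add_subgroup M" "compact M" unfolding M_def
    by (auto intro!: compact_INT[of 0] MN_comp) (auto simp: MN_def intro!: add_subgroup_INT sgv)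
  \<comment> \<open>The part outside \<open>P\<close> is improved from \<open>MN n\<close> to \<open>MN (Suc n)\<close> by decomposing its image under \<open>f\<close>.\<close>
  have decN: "\<exists>y\<in>MN n. x - y \<in> P" if "x \<in> U" for x n
    using that
  proof (induction n arbitrary: x)
    case 0
    then show ?case by (intro bexI[of _ x]) (auto simp: MN_def add_subgroup_zero[OF P(1)])
  next
    case (Suc n)
    obtain p where p: "p \<in> P" "f x - f p \<in> H" using step[of "f x"] Suc.prems by blast
    define u where "u = x - p"
    have fu: "f u = f x - f p" by (simp add: u_def f.diff)
    have u: "u \<in> U" "f u \<in> U"
      using p fu PU Suc.prems add_subgroup_diff[OF U(1)] unfolding u_def H_def by auto
    obtain m where m: "m \<in> MN n" "f u - m \<in> P" using Suc.IH[OF u(2)] by blast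
    obtain q where q: "q \<in> P" "f u - m = f q" using m(2) PfP by blast
    have "f (u - q) = m" using q(2) by (simp add: f.diff algebra_simps)
    have "(f ^^ j) (u - q) \<in> U" if "j \<le> Suc n" for j
    proof (cases j)
      case 0 then show ?thesis using u q PU add_subgroup_diff[OF U(1)] by auto
    next
      case (Suc i)
      then have "(f ^^ j) (u - q) = (f ^^ i) m" using \<open>f (u - q) = m\<close> by (simp add: funpow_swap1)
      then show ?thesis using m(1) that Suc unfolding MN_def by auto
    qed
    then have "u - q \<in> MN (Suc n)" unfolding MN_def by auto
    moreover have "x - (u - q) \<in> P" using p q add_subgroup_add[OF P(1)] by (simp add: u_def)
    ultimately show ?case by blast
  qed
  have dec: "\<exists>y\<in>M. x - y \<in> P" if "x \<in> U" for x
    unfolding M_def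
    by (rule nested_compact_difference[where K = MN, OF MN_comp MN_dec compact_imp_closed[OF P(2)] decN[OF that]])
  have M_iff: "x \<in> M \<longleftrightarrow> (\<forall>j. (f ^^ j) x \<in> U)" for x
    unfolding M_def MN_def by auto
  have fM: "f ` M \<subseteq> M"
  proof
    fix y assume "y \<in> f ` M"
    then obtain x where x: "y = f x" "x \<in> M" by (elim imageE)
    have "(f ^^ j) y \<in> U" for j
    proof -
      have "(f ^^ Suc j) x \<in> U" using x(2) M_iff by blast
      then show ?thesis using x(1) by (simp add: funpow_swap1)
    qed
    then show "y \<in> M" using M_iff by simp
  qed
  have "?k = add_index (f ` P) (f ` P \<inter> H)"
    unfolding k H_def[symmetric]
    by (rule add_index_sum[OF Hs add_subgroup_image[OF f.additive_axioms P(1)]]) (use PU step in auto)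
  moreover have "f ` P \<inter> H = P" using fPU PU unfolding H_def by blast
  ultimately have scale: "?k = add_index (f ` P) P" by simp
  show ?thesis by (rule that[OF Uc P PfP fPU M fM _ scale]) (intro ballI dec)
qed

section \<open>The topology of the p-adic numbers\<close>

lemma padic_norm_0 [simp]: "padic_norm (0 :: 'p::prime_card padic) = 0"
  by (simp add: padic_norm_eq_0_iff)

lemma padic_norm_1 [simp]: "padic_norm (1 :: 'p::prime_card padic) = 1"
  using padic_norm_mult[of 1 "1 :: 'p padic"] padic_norm_eq_0_iff[of "1 :: 'p padic"] by simp

lemma padic_norm_inverse: "padic_norm (inverse x :: 'p::prime_card padic) = inverse (padic_norm x)"
proof (cases "x = 0")
  case False
  then have "padic_norm (inverse x) * padic_norm x = 1"
    by (metis padic_norm_mult left_inverse padic_norm_1)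
  then show ?thesis using inverse_unique[of "padic_norm x" "padic_norm (inverse x)"] by (simp add: mult.commute)
qed simp

lemma padic_norm_power: "padic_norm (x ^ n :: 'p::prime_card padic) = padic_norm x ^ n"
  by (induction n) (simp_all add: padic_norm_mult)

lemma padic_norm_add_le:
  "padic_norm x \<le> r \<Longrightarrow> padic_norm y \<le> r \<Longrightarrow> padic_norm (x + y :: 'p::prime_card padic) \<le> r"
  using padic_norm_ultrametric[of x y] by linarith

lemma padic_norm_diff_le:
  "padic_norm x \<le> r \<Longrightarrow> padic_norm y \<le> r \<Longrightarrow> padic_norm (x - y :: 'p::prime_card padic) \<le> r"
  using padic_norm_add_le[of x r "- y"] by (simp add: padic_norm_minus)

lemma padic_norm_of_nat_le_1: "padic_norm (of_nat k :: 'p::prime_card padic) \<le> 1"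
  by (induction k) (auto intro: padic_norm_add_le)

instance padic :: (prime_card) topological_ab_group_add
proof
  fix a b :: "'a padic"
  show "((\<lambda>x. fst x + snd x) \<longlongrightarrow> a + b) (nhds a \<times>\<^sub>F nhds b)"
  proof (rule tendstoI)
    fix e :: real assume e: "0 < e"
    have "eventually (\<lambda>x. dist x c < e) (nhds c)" for c :: "'a padic"
      using e eventually_nhds_metric by blast
    from eventually_prodI[OF this this]
    have "eventually (\<lambda>x. dist (fst x) a < e \<and> dist (snd x) b < e) (nhds a \<times>\<^sub>F nhds b)" .
    then show "eventually (\<lambda>x. dist (fst x + snd x) (a + b) < e) (nhds a \<times>\<^sub>F nhds b)"
    proof (rule eventually_mono)
      fix x :: "'a padic \<times> 'a padic" assume x: "dist (fst x) a < e \<and> dist (snd x) b < e"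
      have eq: "fst x + snd x - (a + b) = (fst x - a) + (snd x - b)" by simp
      have "padic_norm ((fst x - a) + (snd x - b)) < e"
        using x padic_norm_ultrametric[of "fst x - a" "snd x - b"] unfolding dist_padic_def by linarith
      then show "dist (fst x + snd x) (a + b) < e" unfolding dist_padic_def eq .
    qed
  qed
  show "(uminus \<longlongrightarrow> - a) (nhds a)"
  proof (rule tendstoI)
    fix e :: real assume e: "0 < e"
    have "eventually (\<lambda>x. dist x a < e) (nhds a)"
      using e eventually_nhds_metric by blast
    moreover have "dist (- x) (- a) = dist x a" for x
      using padic_norm_minus[of "x - a"] by (simp add: dist_padic_def)
    ultimately show "eventually (\<lambda>x. dist (- x) (- a) < e) (nhds a)" by simp
  qed
qed

lemma tendsto_padic_mult [tendsto_intros]: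
  fixes f g :: "_ \<Rightarrow> 'p::prime_card padic"
  assumes f: "(f \<longlongrightarrow> a) F" and g: "(g \<longlongrightarrow> b) F"
  shows "((\<lambda>x. f x * g x) \<longlongrightarrow> a * b) F"
proof (rule tendstoI)
  fix e :: real assume e: "0 < e"
  define r where "r = max 1 (max (padic_norm a) (padic_norm b))"
  have r: "r \<ge> 1" "padic_norm a \<le> r" "padic_norm b \<le> r" unfolding r_def by auto
  define d where "d = min 1 (e / r)"
  have d: "0 < d" "d \<le> 1" "r * d \<le> e" using e r unfolding d_def by (auto simp: min_def field_simps)
  have "eventually (\<lambda>x. dist (f x) a < d) F" "eventually (\<lambda>x. dist (g x) b < d) F"
    using tendstoD[OF f d(1)] tendstoD[OF g d(1)] by auto
  then show "eventually (\<lambda>x. dist (f x * g x) (a * b) < e) F"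
  proof eventually_elim
    case (elim x)
    have gx: "padic_norm (g x) \<le> r"
    proof -
      have "g x = (g x - b) + b" by simp
      then show ?thesis
        using elim(2) d r padic_norm_add_le[of "g x - b" r b] unfolding dist_padic_def by simp
    qed
    have 1: "padic_norm ((f x - a) * g x) < e"
    proof -
      have "padic_norm ((f x - a) * g x) \<le> padic_norm (f x - a) * r"
        unfolding padic_norm_mult by (intro mult_left_mono gx padic_norm_nonneg)
      also have "\<dots> < d * r" using elim(1) r unfolding dist_padic_def by simp
      finally show ?thesis using d(3) by (simp add: mult.commute)
    qed
    have 2: "padic_norm (a * (g x - b)) < e"
    proof -
      have "padic_norm (a * (g x - b)) \<le> r * padic_norm (g x - b)"
        unfolding padic_norm_mult by (intro mult_right_mono r padic_norm_nonneg)
      also have "\<dots> < r * d" using elim(2) r unfolding dist_padic_def by simp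
      finally show ?thesis using d(3) by simp
    qed
    have "f x * g x - a * b = (f x - a) * g x + a * (g x - b)" by (simp add: algebra_simps)
    then show ?case
      using 1 2 padic_norm_ultrametric[of "(f x - a) * g x" "a * (g x - b)"]
      unfolding dist_padic_def by simp
  qed
qed

text \<open>The embedding of the rationals is defined through constant Cauchy sequences, so that its norm can
be read off from the absolute value on the rationals.\<close>
lift_definition padic_of_rat :: "rat \<Rightarrow> 'p::prime_card padic_seq" is "\<lambda>q n. q"
  by (simp add: padic_cauchy_const prime_card)

definition rat_padic :: "rat \<Rightarrow> 'p::prime_card padic" where "rat_padic q = abs_padic (padic_of_rat q)"

lemma rat_padic_add: "rat_padic (a + b) = (rat_padic a + rat_padic b :: 'p::prime_card padic)"
proof -
  have "padic_of_rat (a + b) = (padic_of_rat a + padic_of_rat b :: 'p padic_seq)" by transfer simp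
  then show ?thesis by (simp add: rat_padic_def plus_padic.abs_eq)
qed

lemma rat_padic_diff: "rat_padic (a - b) = (rat_padic a - rat_padic b :: 'p::prime_card padic)"
proof -
  have "padic_of_rat (a - b) = (padic_of_rat a - padic_of_rat b :: 'p padic_seq)" by transfer simp
  then show ?thesis by (simp add: rat_padic_def minus_padic.abs_eq)
qed

lemma rat_padic_mult: "rat_padic (a * b) = (rat_padic a * rat_padic b :: 'p::prime_card padic)"
proof -
  have "padic_of_rat (a * b) = (padic_of_rat a * padic_of_rat b :: 'p padic_seq)" by transfer simp
  then show ?thesis by (simp add: rat_padic_def times_padic.abs_eq)
qed

lemma rat_padic_1: "rat_padic 1 = (1 :: 'p::prime_card padic)"
proof -
  have "padic_of_rat 1 = (1 :: 'p padic_seq)" by transfer simp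
  then show ?thesis by (simp add: rat_padic_def one_padic.abs_eq)
qed

lemma rat_padic_0: "rat_padic 0 = (0 :: 'p::prime_card padic)"
  using rat_padic_diff[of 0 0, where 'p='p] by simp

lemma rat_padic_of_nat: "rat_padic (of_nat k) = (of_nat k :: 'p::prime_card padic)"
  by (induction k) (simp_all add: rat_padic_0 rat_padic_1 rat_padic_add)

lemma rat_padic_of_int: "rat_padic (of_int k) = (of_int k :: 'p::prime_card padic)"
proof (cases k rule: int_cases2)
  case (nonneg n)
  then show ?thesis using rat_padic_of_nat[of n, where 'p='p] by simp
next
  case (nonpos n)
  then have "rat_padic (of_int k) = (rat_padic 0 - rat_padic (of_nat n) :: 'p padic)"
    by (simp add: rat_padic_diff[symmetric])
  then show ?thesis using nonpos by (simp add: rat_padic_of_nat rat_padic_0)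
qed

lemma padic_norm_rat: "padic_norm (rat_padic q :: 'p::prime_card padic) = rat_padic_abs CARD('p) q"
  by (simp add: rat_padic_def padic_norm.abs_eq padic_seq_norm.rep_eq padic_of_rat.rep_eq)



lemma padic_norm_of_int_le_1: "padic_norm (of_int k :: 'p::prime_card padic) \<le> 1"
proof (cases k rule: int_cases2)
  case (nonneg n) then show ?thesis using padic_norm_of_nat_le_1[of n, where 'p='p] by simp
next
  case (nonpos n) then show ?thesis using padic_norm_of_nat_le_1[of n, where 'p='p] by (simp add: padic_norm_minus)
qed

lemma padic_norm_of_int_unit:
  assumes "\<not> int CARD('p) dvd d"
  shows "padic_norm (of_int d :: 'p::prime_card padic) = 1"
proof -
  have "d \<noteq> 0" using assms by auto
  then have "rat_padic_abs CARD('p) (of_int d / of_int 1) = 1"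
    using rat_padic_abs_Fract[OF prime_card[where 'a='p], of d 1] assms
    by (simp add: not_dvd_imp_multiplicity_0)
  then show ?thesis using padic_norm_rat[of "of_int d", where 'p='p] by (simp add: rat_padic_of_int)
qed

lemma padic_cauchy_tail_dist:
  fixes X :: "'p::prime_card padic_seq"
  assumes "\<And>m. m \<ge> N \<Longrightarrow> rat_padic_abs CARD('p) (Rep_padic_seq X m - q) \<le> e"
  shows "dist (rat_padic q) (abs_padic X) \<le> e"
proof -
  have "dist (abs_padic X) (rat_padic q) = padic_seq_norm (X - padic_of_rat q)"
    by (simp add: dist_padic_def rat_padic_def minus_padic.abs_eq padic_norm.abs_eq)
  also have "\<dots> = lim (\<lambda>n. rat_padic_abs CARD('p) (Rep_padic_seq (X - padic_of_rat q) n))"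
    by (simp add: padic_seq_norm.rep_eq)
  also have "\<dots> \<le> e"
  proof (rule LIMSEQ_le_const2)
    show "(\<lambda>n. rat_padic_abs CARD('p) (Rep_padic_seq (X - padic_of_rat q) n)) \<longlonglongrightarrow>
       lim (\<lambda>n. rat_padic_abs CARD('p) (Rep_padic_seq (X - padic_of_rat q) n))"
      using Rep_padic_seq by (intro padic_cauchy_abs_tendsto) blast
    show "\<exists>N. \<forall>n\<ge>N. rat_padic_abs CARD('p) (Rep_padic_seq (X - padic_of_rat q) n) \<le> e"
      using assms by (intro exI[of _ N]) (simp add: minus_padic_seq.rep_eq padic_of_rat.rep_eq)
  qed
  finally show ?thesis by (simp add: dist_commute)
qed

lemma rat_padic_tendsto:
  "(\<lambda>n. rat_padic (Rep_padic_seq X n)) \<longlonglongrightarrow> (abs_padic X :: 'p::prime_card padic)"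
proof (rule tendstoI)
  fix e :: real assume e: "0 < e"
  have "padic_cauchy CARD('p) (Rep_padic_seq X)" using Rep_padic_seq by blast
  then obtain N where N: "\<And>m n. m \<ge> N \<Longrightarrow> n \<ge> N \<Longrightarrow>
      rat_padic_abs CARD('p) (Rep_padic_seq X m - Rep_padic_seq X n) < e / 2"
    using e unfolding padic_cauchy_def by (meson half_gt_zero)
  have "dist (rat_padic (Rep_padic_seq X n)) (abs_padic X) < e" if "n \<ge> N" for n
  proof -
    have "dist (rat_padic (Rep_padic_seq X n)) (abs_padic X) \<le> e / 2"
      by (rule padic_cauchy_tail_dist[of N]) (use N that in \<open>auto intro: less_imp_le\<close>)
    then show ?thesis using e by simp
  qed
  then show "eventually (\<lambda>n. dist (rat_padic (Rep_padic_seq X n)) (abs_padic X) < e) sequentially"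
    unfolding eventually_sequentially by blast
qed

lemma rat_padic_dense:
  fixes x :: "'p::prime_card padic"
  assumes "0 < e"
  obtains q where "dist (rat_padic q) x < e"
proof -
  obtain X where X: "x = abs_padic X" by (metis Quotient3_abs_rep[OF Quotient3_padic])
  have "eventually (\<lambda>n. dist (rat_padic (Rep_padic_seq X n)) x < e) sequentially"
    unfolding X by (rule tendstoD[OF rat_padic_tendsto assms])
  then show ?thesis using that unfolding eventually_sequentially by blast
qed

text \<open>A Cauchy sequence of \<open>p\<close>-adic numbers is replaced by a sequence of rationals with the same limiting
behaviour; the latter is a Cauchy sequence of rationals and thus represents the limit.\<close>
instance padic :: (prime_card) complete_space
proof
  fix X :: "nat \<Rightarrow> 'a padic" assume X: "Cauchy X"
  have "\<exists>q. dist (rat_padic q) (X n) < inverse (Suc n)" for n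
    using rat_padic_dense[of "inverse (Suc n)" "X n"] by auto
  then obtain q where q: "\<And>n. dist (rat_padic (q n)) (X n) < inverse (Suc n)" by metis
  have lim0: "(\<lambda>n. dist (rat_padic (q n)) (X n)) \<longlonglongrightarrow> 0"
    by (rule tendsto_sandwich[OF _ _ tendsto_const LIMSEQ_inverse_real_of_nat])
       (use q in \<open>auto intro!: always_eventually less_imp_le\<close>)
  have "padic_cauchy CARD('a) q"
    unfolding padic_cauchy_def
  proof (intro allI impI)
    fix e :: real assume e: "0 < e"
    obtain M where M: "\<And>m n. m \<ge> M \<Longrightarrow> n \<ge> M \<Longrightarrow> dist (X m) (X n) < e / 3"
      using X e unfolding Cauchy_def by (meson divide_pos_pos zero_less_numeral)
    have "eventually (\<lambda>n. dist (rat_padic (q n)) (X n) < e / 3) sequentially"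
      using order_tendstoD(2)[OF lim0, of "e / 3"] e by simp
    then obtain N where N: "\<And>n. n \<ge> N \<Longrightarrow> dist (rat_padic (q n)) (X n) < e / 3"
      unfolding eventually_sequentially by blast
    have "rat_padic_abs CARD('a) (q m - q n) < e" if "m \<ge> max M N" "n \<ge> max M N" for m n
    proof -
      have "dist (rat_padic (q m)) (rat_padic (q n) :: 'a padic) < e"
        using M[of m n] N[of m] N[of n] that
          dist_triangle[of "rat_padic (q m)" "rat_padic (q n)" "X m"]
          dist_triangle[of "X m" "rat_padic (q n)" "X n"]
        by (simp add: dist_commute)
      then show ?thesis
        unfolding dist_padic_def by (metis padic_norm_rat rat_padic_diff)
    qed
    then show "\<exists>N. \<forall>m\<ge>N. \<forall>n\<ge>N. rat_padic_abs CARD('a) (q m - q n) < e" by blast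
  qed
  then have rep: "Rep_padic_seq (Abs_padic_seq q :: 'a padic_seq) = q"
    by (intro Abs_padic_seq_inverse) simp
  define L :: "'a padic" where "L = abs_padic (Abs_padic_seq q)"
  have "(\<lambda>n. rat_padic (q n)) \<longlonglongrightarrow> L"
    using rat_padic_tendsto[of "Abs_padic_seq q :: 'a padic_seq"] unfolding rep L_def .
  then have "(\<lambda>n. dist (rat_padic (q n)) L) \<longlonglongrightarrow> 0" by (simp add: tendsto_dist_iff[symmetric])
  from tendsto_add[OF lim0 this]
  have "(\<lambda>n. dist (rat_padic (q n)) (X n) + dist (rat_padic (q n)) L) \<longlonglongrightarrow> 0" by simp
  then have "(\<lambda>n. dist (X n) L) \<longlonglongrightarrow> 0"
    by (rule Lim_null_comparison[rotated]) (simp add: dist_triangle3)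
  then have "X \<longlonglongrightarrow> L" by (subst tendsto_dist_iff)
  then show "convergent X" by (auto simp: convergent_def)
qed

text \<open>In an ultrametric field every triangle is isosceles; hence the norm takes the same values on
\<open>p\<close>-adic numbers as on rationals.\<close>
lemma padic_norm_eqI:
  fixes x y :: "'p::prime_card padic"
  assumes "padic_norm (x - y) < padic_norm x"
  shows "padic_norm x = padic_norm y"
proof (rule antisym)
  show "padic_norm x \<le> padic_norm y"
    using padic_norm_ultrametric[of "x - y" y] assms by (simp add: max_def split: if_splits)
  have "padic_norm y \<le> max (padic_norm x) (padic_norm (- (x - y)))"
    using padic_norm_ultrametric[of x "- (x - y)"] by simp
  then show "padic_norm y \<le> padic_norm x" using assms by (simp only: padic_norm_minus)
qed

lemma padic_norm_powi:
  fixes x :: "'p::prime_card padic"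
  assumes x: "x \<noteq> 0"
  obtains k :: int where "padic_norm x = real CARD('p) powi k"
proof -
  have pos: "0 < padic_norm x" using x padic_norm_nonneg[of x] padic_norm_eq_0_iff[of x] by linarith
  obtain q where "dist (rat_padic q) x < padic_norm x" by (rule rat_padic_dense[OF pos])
  then have eq: "padic_norm x = rat_padic_abs CARD('p) q"
    using padic_norm_eqI[of x "rat_padic q"] unfolding padic_norm_rat[symmetric] dist_padic_def
    by (metis padic_norm_minus minus_diff_eq)
  have "q \<noteq> 0" using eq pos by auto
  then show ?thesis using that eq unfolding rat_padic_abs_def by auto
qed

text \<open>The natural numbers below \<open>p\<^sup>m\<close> represent all residues of \<open>p\<close>-adic integers modulo \<open>p\<^sup>m\<close>: a
nearby rational has a denominator prime to \<open>p\<close>, which can be inverted modulo \<open>p\<^sup>m\<close>. This gives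
total boundedness of the integers, density of the natural numbers in them, and, for
\<open>m = 1\<close>, the size of the residue field.\<close>
lemma padic_nat_approx:
  fixes x :: "'p::prime_card padic"
  assumes x: "padic_norm x \<le> 1"
  obtains k where "k < CARD('p) ^ m" "padic_norm (x - of_nat k) \<le> (1 / CARD('p)) ^ m"
proof -
  let ?p = "CARD('p)"
  note p = prime_card[where 'a='p]
  have p1: "?p > 1" using p prime_gt_1_nat by blast
  let ?e = "(1 / real ?p) ^ m"
  have e: "0 < ?e" "?e \<le> 1" using p1 by (auto intro: power_le_one)
  obtain q where q: "dist (rat_padic q) x < ?e" by (rule rat_padic_dense[OF e(1)])
  obtain n d where nd: "quotient_of q = (n, d)" by (cases "quotient_of q")
  have d0: "d > 0" and co: "coprime n d" and qnd: "q = of_int n / of_int d"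
    using quotient_of_denom_pos[OF nd] quotient_of_coprime[OF nd] quotient_of_div[OF nd] by auto
  have qle: "rat_padic_abs ?p q \<le> 1"
  proof -
    have "rat_padic q = (rat_padic q - x) + x" by simp
    then have "padic_norm (rat_padic q :: 'p padic) \<le> 1"
      using padic_norm_add_le[of "rat_padic q - x" 1 x] q x e unfolding dist_padic_def by simp
    then show ?thesis by (simp add: padic_norm_rat)
  qed
  have cop: "coprime (int ?p) d"
  proof (rule ccontr)
    assume "\<not> coprime (int ?p) d"
    then have pd: "int ?p dvd d" using p by (metis prime_imp_coprime prime_nat_int_transfer)
    then have pn: "\<not> int ?p dvd n"
      using coprime_common_divisor[OF co, of "int ?p"] pd p1 by auto
    then have n0: "n \<noteq> 0" by auto
    have md: "multiplicity (int ?p) d \<ge> 1"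
      using pd d0 p1 by (intro multiplicity_geI) auto
    have mn: "multiplicity (int ?p) n = 0" using pn by (rule not_dvd_imp_multiplicity_0)
    have "rat_padic_abs ?p q = real ?p ^ multiplicity (int ?p) d"
      unfolding qnd using rat_padic_abs_Fract[OF p n0, of d] d0 mn by simp
    moreover have "real ?p ^ multiplicity (int ?p) d > 1" using md p1 by (intro one_less_power) auto
    ultimately show False using qle by simp
  qed
  then have "coprime (int ?p ^ m) d" by simp
  then obtain c where c: "[d * c = 1] (mod (int ?p ^ m))"
    using cong_solve_coprime_int[of d "int ?p ^ m"] by (auto simp: coprime_commute)
  define k where "k = nat ((n * c) mod (int ?p ^ m))"
  have kint: "int k = (n * c) mod (int ?p ^ m)" using p1 by (simp add: k_def)
  have "k < ?p ^ m"
  proof -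
    have "int k < int ?p ^ m" unfolding kint using p1 by (intro pos_mod_bound) simp
    then show ?thesis by (metis of_nat_less_iff of_nat_power)
  qed
  moreover have "padic_norm (x - of_nat k) \<le> ?e"
  proof -
    have "[d * int k = n] (mod (int ?p ^ m))"
    proof -
      have "[d * int k = d * (n * c)] (mod (int ?p ^ m))" unfolding kint by (intro cong_mult) (auto simp: cong_def)
      also have "d * (n * c) = n * (d * c)" by simp
      also have "[n * (d * c) = n * 1] (mod (int ?p ^ m))" by (intro cong_mult c cong_refl)
      finally show ?thesis by simp
    qed
    then obtain t where t: "n - d * int k = int ?p ^ m * t"
      by (metis cong_iff_dvd_diff cong_sym dvdE)
    have nd1: "padic_norm (of_int d :: 'p padic) = 1"
      using cop p1 by (intro padic_norm_of_int_unit) (auto simp: coprime_absorb_left)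
    have "rat_padic q * of_int d = (of_int n :: 'p padic)"
      using d0 by (simp add: rat_padic_of_int[symmetric] rat_padic_mult[symmetric] qnd)
    then have "(rat_padic q - of_nat k) * of_int d = (of_int (n - d * int k) :: 'p padic)"
      by (simp add: algebra_simps)
    also have "\<dots> = of_nat ?p ^ m * of_int t" unfolding t by simp
    finally have "padic_norm (rat_padic q - of_nat k :: 'p padic) * padic_norm (of_int d :: 'p padic)
        = padic_norm (of_nat ?p :: 'p padic) ^ m * padic_norm (of_int t :: 'p padic)"
      by (metis padic_norm_mult padic_norm_power)
    then have "padic_norm (rat_padic q - of_nat k :: 'p padic) \<le> ?e"
      using nd1 padic_norm_of_int_le_1[of t, where 'p='p] e
      by (simp add: padic_norm_prime mult_left_le)
    moreover have "x - of_nat k = (x - rat_padic q) + (rat_padic q - of_nat k)" by simp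
    moreover have "padic_norm (x - rat_padic q) \<le> ?e"
      using q unfolding dist_padic_def by (metis less_imp_le padic_norm_minus minus_diff_eq)
    ultimately show ?thesis using padic_norm_add_le by metis
  qed
  ultimately show ?thesis by (rule that)
qed

lemma padic_small_power:
  assumes "0 < (e::real)"
  obtains m where "(1 / real CARD('p::prime_card)) ^ m < e"
  using real_arch_pow_inv[OF assms, of "1 / real CARD('p)"] prime_gt_1_nat[OF prime_card[where 'a='p]] by auto

lemma closed_padic_le: "closed {x :: 'p::prime_card padic. padic_norm x \<le> r}"
proof -
  have "{x :: 'p padic. padic_norm x \<le> r} = cball 0 r" by (auto simp: dist_padic_def padic_norm_minus)
  then show ?thesis by simp
qed

lemma open_padic_le: "0 < r \<Longrightarrow> open {x :: 'p::prime_card padic. padic_norm x \<le> r}"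
  unfolding open_dist
proof (intro ballI)
  fix x :: "'p padic" assume r: "0 < r" and x: "x \<in> {x. padic_norm x \<le> r}"
  have "padic_norm y \<le> r" if "dist y x < r" for y
    using padic_norm_add_le[of "y - x" r x] x that by (simp add: dist_padic_def)
  then show "\<exists>e>0. \<forall>y. dist y x < e \<longrightarrow> y \<in> {x. padic_norm x \<le> r}" using r by blast
qed

lemma compact_padic_integers: "compact {x :: 'p::prime_card padic. padic_norm x \<le> 1}"
  unfolding compact_eq_totally_bounded
proof (intro conjI allI impI)
  show "complete {x :: 'p padic. padic_norm x \<le> 1}"
    by (simp add: complete_eq_closed closed_padic_le)
  fix e :: real assume "0 < e"
  then obtain m where m: "(1 / real CARD('p)) ^ m < e" by (rule padic_small_power)
  let ?K = "(of_nat :: nat \<Rightarrow> 'p padic) ` {..<CARD('p) ^ m}"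
  have "{x :: 'p padic. padic_norm x \<le> 1} \<subseteq> (\<Union>x\<in>?K. ball x e)"
  proof
    fix x :: "'p padic" assume "x \<in> {x. padic_norm x \<le> 1}"
    then obtain k where k: "k < CARD('p) ^ m" "padic_norm (x - of_nat k) \<le> (1 / CARD('p)) ^ m"
      using padic_nat_approx[of x m] by blast
    then have "x \<in> ball (of_nat k) e" using m by (simp add: dist_commute) (simp add: dist_padic_def)
    then show "x \<in> (\<Union>x\<in>?K. ball x e)" using k(1) by blast
  qed
  moreover have "finite ?K" by simp
  ultimately show "\<exists>k. finite k \<and> {x :: 'p padic. padic_norm x \<le> 1} \<subseteq> (\<Union>x\<in>k. ball x e)"
    by (intro exI[of _ ?K] conjI)
qed

lemma padic_large_element:
  obtains c :: "'p::prime_card padic" where "c \<noteq> 0" "r \<le> padic_norm c"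
proof -
  have "1 < real CARD('p)" using prime_gt_1_nat[OF prime_card[where 'a='p]] by simp
  then obtain m where m: "r < real CARD('p) ^ m" using real_arch_pow[of "real CARD('p)" r] by blast
  let ?c = "inverse (of_nat CARD('p)) ^ m :: 'p padic"
  have n: "padic_norm ?c = real CARD('p) ^ m" 
    unfolding padic_norm_power padic_norm_inverse padic_norm_prime by simp
  have "0 < real CARD('p) ^ m" using prime_gt_1_nat[OF prime_card[where 'a='p]] by simp
  then have "?c \<noteq> 0" using padic_norm_eq_0_iff[of ?c] n by linarith
  moreover have "r \<le> padic_norm ?c" using n m by linarith
  ultimately show ?thesis by (rule that)
qed

text \<open>Every ball lies in a multiple of the ring of integers.\<close>
lemma compact_padic_le: "compact {x :: 'p::prime_card padic. padic_norm x \<le> r}"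
proof -
  obtain c :: "'p padic" where c: "c \<noteq> 0" "r \<le> padic_norm c" by (rule padic_large_element)
  have nc: "0 < padic_norm c" using c padic_norm_nonneg[of c] padic_norm_eq_0_iff[of c] by linarith
  have "compact ((*) c ` {x :: 'p padic. padic_norm x \<le> 1})"
    by (intro compact_continuous_image compact_padic_integers)
       (auto simp: continuous_on_def intro!: tendsto_intros)
  moreover have "{x :: 'p padic. padic_norm x \<le> r} \<subseteq> (*) c ` {x :: 'p padic. padic_norm x \<le> 1}"
  proof
    fix x :: "'p padic" assume "x \<in> {x. padic_norm x \<le> r}"
    then have "padic_norm (inverse c * x) \<le> 1"
      unfolding padic_norm_mult padic_norm_inverse using c(2) nc by (simp add: field_simps)
    moreover have "x = c * (inverse c * x)" using c by (simp add: mult.assoc[symmetric])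
    ultimately show "x \<in> (*) c ` {x. padic_norm x \<le> 1}" by (intro image_eqI[of _ _ "inverse c * x"]) auto
  qed
  ultimately show ?thesis using closed_padic_le[of r, where 'p='p]
    by (metis compact_Int_closed inf.absorb_iff2)
qed

instance padic :: (prime_card) heine_borel
proof
  fix f :: "nat \<Rightarrow> 'a padic" assume "bounded (range f)"
  then obtain r where r: "\<forall>y\<in>range f. dist 0 y \<le> r" using bounded_any_center by blast
  let ?K = "{x :: 'a padic. padic_norm x \<le> r}"
  have "f n \<in> ?K" for n
  proof -
    have "dist 0 (f n) \<le> r" using r by blast
    then show ?thesis by (simp add: dist_padic_def padic_norm_minus)
  qed
  moreover have K: "seq_compact ?K"
    using compact_padic_le compact_eq_seq_compact_metric by blast
  ultimately obtain l s where "strict_mono s" "(f \<circ> s) \<longlonglongrightarrow> l"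
    using seq_compactE[OF K, of f] by blast
  then show "\<exists>l r. strict_mono r \<and> (f \<circ> r) \<longlonglongrightarrow> l" by blast
qed

section \<open>Compact open subgroups and their volume\<close>

instance vec :: (topological_monoid_add, finite) topological_monoid_add
proof
  fix a b :: "'a ^ 'b"
  show "((\<lambda>x. fst x + snd x) \<longlongrightarrow> a + b) (nhds a \<times>\<^sub>F nhds b)"
  proof (rule vec_tendstoI)
    fix i
    have "((\<lambda>x. fst x $ i) \<longlongrightarrow> a $ i) (nhds a \<times>\<^sub>F nhds b)"
         "((\<lambda>x. snd x $ i) \<longlongrightarrow> b $ i) (nhds a \<times>\<^sub>F nhds b)"
      by (intro tendsto_vec_nth filterlim_fst filterlim_snd)+
    then show "((\<lambda>x. (fst x + snd x) $ i) \<longlongrightarrow> (a + b) $ i) (nhds a \<times>\<^sub>F nhds b)"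
      unfolding vector_add_component by (rule tendsto_add)
  qed
qed

instance vec :: (topological_group_add, finite) topological_group_add
proof
  fix a :: "'a ^ 'b"
  show "(uminus \<longlongrightarrow> - a) (nhds a)"
  proof (rule vec_tendstoI)
    fix i
    have "((\<lambda>x. x $ i) \<longlongrightarrow> a $ i) (nhds a)" by (intro tendsto_vec_nth filterlim_ident)
    then show "((\<lambda>x. (- x) $ i) \<longlongrightarrow> (- a) $ i) (nhds a)"
      unfolding vector_uminus_component by (rule tendsto_minus)
  qed
qed

instance vec :: (topological_ab_group_add, finite) topological_ab_group_add ..

lemma tendsto_padic_matrix_vector:
  fixes A :: "'p::prime_card padic ^ 'n ^ 'm"
  assumes "(f \<longlongrightarrow> x) F" shows "((\<lambda>t. A *v f t) \<longlongrightarrow> A *v x) F"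
  unfolding matrix_vector_mult_def
  by (intro tendsto_vec_lambda tendsto_sum tendsto_padic_mult tendsto_const tendsto_vec_nth assms)

lemma continuous_on_padic_matrix_vector:
  "continuous_on S ((*v) (A :: 'p::prime_card padic ^ 'n ^ 'm))"
  unfolding continuous_on_def by (intro ballI tendsto_padic_matrix_vector tendsto_ident_at)

definition polydisc :: "('n \<Rightarrow> real) \<Rightarrow> ('p::prime_card padic ^ 'n) set" where
  "polydisc r = {x. \<forall>i. padic_norm (x $ i) \<le> r i}"

lemma polydisc_compact_open_subgroup:
  assumes r: "\<And>i. 0 < r i"
  shows "(polydisc r :: ('p::prime_card padic ^ 'n) set) \<in> compact_open_subgroups"
proof -
  have alt: "polydisc r = {x :: 'p padic ^ 'n. \<forall>i. x $ i \<in> {y. padic_norm y \<le> r i}}"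
    by (simp add: polydisc_def)
  have "open (polydisc r :: ('p padic ^ 'n) set)"
    unfolding alt by (intro open_vector_box allI open_padic_le r)
  moreover have "closed (polydisc r :: ('p padic ^ 'n) set)"
    unfolding alt by (intro closed_vector_box allI closed_padic_le)
  moreover have "bounded (polydisc r :: ('p padic ^ 'n) set)"
    unfolding bounded_def
  proof (intro exI ballI)
    fix x :: "'p padic ^ 'n" assume x: "x \<in> polydisc r"
    have "dist 0 x \<le> (\<Sum>i\<in>UNIV. dist ((0 :: 'p padic ^ 'n) $ i) (x $ i))"
      unfolding dist_vec_def by (rule L2_set_le_sum) auto
    also have "\<dots> \<le> (\<Sum>i\<in>UNIV. r i)"
      using x by (intro sum_mono) (simp add: polydisc_def dist_padic_def padic_norm_minus)
    finally show "dist 0 x \<le> (\<Sum>i\<in>UNIV. r i)" .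
  qed
  moreover have "add_subgroup (polydisc r :: ('p padic ^ 'n) set)"
    using r unfolding add_subgroup_def polydisc_def
    by (auto simp: padic_norm_minus less_imp_le intro: padic_norm_add_le)
  ultimately show ?thesis
    unfolding compact_open_subgroups_def by (simp add: compact_eq_bounded_closed)
qed

abbreviation unit_polydisc :: "('p::prime_card padic ^ 'n) set" where
  "unit_polydisc \<equiv> polydisc (\<lambda>_. 1)"

lemma compact_open_subgroups_Int:
  fixes M N :: "'a::{topological_ab_group_add, t2_space} set"
  assumes "M \<in> compact_open_subgroups" "N \<in> compact_open_subgroups"
  shows "M \<inter> N \<in> compact_open_subgroups"
  using assms compact_Int[of M N] unfolding compact_open_subgroups_def
  by (auto intro: add_subgroup_Int)

text \<open>This is the Haar measure of a compact open subgroup, normalized by the integral vectors: both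
\<open>M\<close> and the unit polydisc are compared with their intersection, which has finite index in each.\<close>
definition lattice_volume :: "('p::prime_card padic ^ 'n) set \<Rightarrow> real" where
  "lattice_volume M = real (add_index M (M \<inter> unit_polydisc)) /
     real (add_index unit_polydisc (M \<inter> unit_polydisc))"

lemma lattice_volume_pos:
  assumes "M \<in> compact_open_subgroups" shows "0 < lattice_volume M"
proof -
  have O: "(unit_polydisc :: ('a padic ^ 'b) set) \<in> compact_open_subgroups"
    by (rule polydisc_compact_open_subgroup) simp
  have "M \<inter> unit_polydisc \<in> compact_open_subgroups"
    by (rule compact_open_subgroups_Int[OF assms O])
  then show ?thesis
    using assms O unfolding lattice_volume_def compact_open_subgroups_def
    by (auto intro!: divide_pos_pos add_index_pos)
qed

lemma lattice_volume_index:
  assumes M: "M \<in> compact_open_subgroups" and N: "N \<in> compact_open_subgroups" and "N \<subseteq> M"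
  shows "lattice_volume M = real (add_index M N) * lattice_volume N"
proof -
  let ?O = "unit_polydisc :: ('a padic ^ 'b) set"
  have O: "?O \<in> compact_open_subgroups"
    by (rule polydisc_compact_open_subgroup) simp
  have MO: "M \<inter> ?O \<in> compact_open_subgroups" and NO: "N \<inter> ?O \<in> compact_open_subgroups"
    by (rule compact_open_subgroups_Int[OF _ O], fact)+
  have sub: "add_subgroup M" "add_subgroup N" "add_subgroup ?O" "add_subgroup (M \<inter> ?O)" "add_subgroup (N \<inter> ?O)"
    using M N O MO NO unfolding compact_open_subgroups_def by blast+
  have 1: "add_index M (N \<inter> ?O) = add_index M N * add_index N (N \<inter> ?O)"
    by (rule add_index_mult[OF sub(1,2,5)]) (use assms(3) in auto)
  have 2: "add_index M (N \<inter> ?O) = add_index M (M \<inter> ?O) * add_index (M \<inter> ?O) (N \<inter> ?O)"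
    by (rule add_index_mult[OF sub(1,4,5)]) (use assms(3) in auto)
  have 3: "add_index ?O (N \<inter> ?O) = add_index ?O (M \<inter> ?O) * add_index (M \<inter> ?O) (N \<inter> ?O)"
    by (rule add_index_mult[OF sub(3,4,5)]) (use assms(3) in auto)
  have pos: "0 < add_index ?O (M \<inter> ?O)" "0 < add_index (M \<inter> ?O) (N \<inter> ?O)"
    using O MO NO unfolding compact_open_subgroups_def by (auto intro!: add_index_pos)
  have "lattice_volume M = real (add_index M (N \<inter> ?O)) / real (add_index ?O (N \<inter> ?O))"
    unfolding lattice_volume_def 2 3 using pos by simp
  then show ?thesis unfolding lattice_volume_def 1 by simp
qed

lemma inj_matrix_vector:
  fixes A :: "'a::field ^ 'n ^ 'n"
  assumes "det A \<noteq> 0" shows "inj ((*v) A)"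
  using assms matrix_left_invertible_injective[of A] invertible_det_nz[of A]
  unfolding invertible_def by blast

lemma matrix_inverse_exists:
  fixes A :: "'a::field ^ 'n ^ 'n"
  assumes "det A \<noteq> 0"
  obtains B where "A ** B = mat 1" "B ** A = mat 1" "det B \<noteq> 0"
proof -
  obtain B where B: "A ** B = mat 1" "B ** A = mat 1"
    using assms invertible_det_nz[of A] unfolding invertible_def by blast
  have "det A * det B = 1" using B(1) by (metis det_I det_mul)
  then have "det B \<noteq> 0" by auto
  with B show ?thesis by (rule that)
qed

lemma additive_matrix_vector: "Modules.additive ((*v) (A :: 'a::field ^ 'n ^ 'm))"
  by standard (rule matrix_vector_right_distrib)

lemma compact_open_subgroups_matrix_image:
  fixes A :: "'p::prime_card padic ^ 'n ^ 'n"
  assumes A: "det A \<noteq> 0" and M: "M \<in> compact_open_subgroups"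
  shows "(*v) A ` M \<in> compact_open_subgroups"
proof -
  obtain B where B: "A ** B = mat 1" "B ** A = mat 1" using A by (rule matrix_inverse_exists)
  have inv: "A *v (B *v x) = x" "B *v (A *v x) = x" for x
    using B by (simp_all add: matrix_vector_mul_assoc)
  have "(*v) A ` M = (*v) B -` M"
  proof (intro equalityI subsetI)
    fix x assume "x \<in> (*v) B -` M"
    then have "A *v (B *v x) \<in> (*v) A ` M" by blast
    then show "x \<in> (*v) A ` M" by (simp only: inv)
  qed (auto simp: inv)
  moreover have "open ((*v) B -` M)"
    using M by (intro open_vimage continuous_on_padic_matrix_vector) (simp add: compact_open_subgroups_def)
  moreover have "compact ((*v) A ` M)"
    using M by (intro compact_continuous_image continuous_on_padic_matrix_vector)
      (simp add: compact_open_subgroups_def)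
  moreover have "add_subgroup ((*v) A ` M)"
    using M by (intro add_subgroup_image additive_matrix_vector) (simp add: compact_open_subgroups_def)
  ultimately show ?thesis by (simp add: compact_open_subgroups_def)
qed

section \<open>Invertible matrices scale volume by the norm of the determinant\<close>

text \<open>The factor by which a matrix changes the volume does not depend on the subgroup, because two
subgroups can be compared through their intersection and a matrix preserves indices. It
may therefore be computed on a subgroup that suits the matrix.\<close>
lemma lattice_volume_ratio:
  fixes A :: "'p::prime_card padic ^ 'n ^ 'n"
  assumes A: "det A \<noteq> 0"
    and M: "M \<in> compact_open_subgroups" and N: "N \<in> compact_open_subgroups"
  shows "lattice_volume ((*v) A ` M) * lattice_volume N = lattice_volume ((*v) A ` N) * lattice_volume M"
proof -
  note cA = compact_open_subgroups_matrix_image[OF A]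
  have *: "lattice_volume ((*v) A ` M) * lattice_volume N = lattice_volume ((*v) A ` N) * lattice_volume M"
    if M: "M \<in> compact_open_subgroups" and N: "N \<in> compact_open_subgroups" and "N \<subseteq> M" for M N :: "('p padic ^ 'n) set"
  proof -
    have "add_index ((*v) A ` M) ((*v) A ` N) = add_index M N"
      using N by (intro add_index_image additive_matrix_vector inj_matrix_vector A that(3))
        (simp add: compact_open_subgroups_def)
    then show ?thesis
      using lattice_volume_index[OF cA[OF M] cA[OF N]] lattice_volume_index[OF M N] that(3)
      by (simp add: image_mono)
  qed
  have MN: "M \<inter> N \<in> compact_open_subgroups" by (rule compact_open_subgroups_Int[OF M N])
  let ?v = lattice_volume and ?w = "\<lambda>M. lattice_volume ((*v) A ` M)"
  have "?w M * ?v (M \<inter> N) = ?w (M \<inter> N) * ?v M" "?w N * ?v (M \<inter> N) = ?w (M \<inter> N) * ?v N"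
    using *[OF M MN] *[OF N MN] by auto
  then have "(?w M * ?v (M \<inter> N)) * ?v N = (?w N * ?v (M \<inter> N)) * ?v M" by (simp add: ac_simps)
  then have "(?w M * ?v N) * ?v (M \<inter> N) = (?w N * ?v M) * ?v (M \<inter> N)" by (simp add: ac_simps)
  then show ?thesis using lattice_volume_pos[OF MN] by simp
qed

definition scales_volume :: "'p::prime_card padic ^ 'n ^ 'n \<Rightarrow> bool" where
  "scales_volume A \<longleftrightarrow> det A \<noteq> 0 \<and> (\<forall>M\<in>compact_open_subgroups.
     lattice_volume ((*v) A ` M) = padic_norm (det A) * lattice_volume M)"

lemma scales_volumeI:
  fixes A :: "'p::prime_card padic ^ 'n ^ 'n"
  assumes A: "det A \<noteq> 0" and M: "M \<in> compact_open_subgroups"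
    and eq: "lattice_volume ((*v) A ` M) = padic_norm (det A) * lattice_volume M"
  shows "scales_volume A"
  unfolding scales_volume_def
proof (intro conjI ballI A)
  fix N :: "('p padic ^ 'n) set" assume N: "N \<in> compact_open_subgroups"
  have "lattice_volume ((*v) A ` N) * lattice_volume M
      = (padic_norm (det A) * lattice_volume N) * lattice_volume M"
    using lattice_volume_ratio[OF A N M] eq by (simp add: ac_simps)
  then show "lattice_volume ((*v) A ` N) = padic_norm (det A) * lattice_volume N"
    using lattice_volume_pos[OF M] by simp
qed

lemma scales_volume_mult:
  assumes A: "scales_volume A" and B: "scales_volume B"
  shows "scales_volume (A ** B)"
proof -
  have "(*v) (A ** B) ` M = (*v) A ` (*v) B ` M" for M
    by (simp add: image_image matrix_vector_mul_assoc)
  moreover have "det B \<noteq> 0" using B by (simp add: scales_volume_def)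
  ultimately show ?thesis
    using A B compact_open_subgroups_matrix_image[of B] unfolding scales_volume_def
    by (simp add: det_mul padic_norm_mult)
qed

lemma scales_volume_inverse:
  assumes A: "scales_volume A" and AB: "A ** B = mat 1"
  shows "scales_volume B"
proof -
  let ?O = "unit_polydisc :: ('a padic ^ 'b) set"
  have O: "?O \<in> compact_open_subgroups" by (rule polydisc_compact_open_subgroup) simp
  have dd: "det A * det B = 1" using AB by (metis det_I det_mul)
  then have B0: "det B \<noteq> 0" by auto
  have ABO: "(*v) A ` (*v) B ` ?O = ?O"
    by (simp add: image_image matrix_vector_mul_assoc AB)
  then have AB_volume: "padic_norm (det A) * lattice_volume ((*v) B ` ?O) = lattice_volume ?O"
    using bspec[OF conjunct2[OF A[unfolded scales_volume_def]]
        compact_open_subgroups_matrix_image[OF B0 O]] unfolding ABO by simp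
  have "padic_norm (det A) * padic_norm (det B) = 1"
    using dd by (metis padic_norm_mult padic_norm_1)
  then have "lattice_volume ((*v) B ` ?O)
      = padic_norm (det B) * (padic_norm (det A) * lattice_volume ((*v) B ` ?O))"
    by (simp add: mult.assoc[symmetric] mult.commute)
  also note AB_volume
  finally have "lattice_volume ((*v) B ` ?O) = padic_norm (det B) * lattice_volume ?O" .
  then show ?thesis by (rule scales_volumeI[OF B0 O])
qed

text \<open>The identity matrix with column \<open>a\<close> replaced by \<open>v\<close>. With a nonzero entry in position \<open>a\<close> these
matrices generate the general linear group; they comprise shears (\<open>v $ a = 1\<close>) and dilations
(\<open>v\<close> a multiple of a unit vector).\<close>
definition column_matrix :: "'n \<Rightarrow> 'a::field ^ 'n \<Rightarrow> 'a ^ 'n ^ 'n" where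
  "column_matrix a v = (\<chi> i j. if j = a then v $ i else of_bool (i = j))"

lemma column_matrix_mult_vec:
  "(column_matrix a v *v x) $ i = x $ a * v $ i + (if i = a then 0 else x $ i)"
proof -
  have "(column_matrix a v *v x) $ i = (\<Sum>j\<in>UNIV. (if j = a then v $ i else of_bool (i = j)) * x $ j)"
    by (simp add: column_matrix_def matrix_vector_mult_def)
  also have "\<dots> = v $ i * x $ a + (\<Sum>j\<in>UNIV - {a}. of_bool (i = j) * x $ j)"
    by (subst sum.remove[of _ a]) (auto intro!: sum.cong)
  also have "(\<Sum>j\<in>UNIV - {a}. of_bool (i = j) * x $ j) = (\<Sum>j\<in>UNIV - {a}. if j = i then x $ i else 0)"
    by (intro sum.cong) auto
  also have "\<dots> = (if i = a then 0 else x $ i)" by (simp add: sum.delta)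
  finally show ?thesis by (simp add: mult.commute)
qed

lemma det_column_matrix: "det (column_matrix a v) = v $ a"
proof -
  have "column_matrix a v = (\<chi> i j. if j = a then (mat 1 *v v) $ i else mat 1 $ i $ j)"
    unfolding matrix_vector_mul_lid by (simp add: vec_eq_iff column_matrix_def mat_def)
  then show ?thesis using cramer_lemma[of a "mat 1" v] by simp
qed

lemma column_matrix_mult:
  "column_matrix a v ** column_matrix a (c *s axis a 1) = column_matrix a (c *s v)"
  unfolding matrix_eq matrix_vector_mul_assoc[symmetric] vec_eq_iff column_matrix_mult_vec
  by (simp add: axis_def algebra_simps)

text \<open>Gaussian elimination, one column at a time. The induction is on the set of columns that may differ from
the unit vectors: if the pivot \<open>T $ a $ a\<close> is nonzero, then \<open>column_matrix a (column a T)\<close> splits off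
as a left factor, and the other factor has a unit vector in column \<open>a\<close>; otherwise adding a suitable row to row \<open>a\<close> creates a pivot.\<close>
lemma invertible_matrix_induct [consumes 1, case_names mult column]:
  fixes T :: "'a::field ^ 'n ^ 'n"
  assumes T: "det T \<noteq> 0"
    and mult: "\<And>A B. P A \<Longrightarrow> P B \<Longrightarrow> P (A ** B)"
    and col: "\<And>a v. v $ a \<noteq> 0 \<Longrightarrow> P (column_matrix a v)"
  shows "P T"
proof -
  have col_axis: "column_matrix a v *v axis j 1 = (if j = a then v else axis j 1)" for a j and v :: "'a ^ 'n"
    by (simp add: vec_eq_iff column_matrix_mult_vec axis_def)
  have colT: "T *v axis j 1 = column j T" for T :: "'a ^ 'n ^ 'n" and j
    by (simp add: vec_eq_iff matrix_vector_mult_def column_def axis_def if_distrib cong: if_cong)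
  have main: "P T" if "finite J" "det T \<noteq> 0" "\<And>j. j \<notin> J \<Longrightarrow> column j T = axis j 1" for J T
    using that
  proof (induction J arbitrary: T rule: finite_induct)
    case empty
    \<comment> \<open>The identity is itself a column matrix, for an arbitrary index.\<close>
    have "T = column_matrix undefined (axis undefined 1)"
    proof -
      have "T $ i $ j = of_bool (i = j)" for i j
        using arg_cong[OF empty(2)[of j], of "\<lambda>v. v $ i"] by (simp add: column_def axis_def)
      then show ?thesis by (simp add: vec_eq_iff column_matrix_def axis_def)
    qed
    then show ?case using col[of "axis undefined 1" undefined] by simp
  next
    case (insert a J)
    have pivot: "P T" if T: "det T \<noteq> 0" "\<And>j. j \<notin> insert a J \<Longrightarrow> column j T = axis j 1"
        and a: "T $ a $ a \<noteq> 0" for T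
    proof -
      let ?F = "column_matrix a (column a T)"
      have "det ?F \<noteq> 0" using a by (simp add: det_column_matrix column_def)
      then obtain F' where F: "?F ** F' = mat 1" "F' ** ?F = mat 1" "det F' \<noteq> 0"
        by (rule matrix_inverse_exists)
      have F'F: "F' *v (?F *v x) = x" for x using F by (simp add: matrix_vector_mul_assoc)
      have "column j (F' ** T) = axis j 1" if j: "j \<notin> J" for j
      proof -
        have "column j (F' ** T) = F' *v column j T"
          by (simp add: colT[symmetric] matrix_vector_mul_assoc)
        also have "column j T = ?F *v axis j 1" using T(2)[of j] j by (auto simp: col_axis)
        finally show ?thesis by (simp add: F'F)
      qed
      then have "P (F' ** T)" using insert.IH[of "F' ** T"] T F by (simp add: det_mul)
      moreover have "P ?F" using a by (intro col) (simp add: column_def)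
      ultimately have "P (?F ** (F' ** T))" by - (rule mult)
      then show ?thesis using F by (simp add: matrix_mul_assoc)
    qed
    show ?case
    proof (cases "T $ a $ a = 0")
      case True
      \<comment> \<open>If all these entries vanish, then \<open>T\<close> maps its column \<open>a\<close> and the unit vector \<open>a\<close> to the same vector.\<close>
      have "\<exists>i\<in>J. T $ i $ a \<noteq> 0"
      proof (rule ccontr)
        assume "\<not> (\<exists>i\<in>J. T $ i $ a \<noteq> 0)"
        then have z: "T $ j $ a = 0" if "j \<in> insert a J" for j using that True by auto
        have "(T *v column a T) $ i = column a T $ i" for i
        proof -
          have "(T *v column a T) $ i = (\<Sum>j\<in>UNIV. T $ i $ j * T $ j $ a)"
            by (simp add: matrix_vector_mult_def column_def)
          also have "\<dots> = (\<Sum>j\<in>UNIV. if j = i then T $ i $ a else 0)"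
          proof (rule sum.cong)
            fix j
            show "T $ i $ j * T $ j $ a = (if j = i then T $ i $ a else 0)"
            proof (cases "j \<in> insert a J")
              case True then show ?thesis using z by auto
            next
              case False
              then have "T $ i $ j = of_bool (i = j)"
                using arg_cong[OF insert.prems(2)[OF False], of "\<lambda>v. v $ i"] by (simp add: column_def axis_def)
              then show ?thesis by auto
            qed
          qed simp
          finally show ?thesis by (simp add: column_def)
        qed
        then have "T *v column a T = T *v axis a 1" by (simp add: vec_eq_iff colT)
        then have "column a T = axis a 1" using inj_matrix_vector[OF insert.prems(1)] by (simp add: inj_eq)
        then have "T $ a $ a = 1" by (simp add: vec_eq_iff column_def axis_def)
        then show False using True by simp
      qed
      then obtain i where i: "i \<in> J" "T $ i $ a \<noteq> 0" by blast
      then have ia: "i \<noteq> a" using insert.hyps by auto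
      let ?G = "column_matrix i (axis i 1 + axis a 1) :: 'a ^ 'n ^ 'n"
      let ?H = "column_matrix i (axis i 1 - axis a 1) :: 'a ^ 'n ^ 'n"
      have HG: "?H ** ?G = mat 1"
        unfolding matrix_eq matrix_vector_mul_assoc[symmetric] vec_eq_iff column_matrix_mult_vec
        using ia by (auto simp: axis_def algebra_simps)
      have "P (?G ** T)"
      proof (rule pivot)
        show "det (?G ** T) \<noteq> 0" using insert.prems(1) ia by (simp add: det_mul det_column_matrix axis_def)
        show "column j (?G ** T) = axis j 1" if "j \<notin> insert a J" for j
        proof -
          have "column j (?G ** T) = ?G *v column j T"
            by (simp add: colT[symmetric] matrix_vector_mul_assoc)
          also have "\<dots> = axis j 1"
            using insert.prems(2)[OF that] i that by (auto simp: col_axis)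
          finally show ?thesis .
        qed
        have "(?G ** T) $ a $ a = (?G *v column a T) $ a"
          by (simp add: matrix_matrix_mult_def matrix_vector_mult_def column_def)
        also have "\<dots> = T $ i $ a"
          using True ia by (simp add: column_matrix_mult_vec axis_def column_def)
        finally show "(?G ** T) $ a $ a \<noteq> 0" using i by simp
      qed
      moreover have "P ?H" using ia by (intro col) (simp add: axis_def)
      ultimately have "P (?H ** (?G ** T))" by - (rule mult)
      then show ?thesis using HG by (simp add: matrix_mul_assoc)
    qed (rule pivot[OF insert.prems])
  qed
  show ?thesis by (rule main[of UNIV]) (use T in auto)
qed


text \<open>A shear preserves a polydisc that is thin enough in direction \<open>a\<close>, since then the multiples of
\<open>v\<close> that are added do not leave the unit polydisc. Its determinant is one.\<close>
lemma scales_volume_shear: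
  fixes v :: "'p::prime_card padic ^ 'n"
  assumes v: "v $ a = 1"
  shows "scales_volume (column_matrix a v)"
proof -
  define \<rho> where "\<rho> = 1 / (1 + (\<Sum>i\<in>UNIV. padic_norm (v $ i)))"
  have s: "0 \<le> (\<Sum>i\<in>UNIV. padic_norm (v $ i))" by (intro sum_nonneg padic_norm_nonneg)
  then have \<rho>: "0 < \<rho>" unfolding \<rho>_def by simp
  have \<rho>v: "\<rho> * padic_norm (v $ i) \<le> 1" for i
  proof -
    have "padic_norm (v $ i) \<le> (\<Sum>i\<in>UNIV. padic_norm (v $ i))"
      by (intro member_le_sum padic_norm_nonneg) auto
    then show ?thesis using s unfolding \<rho>_def by (simp add: field_simps)
  qed
  define M where "M = (polydisc (\<lambda>j. if j = a then \<rho> else 1) :: ('p padic ^ 'n) set)"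
  have M: "M \<in> compact_open_subgroups" unfolding M_def by (rule polydisc_compact_open_subgroup) (simp add: \<rho>)
  have stable: "column_matrix a w *v x \<in> M"
    if w: "w $ a = 1" "\<And>i. \<rho> * padic_norm (w $ i) \<le> 1" and x: "x \<in> M" for w x
  proof -
    have xa: "padic_norm (x $ a) \<le> \<rho>" and xi: "\<And>i. i \<noteq> a \<Longrightarrow> padic_norm (x $ i) \<le> 1"
      using x unfolding M_def polydisc_def by (auto split: if_splits)
    have "padic_norm (x $ a * w $ i) \<le> 1" for i
    proof -
      have "padic_norm (x $ a) * padic_norm (w $ i) \<le> \<rho> * padic_norm (w $ i)"
        by (intro mult_right_mono xa padic_norm_nonneg)
      then show ?thesis using w(2)[of i] by (simp add: padic_norm_mult)
    qed
    then show ?thesis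
      using xa xi w(1) unfolding M_def polydisc_def
      by (auto simp: column_matrix_mult_vec intro!: padic_norm_add_le)
  qed
  define w where "w = axis a 1 + axis a 1 - v"
  have w: "w $ a = 1" "\<And>i. padic_norm (w $ i) = padic_norm (v $ i)"
    using v by (auto simp: w_def axis_def padic_norm_minus)
  have inv: "column_matrix a v *v (column_matrix a w *v x) = x" for x
    unfolding vec_eq_iff column_matrix_mult_vec using v by (simp add: w_def axis_def algebra_simps)
  have "(*v) (column_matrix a v) ` M = M"
  proof (intro equalityI subsetI)
    fix x assume "x \<in> M"
    then have "column_matrix a w *v x \<in> M" using w \<rho>v by (intro stable) auto
    then show "x \<in> (*v) (column_matrix a v) ` M" using inv[of x] by (metis imageI)
  qed (use stable[OF v \<rho>v] in blast)
  then show ?thesis using v M by (intro scales_volumeI[of _ M]) (simp_all add: det_column_matrix)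
qed

text \<open>Units of the ring of integers preserve the unit polydisc, and multiplication of one coordinate
by \<open>p\<close> maps it to a subgroup of index \<open>p\<close>, the number of residues. Every nonzero \<open>p\<close>-adic number is a
power of \<open>p\<close> times a unit.\<close>
lemma scales_volume_dilation:
  fixes c :: "'p::prime_card padic"
  assumes c: "c \<noteq> 0"
  shows "scales_volume (column_matrix a (c *s axis a 1) :: 'p padic ^ 'n ^ 'n)"
proof -
  define D where "D c = (column_matrix a (c *s axis a 1) :: 'p padic ^ 'n ^ 'n)" for c
  have D: "(D c *v x) $ i = (if i = a then c * x $ a else x $ i)" for c x i
    by (simp add: D_def column_matrix_mult_vec axis_def)
  have det: "det (D c) = c" for c by (simp add: D_def det_column_matrix axis_def)
  have mult: "D c ** D d = D (c * d)" for c d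
    unfolding matrix_eq matrix_vector_mul_assoc[symmetric] vec_eq_iff D by auto
  have D1: "D 1 = mat 1" unfolding matrix_eq vec_eq_iff D by auto
  let ?O = "unit_polydisc :: ('p padic ^ 'n) set"
  let ?p = "of_nat CARD('p) :: 'p padic"
  have O: "?O \<in> compact_open_subgroups" by (rule polydisc_compact_open_subgroup) simp
  have p1: "CARD('p) > 1" using prime_gt_1_nat[OF prime_card] by blast
  have p0: "?p \<noteq> 0" using padic_norm_prime[where 'p='p] p1 by auto
  have image: "(*v) (D c) ` ?O = polydisc (\<lambda>j. if j = a then padic_norm c else 1)" if c: "c \<noteq> 0" for c
  proof (intro equalityI subsetI)
    fix x :: "'p padic ^ 'n" assume "x \<in> (*v) (D c) ` ?O"
    then show "x \<in> polydisc (\<lambda>j. if j = a then padic_norm c else 1)"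
      unfolding polydisc_def by (auto simp: D padic_norm_mult padic_norm_nonneg mult_left_le)
  next
    fix x :: "'p padic ^ 'n"
    assume x: "x \<in> polydisc (\<lambda>j. if j = a then padic_norm c else 1)"
    have nc: "0 < padic_norm c" using c padic_norm_nonneg[of c] padic_norm_eq_0_iff[of c] by linarith
    have "padic_norm (x $ a) \<le> padic_norm c" and xi: "\<And>i. i \<noteq> a \<Longrightarrow> padic_norm (x $ i) \<le> 1"
      using x unfolding polydisc_def by (auto split: if_splits)
    then have "padic_norm (inverse c * x $ a) \<le> 1"
      unfolding padic_norm_mult padic_norm_inverse using nc by (simp add: field_simps)
    with xi have "D (inverse c) *v x \<in> ?O" by (simp add: polydisc_def D)
    moreover have "D c *v (D (inverse c) *v x) = x" using c by (simp add: matrix_vector_mul_assoc mult D1)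
    ultimately show "x \<in> (*v) (D c) ` ?O" by (metis imageI)
  qed
  have unit: "scales_volume (D u)" if u: "padic_norm u = 1" for u
  proof -
    have u0: "u \<noteq> 0" using u by auto
    have "(*v) (D u) ` ?O = ?O" unfolding image[OF u0] u by simp
    then show ?thesis using u u0 O by (intro scales_volumeI[of _ ?O]) (simp_all add: det)
  qed
  have prime: "scales_volume (D ?p)"
  proof -
    have DO: "(*v) (D ?p) ` ?O \<in> compact_open_subgroups"
      using p0 O by (intro compact_open_subgroups_matrix_image) (simp_all add: det)
    have le1: "padic_norm y \<le> 1" if "padic_norm y \<le> 1 / CARD('p)" for y :: "'p padic"
      using that p1 order_trans[of "padic_norm y" "1 / real CARD('p)" 1] by simp
    have DO_alt: "(*v) (D ?p) ` ?O = {x \<in> ?O. padic_norm (x $ a) \<le> 1 / CARD('p)}"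
    proof (intro equalityI subsetI)
      fix x assume "x \<in> (*v) (D ?p) ` ?O"
      then have "x \<in> polydisc (\<lambda>j. if j = a then 1 / CARD('p) else 1)"
        unfolding image[OF p0] padic_norm_prime .
      then have x: "padic_norm (x $ i) \<le> (if i = a then 1 / CARD('p) else 1)" for i
        unfolding polydisc_def by blast
      have "padic_norm (x $ i) \<le> 1" for i using x[of i] le1 by (cases "i = a") auto
      then show "x \<in> {x \<in> ?O. padic_norm (x $ a) \<le> 1 / CARD('p)}"
        using x[of a] by (simp add: polydisc_def)
    next
      fix x assume "x \<in> {x \<in> ?O. padic_norm (x $ a) \<le> 1 / CARD('p)}"
      then show "x \<in> (*v) (D ?p) ` ?O"
        unfolding image[OF p0] padic_norm_prime by (simp add: polydisc_def)
    qed
    let ?r = "\<lambda>k::nat. axis a (of_nat k) :: 'p padic ^ 'n"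
    have eqI: "k = l" if "k < CARD('p)" "l < CARD('p)"
        "padic_norm (of_nat k - of_nat l :: 'p padic) \<le> 1 / CARD('p)" for k l
    proof (rule ccontr)
      assume "k \<noteq> l"
      then have "\<not> int CARD('p) dvd int k - int l"
        using that(1,2) zdvd_imp_le[of "int CARD('p)" "int k - int l"] zdvd_imp_le[of "int CARD('p)" "int l - int k"]
          dvd_diff_commute[of "int CARD('p)" "int k" "int l"] by linarith
      then have "padic_norm (of_int (int k - int l) :: 'p padic) = 1" by (rule padic_norm_of_int_unit)
      then show False using that(3) p1 by simp
    qed
    have diff: "g - ?r k \<in> (*v) (D ?p) ` ?O \<longleftrightarrow> padic_norm (g $ a - of_nat k) \<le> 1 / CARD('p)"
      if g: "g \<in> ?O" for g k
    proof -
      have "g - ?r k \<in> ?O"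
        using g unfolding polydisc_def by (auto simp: axis_def intro!: padic_norm_diff_le padic_norm_of_nat_le_1)
      then show ?thesis unfolding DO_alt by (simp add: axis_def)
    qed
    have "transversal (?r ` {..<CARD('p)}) ?O ((*v) (D ?p) ` ?O)"
      unfolding transversal_def
    proof (intro conjI ballI)
      show "?r ` {..<CARD('p)} \<subseteq> ?O" by (auto simp: polydisc_def axis_def padic_norm_of_nat_le_1)
      fix g assume g: "g \<in> ?O"
      then have "padic_norm (g $ a) \<le> 1" by (simp add: polydisc_def)
      then obtain k where k: "k < CARD('p)" "padic_norm (g $ a - of_nat k) \<le> 1 / CARD('p)"
        using padic_nat_approx[of "g $ a" 1] by auto
      show "\<exists>!r. r \<in> ?r ` {..<CARD('p)} \<and> g - r \<in> (*v) (D ?p) ` ?O"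
      proof (rule ex1I[of _ "?r k"])
        show "?r k \<in> ?r ` {..<CARD('p)} \<and> g - ?r k \<in> (*v) (D ?p) ` ?O"
          using k diff[OF g, of k] by blast
        fix r assume r: "r \<in> ?r ` {..<CARD('p)} \<and> g - r \<in> (*v) (D ?p) ` ?O"
        then obtain l where l: "r = ?r l" "l < CARD('p)" by auto
        then have l': "padic_norm (g $ a - of_nat l) \<le> 1 / CARD('p)" using r diff[OF g, of l] by blast
        have "of_nat k - of_nat l = (g $ a - of_nat l) - (g $ a - of_nat k)" by simp
        then have "padic_norm (of_nat k - of_nat l :: 'p padic) \<le> 1 / CARD('p)"
          using padic_norm_diff_le[OF l' k(2)] by (simp only:)
        then show "r = ?r k" using eqI[of k l] k l by simp
      qed
    qed
    then have "add_index ?O ((*v) (D ?p) ` ?O) = card (?r ` {..<CARD('p)})"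
      using DO by (intro add_index_transversal) (simp_all add: compact_open_subgroups_def)
    moreover have "inj_on ?r {..<CARD('p)}"
    proof (rule inj_onI)
      fix k l assume kl: "k \<in> {..<CARD('p)}" "l \<in> {..<CARD('p)}" "?r k = ?r l"
      have "of_nat k = (of_nat l :: 'p padic)"
        using arg_cong[OF kl(3), of "\<lambda>v. v $ a"] by (simp add: axis_def)
      then show "k = l" using eqI[of k l] kl(1,2) by simp
    qed
    ultimately have "add_index ?O ((*v) (D ?p) ` ?O) = CARD('p)"
      by (simp add: card_image)
    moreover have "(*v) (D ?p) ` ?O \<subseteq> ?O" unfolding DO_alt by blast
    ultimately have "lattice_volume ?O = real CARD('p) * lattice_volume ((*v) (D ?p) ` ?O)"
      using lattice_volume_index[OF O DO] by simp
    then show ?thesis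
      using p0 O p1 by (intro scales_volumeI[of _ ?O]) (simp_all add: det padic_norm_prime)
  qed
  have inv: "scales_volume (D (inverse d))" if "scales_volume (D d)" "d \<noteq> 0" for d
    by (rule scales_volume_inverse[OF that(1)]) (use that(2) in \<open>simp add: mult D1\<close>)
  have pow: "scales_volume (D (d ^ k * u))" if "scales_volume (D d)" "padic_norm u = 1" for d k u
  proof (induction k)
    case 0 then show ?case using unit[OF that(2)] by simp
  next
    case (Suc k)
    then have "scales_volume (D d ** D (d ^ k * u))" by (intro scales_volume_mult that(1))
    then show ?case by (simp add: mult ac_simps)
  qed
  obtain k where k: "padic_norm c = real CARD('p) powi k" using c by (rule padic_norm_powi)
  show ?thesis
  proof (cases "k \<ge> 0")
    case True
    define m where "m = nat k"
    have "padic_norm (?p ^ m * c) = 1"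
      unfolding padic_norm_mult padic_norm_power padic_norm_prime k using True p1
      by (simp add: m_def power_int_def power_divide)
    then have "scales_volume (D (inverse ?p ^ m * (?p ^ m * c)))"
      by (intro pow inv prime p0)
    moreover have "inverse ?p ^ m * (?p ^ m * c) = c"
      using p0 by (simp add: power_inverse mult.assoc[symmetric])
    ultimately show ?thesis unfolding D_def by simp
  next
    case False
    define m where "m = nat (- k)"
    have "padic_norm (inverse ?p ^ m * c) = 1"
      unfolding padic_norm_mult padic_norm_power padic_norm_inverse padic_norm_prime k using False p1
      by (simp add: m_def power_int_def power_inverse)
    then have "scales_volume (D (?p ^ m * (inverse ?p ^ m * c)))"
      by (intro pow prime)
    moreover have "?p ^ m * (inverse ?p ^ m * c) = c"
      using p0 by (simp add: power_inverse mult.assoc[symmetric])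
    ultimately show ?thesis unfolding D_def by simp
  qed
qed

lemma lattice_volume_matrix_image:
  fixes A :: "'p::prime_card padic ^ 'n ^ 'n"
  assumes "det A \<noteq> 0" and M: "M \<in> compact_open_subgroups"
  shows "lattice_volume ((*v) A ` M) = padic_norm (det A) * lattice_volume M"
proof -
  have "scales_volume A"
    using assms(1)
  proof (induction A rule: invertible_matrix_induct)
    case (mult A B)
    then show ?case by (rule scales_volume_mult)
  next
    case (column a v)
    have "column_matrix a (inverse (v $ a) *s v) ** column_matrix a (v $ a *s axis a 1) = column_matrix a v"
      using column by (simp add: column_matrix_mult vector_smult_assoc)
    moreover have "scales_volume (column_matrix a (inverse (v $ a) *s v))"
      using column by (intro scales_volume_shear) simp
    moreover have "scales_volume (column_matrix a (v $ a *s axis a 1))"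
      using column by (rule scales_volume_dilation)
    ultimately show ?case using scales_volume_mult by metis
  qed
  then show ?thesis using M by (simp add: scales_volume_def)
qed

section \<open>Characteristic polynomials of block triangular matrices\<close>

lemma coeff_mult_degree_bound:
  fixes p q :: "'a::comm_semiring_0 poly"
  assumes "degree p \<le> m" "degree q \<le> n"
  shows "poly.coeff (p * q) (m + n) = poly.coeff p m * poly.coeff q n"
proof -
  have "poly.coeff (p * q) (m + n) = (\<Sum>i\<le>m + n. poly.coeff p i * poly.coeff q (m + n - i))" by (simp add: coeff_mult)
  also have "\<dots> = (\<Sum>i\<le>m + n. if i = m then poly.coeff p m * poly.coeff q n else 0)"
  proof (rule sum.cong)
    fix i assume "i \<in> {..m + n}"
    show "poly.coeff p i * poly.coeff q (m + n - i) = (if i = m then poly.coeff p m * poly.coeff q n else 0)"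
    proof (cases i m rule: linorder_cases)
      case less
      then have "degree q < m + n - i" using assms by simp
      then show ?thesis using less by (simp add: coeff_eq_0)
    next
      case greater
      then have "degree p < i" using assms by simp
      then show ?thesis using greater by (simp add: coeff_eq_0)
    qed simp
  qed simp
  finally show ?thesis by simp
qed

lemma coeff_prod_degree_bound:
  fixes p :: "'i \<Rightarrow> 'a::comm_semiring_1 poly"
  assumes "finite I" "\<And>i. i \<in> I \<Longrightarrow> degree (p i) \<le> d i"
  shows "degree (\<Prod>i\<in>I. p i) \<le> (\<Sum>i\<in>I. d i) \<and>
    poly.coeff (\<Prod>i\<in>I. p i) (\<Sum>i\<in>I. d i) = (\<Prod>i\<in>I. poly.coeff (p i) (d i))"
  using assms
proof (induction I rule: finite_induct)
  case (insert i I)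
  then have IH: "degree (\<Prod>i\<in>I. p i) \<le> (\<Sum>i\<in>I. d i)"
      "poly.coeff (\<Prod>i\<in>I. p i) (\<Sum>i\<in>I. d i) = (\<Prod>i\<in>I. poly.coeff (p i) (d i))" and i: "degree (p i) \<le> d i" by auto
  have "degree (p i * (\<Prod>i\<in>I. p i)) \<le> d i + (\<Sum>i\<in>I. d i)"
    using degree_mult_le[of "p i" "\<Prod>i\<in>I. p i"] IH(1) i by linarith
  then show ?case using insert.hyps coeff_mult_degree_bound[OF i IH(1)] IH(2) by simp
qed simp

text \<open>The top coefficient of a determinant whose rows have bounded degrees. It shows that the
characteristic polynomial of a diagonal block is monic.\<close>
lemma det_degree_bound:
  fixes M :: "'a::comm_ring_1 poly ^ 'n ^ 'n"
  assumes "\<And>i j. degree (M $ i $ j) \<le> d i"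
  shows "degree (det M) \<le> (\<Sum>i\<in>UNIV. d i)"
    and "poly.coeff (det M) (\<Sum>i\<in>UNIV. d i) = det (\<chi> i j. poly.coeff (M $ i $ j) (d i))"
proof -
  have p: "degree (\<Prod>i\<in>UNIV. M $ i $ q i) \<le> (\<Sum>i\<in>UNIV. d i) \<and>
      poly.coeff (\<Prod>i\<in>UNIV. M $ i $ q i) (\<Sum>i\<in>UNIV. d i) = (\<Prod>i\<in>UNIV. poly.coeff (M $ i $ q i) (d i))" for q
    by (rule coeff_prod_degree_bound) (auto simp: assms)
  show "degree (det M) \<le> (\<Sum>i\<in>UNIV. d i)"
    unfolding det_def
  proof (rule degree_sum_le)
    fix q assume "q \<in> {q. q permutes (UNIV :: 'n set)}"
    show "degree (of_int (sign q) * (\<Prod>i\<in>UNIV. M $ i $ q i)) \<le> (\<Sum>i\<in>UNIV. d i)"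
      using degree_mult_le[of "of_int (sign q)" "\<Prod>i\<in>UNIV. M $ i $ q i"] p[of q] by (simp add: of_int_poly)
  qed simp
  show "poly.coeff (det M) (\<Sum>i\<in>UNIV. d i) = det (\<chi> i j. poly.coeff (M $ i $ j) (d i))"
    unfolding det_def coeff_sum
    by (intro sum.cong) (auto simp: of_int_poly p)
qed

lemma det_ring_hom:
  fixes M :: "'a::comm_ring_1 ^ 'n ^ 'n"
  assumes "comm_ring_hom h"
  shows "h (det M) = det (map_matrix h M)"
proof -
  interpret comm_ring_hom h by fact
  show ?thesis by (simp add: det_def hom_distribs)
qed

text \<open>For a matrix that is block triangular with respect to \<open>S\<close> and its complement, the block on \<open>S\<close>
is completed to a full-size matrix by the identity, so that its determinant is the one of the
block; \<open>upper_left_unit\<close> is the complementary factor. Working with a subset of the index type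
avoids types for the dimensions of the blocks.\<close>
definition upper_left_block :: "'n set \<Rightarrow> 'a::comm_ring_1 ^ 'n ^ 'n \<Rightarrow> 'a ^ 'n ^ 'n" where
  "upper_left_block S M = (\<chi> i j. if i \<in> S \<and> j \<in> S then M $ i $ j else of_bool (i = j))"

definition upper_left_unit :: "'n set \<Rightarrow> 'a::comm_ring_1 ^ 'n ^ 'n \<Rightarrow> 'a ^ 'n ^ 'n" where
  "upper_left_unit S M = (\<chi> i j. if i \<in> S \<and> j \<in> S then of_bool (i = j) else M $ i $ j)"

lemma block_triangular_factorization:
  fixes M :: "'a::comm_ring_1 ^ 'n ^ 'n"
  assumes "\<And>i j. i \<notin> S \<Longrightarrow> j \<in> S \<Longrightarrow> M $ i $ j = 0"
  shows "upper_left_unit S M ** upper_left_block S M = M"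
  unfolding vec_eq_iff
proof (intro allI)
  fix i j
  let ?G = "upper_left_unit S M" and ?F = "upper_left_block S M"
  have "(?G ** ?F) $ i $ j = (\<Sum>k\<in>UNIV. ?G $ i $ k * ?F $ k $ j)"
    by (simp add: matrix_matrix_mult_def)
  also have "\<dots> = M $ i $ j"
  proof (cases "j \<in> S")
    case False
    then have "(\<Sum>k\<in>UNIV. ?G $ i $ k * ?F $ k $ j) = (\<Sum>k\<in>UNIV. if k = j then ?G $ i $ j else 0)"
      by (intro sum.cong) (auto simp: upper_left_block_def)
    then show ?thesis using False by (simp add: upper_left_unit_def)
  next
    case j: True
    show ?thesis
    proof (cases "i \<in> S")
      case True
      then have "(\<Sum>k\<in>UNIV. ?G $ i $ k * ?F $ k $ j) = (\<Sum>k\<in>UNIV. if k = i then M $ i $ j else 0)"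
        using j by (intro sum.cong) (auto simp: upper_left_block_def upper_left_unit_def)
      then show ?thesis by simp
    next
      case False
      then have "?G $ i $ k * ?F $ k $ j = 0" for k
        using j assms[of i k] by (auto simp: upper_left_block_def upper_left_unit_def)
      then show ?thesis using assms[OF False j] by simp
    qed
  qed
  finally show "(?G ** ?F) $ i $ j = M $ i $ j" .
qed

text \<open>Linear polynomials are prime. Monicity pins down the constant factor.\<close>
lemma monic_factor_of_linear_product:
  fixes F G :: "'a::idom poly"
  assumes "finite X" "F * G = (\<Prod>i\<in>X. [:- a i, 1:])" "lead_coeff F = 1"
  obtains I where "I \<subseteq> X" "F = (\<Prod>i\<in>I. [:- a i, 1:])" "G = (\<Prod>i\<in>X - I. [:- a i, 1:])"
  using assms
proof (induction X arbitrary: F G thesis rule: finite_induct)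
  case empty
  then have FG: "F * G = 1" by simp
  then have "F \<noteq> 0" "G \<noteq> 0" by auto
  then have "degree F + degree G = 0" using FG by (metis degree_mult_eq degree_1)
  then obtain c where "F = [:c:]" by (metis add_is_0 degree_eq_zeroE)
  then have "F = 1" using empty(3) by (simp add: one_pCons)
  then show ?case using empty(1)[of "{}"] FG by simp
next
  case (insert x X)
  let ?l = "[:- a x, 1:]"
  have FG: "F * G = ?l * (\<Prod>i\<in>X. [:- a i, 1:])" using insert by simp
  have l0: "?l \<noteq> 0" by simp
  have "poly (F * G) (a x) = 0" unfolding FG by simp
  then consider "poly F (a x) = 0" | "poly G (a x) = 0" by auto
  then show ?case
  proof cases
    case 1
    then obtain F' where F': "F = ?l * F'" unfolding poly_eq_0_iff_dvd by (elim dvdE)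
    then have "?l * (F' * G) = ?l * (\<Prod>i\<in>X. [:- a i, 1:])" using FG by (simp only: mult.assoc)
    then have "F' * G = (\<Prod>i\<in>X. [:- a i, 1:])" by (simp only: mult_cancel_left l0 simp_thms)
    moreover have "lead_coeff F' = 1"
      using insert.prems(3) lead_coeff_mult[of ?l F'] unfolding F' by simp
    ultimately obtain I where I: "I \<subseteq> X" "F' = (\<Prod>i\<in>I. [:- a i, 1:])" "G = (\<Prod>i\<in>X - I. [:- a i, 1:])"
      using insert.IH by blast
    have "finite I" "x \<notin> I" using I(1) insert.hyps finite_subset by auto
    then have "F = (\<Prod>i\<in>insert x I. [:- a i, 1:])" unfolding F' I(2) by simp
    moreover have "insert x X - insert x I = X - I" using insert.hyps by auto
    ultimately show ?thesis using insert.prems(1)[of "insert x I"] I by auto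
  next
    case 2
    then obtain G' where G': "G = ?l * G'" unfolding poly_eq_0_iff_dvd by (elim dvdE)
    then have "?l * (F * G') = ?l * (\<Prod>i\<in>X. [:- a i, 1:])" using FG by (simp only: ac_simps)
    then have "F * G' = (\<Prod>i\<in>X. [:- a i, 1:])" by (simp only: mult_cancel_left l0 simp_thms)
    then obtain I where I: "I \<subseteq> X" "F = (\<Prod>i\<in>I. [:- a i, 1:])" "G' = (\<Prod>i\<in>X - I. [:- a i, 1:])"
      using insert.IH insert.prems(3) by blast
    have "x \<notin> I" using I(1) insert.hyps by auto
    then have "insert x X - I = insert x (X - I)" by auto
    then have "G = (\<Prod>i\<in>insert x X - I. [:- a i, 1:])" unfolding G' I(3) using insert.hyps by simp
    then show ?thesis using insert.prems(1)[of I] I by auto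
  qed
qed

lemma singular_matrix_null_vector:
  fixes M :: "'a::field ^ 'n ^ 'n"
  assumes "det M = 0"
  obtains v where "v \<noteq> 0" "M *v v = 0"
proof -
  have "\<not> invertible M" using assms invertible_det_nz by blast
  then have "\<not> (\<exists>B. B ** M = mat 1)"
    unfolding invertible_def using matrix_left_right_inverse by blast
  then show ?thesis using that unfolding matrix_left_invertible_ker by blast
qed

lemma charpoly_matrix_entry:
  "(mat [:0, 1:] - map_matrix (\<lambda>a. [:a:]) A) $ i $ j = (if i = j then [:0, 1:] else 0) - [:A $ i $ j:]"
  by (simp add: mat_def)

lemma charpoly_conjugate:
  fixes A P Q :: "'a::comm_ring_1 ^ 'n ^ 'n"
  assumes "Q ** P = mat 1"
  shows "charpoly (Q ** A ** P) = charpoly A"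
proof -
  define C where "C = (map_matrix (\<lambda>a. [:a:]) :: 'a ^ 'n ^ 'n \<Rightarrow> _)"
  have C_mult: "C (M ** N) = C M ** C N" for M N
    unfolding C_def vec_eq_iff by (simp add: matrix_matrix_mult_def sum_to_poly[symmetric] ac_simps)
  have "C Q ** C P = mat 1"
    unfolding C_mult[symmetric] assms by (simp add: C_def vec_eq_iff mat_def one_pCons)
  moreover have X: "mat [:0, 1:] ** M = M ** mat [:0, 1:]" for M :: "'a poly ^ 'n ^ 'n"
    unfolding vec_eq_iff matrix_matrix_mult_def mat_def
    by (simp add: if_distrib if_distribR mult.commute cong: if_cong)
  ultimately have "mat [:0, 1:] - C (Q ** A ** P) = C Q ** (mat [:0, 1:] - C A) ** C P"
  proof -
    assume CQP: "C Q ** C P = mat 1" and X: "\<And>M :: 'a poly ^ 'n ^ 'n. mat [:0, 1:] ** M = M ** mat [:0, 1:]"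
    have "C Q ** (mat [:0, 1:] - C A) ** C P = C Q ** mat [:0, 1:] ** C P - C Q ** C A ** C P"
      by (simp add: vec_eq_iff matrix_matrix_mult_def algebra_simps sum_subtractf sum_distrib_right sum_distrib_left)
    also have "C Q ** mat [:0, 1:] ** C P = C Q ** C P ** mat [:0, 1:]"
      unfolding matrix_mul_assoc[symmetric] X ..
    finally show ?thesis by (simp add: CQP C_mult)
  qed
  then have "charpoly (Q ** A ** P) = det (C Q) * det (mat [:0, 1:] - C A) * det (C P)"
    unfolding charpoly_def C_def[symmetric] by (simp add: det_mul)
  also have "\<dots> = (det (C Q) * det (C P)) * det (mat [:0, 1:] - C A)" by (simp add: ac_simps)
  also have "det (C Q) * det (C P) = 1"
    using \<open>C Q ** C P = mat 1\<close> by (metis det_I det_mul)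
  finally show ?thesis by (simp add: charpoly_def C_def)
qed

section \<open>Eigenvalues and bounded orbits\<close>

lemma norm_le_1_if_powers_bounded:
  fixes N c C :: real
  assumes "0 < c" "\<And>m::nat. N ^ m * c \<le> C"
  shows "N \<le> 1"
proof (rule ccontr)
  assume "\<not> N \<le> 1"
  then obtain m where "C / c < N ^ m" using real_arch_pow[of N "C / c"] by auto
  then show False using assms(1) assms(2)[of m] by (simp add: field_simps)
qed

context
  fixes \<iota> :: "'p::prime_card padic \<Rightarrow> 'k::field" and N :: "'k \<Rightarrow> real"
  assumes hom: "field_hom \<iota>" and ext: "is_norm_extension \<iota> N"
begin

interpretation \<iota>: field_hom \<iota> by (rule hom)

lemma norm_extension_nonneg: "0 \<le> N x"
  and norm_extension_eq_0: "N x = 0 \<longleftrightarrow> x = 0"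
  and norm_extension_mult: "N (x * y) = N x * N y"
  and norm_extension_triangle: "N (x + y) \<le> N x + N y"
  and norm_extension_eq: "N (\<iota> c) = padic_norm c"
  using ext unfolding is_norm_extension_def by auto

lemma norm_extension_1: "N 1 = 1"
  using norm_extension_eq[of 1] by simp

lemma norm_extension_power: "N (x ^ m) = N x ^ m"
  by (induction m) (simp_all add: norm_extension_1 norm_extension_mult)

lemma norm_extension_prod: "N (\<Prod>i\<in>I. f i) = (\<Prod>i\<in>I. N (f i))"
  by (induction I rule: infinite_finite_induct) (simp_all add: norm_extension_1 norm_extension_mult)

lemma norm_extension_minus: "N (- x) = N x"
proof -
  have "N (- 1) = padic_norm (- 1 :: 'p padic)" using norm_extension_eq[of "- 1"] by (simp add: \<iota>.hom_uminus)
  then have "N (- 1) = 1" by (simp add: padic_norm_minus)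
  then show ?thesis using norm_extension_mult[of "- 1" x] by simp
qed

lemma norm_extension_sum_le: "N (\<Sum>i\<in>I. f i) \<le> (\<Sum>i\<in>I. N (f i))"
proof (induction I rule: infinite_finite_induct)
  case (insert i I)
  then show ?case using norm_extension_triangle[of "f i" "\<Sum>i\<in>I. f i"] by simp
qed (simp_all add: norm_extension_eq_0[THEN iffD2])

text \<open>Applying \<open>B\<^sup>m\<close> to the eigenvector \<open>v\<close> gives \<open>\<mu>\<^sup>m v\<close> on the one hand, and on the other hand a combination,
with fixed coefficients, of the orbits of those unit vectors that occur in \<open>v\<close>. Only
these orbits have to be bounded.\<close>
lemma right_eigenvalue_bounded:
  assumes v: "v \<noteq> 0" and eig: "map_matrix \<iota> B *v v = \<mu> *s v"
    and bd: "\<And>m i j. v $ j \<noteq> 0 \<Longrightarrow> padic_norm ((((*v) B ^^ m) (axis j 1)) $ i) \<le> C"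
  shows "N \<mu> \<le> 1"
proof -
  define b where "b m j = ((*v) B ^^ m) (axis j 1)" for m j
  have pow: "(\<Sum>j\<in>UNIV. v $ j * \<iota> (b m j $ i)) = \<mu> ^ m * v $ i" for m i
  proof (induction m arbitrary: i)
    case 0
    have "(\<Sum>j\<in>UNIV. v $ j * \<iota> (b 0 j $ i)) = (\<Sum>j\<in>UNIV. if j = i then v $ i else 0)"
      by (intro sum.cong) (auto simp: b_def axis_def)
    then show ?case by simp
  next
    case (Suc m)
    have "(\<Sum>j\<in>UNIV. v $ j * \<iota> (b (Suc m) j $ i))
        = (\<Sum>j\<in>UNIV. \<Sum>k\<in>UNIV. \<iota> (B $ i $ k) * (v $ j * \<iota> (b m j $ k)))"
      by (simp add: b_def matrix_vector_mult_def \<iota>.hom_sum \<iota>.hom_mult sum_distrib_left mult.left_commute)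
    also have "\<dots> = (\<Sum>k\<in>UNIV. \<Sum>j\<in>UNIV. \<iota> (B $ i $ k) * (v $ j * \<iota> (b m j $ k)))"
      by (rule sum.swap)
    also have "\<dots> = (\<Sum>k\<in>UNIV. \<iota> (B $ i $ k) * (\<mu> ^ m * v $ k))"
      by (simp add: sum_distrib_left[symmetric] Suc)
    also have "\<dots> = \<mu> ^ m * (map_matrix \<iota> B *v v) $ i"
      by (simp add: matrix_vector_mult_def sum_distrib_left mult.left_commute)
    finally show ?case unfolding eig by simp
  qed
  obtain i where i: "v $ i \<noteq> 0" using v by (auto simp: vec_eq_iff)
  show ?thesis
  proof (rule norm_le_1_if_powers_bounded)
    show "0 < N (v $ i)" using i norm_extension_nonneg[of "v $ i"] norm_extension_eq_0[of "v $ i"] by linarith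
    fix m :: nat
    have "N \<mu> ^ m * N (v $ i) = N (\<Sum>j\<in>UNIV. v $ j * \<iota> (b m j $ i))"
      unfolding pow by (simp add: norm_extension_mult norm_extension_power)
    also have "\<dots> \<le> (\<Sum>j\<in>UNIV. N (v $ j * \<iota> (b m j $ i)))" by (rule norm_extension_sum_le)
    also have "\<dots> \<le> (\<Sum>j\<in>UNIV. N (v $ j) * C)"
    proof (rule sum_mono)
      fix j
      show "N (v $ j * \<iota> (b m j $ i)) \<le> N (v $ j) * C"
      proof (cases "v $ j = 0")
        case False
        then show ?thesis
          using bd[OF False, of m i] unfolding norm_extension_mult norm_extension_eq b_def
          by (intro mult_left_mono norm_extension_nonneg)
      qed (simp add: norm_extension_eq_0[THEN iffD2])
    qed
    finally show "N \<mu> ^ m * N (v $ i) \<le> (\<Sum>j\<in>UNIV. N (v $ j) * C)" .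
  qed
qed

text \<open>The dual statement: pairing a left eigenvector \<open>v\<close> with the orbit of a single unit vector
multiplies by \<open>\<mu>\<close> in each step, so one bounded orbit suffices, provided the pairing
does not vanish at the start.\<close>
lemma left_eigenvalue_bounded:
  assumes v: "v $ j \<noteq> 0" and eig: "v v* map_matrix \<iota> A = \<mu> *s v"
    and bd: "\<And>m i. padic_norm ((((*v) A ^^ m) (axis j 1)) $ i) \<le> C"
  shows "N \<mu> \<le> 1"
proof -
  define b where "b m = ((*v) A ^^ m) (axis j 1)" for m
  have eig': "(\<Sum>i\<in>UNIV. v $ i * \<iota> (A $ i $ k)) = \<mu> * v $ k" for k
    using arg_cong[OF eig, of "\<lambda>w. w $ k"] by (simp add: vector_matrix_mult_def mult.commute)
  have pow: "(\<Sum>i\<in>UNIV. v $ i * \<iota> (b m $ i)) = \<mu> ^ m * v $ j" for m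
  proof (induction m)
    case 0
    have "(\<Sum>i\<in>UNIV. v $ i * \<iota> (b 0 $ i)) = (\<Sum>i\<in>UNIV. if i = j then v $ j else 0)"
      by (intro sum.cong) (auto simp: b_def axis_def)
    then show ?case by simp
  next
    case (Suc m)
    have "(\<Sum>i\<in>UNIV. v $ i * \<iota> (b (Suc m) $ i))
        = (\<Sum>i\<in>UNIV. \<Sum>k\<in>UNIV. (v $ i * \<iota> (A $ i $ k)) * \<iota> (b m $ k))"
      by (simp add: b_def matrix_vector_mult_def \<iota>.hom_sum \<iota>.hom_mult sum_distrib_left mult.assoc)
    also have "\<dots> = (\<Sum>k\<in>UNIV. \<Sum>i\<in>UNIV. (v $ i * \<iota> (A $ i $ k)) * \<iota> (b m $ k))"
      by (rule sum.swap)
    also have "\<dots> = (\<Sum>k\<in>UNIV. (\<Sum>i\<in>UNIV. v $ i * \<iota> (A $ i $ k)) * \<iota> (b m $ k))"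
      by (simp only: sum_distrib_right)
    also have "\<dots> = \<mu> * (\<Sum>k\<in>UNIV. v $ k * \<iota> (b m $ k))"
      unfolding eig' by (simp only: sum_distrib_left mult.assoc)
    finally show ?case unfolding Suc by simp
  qed
  show ?thesis
  proof (rule norm_le_1_if_powers_bounded)
    show "0 < N (v $ j)" using v norm_extension_nonneg[of "v $ j"] norm_extension_eq_0[of "v $ j"] by linarith
    fix m :: nat
    have "N \<mu> ^ m * N (v $ j) = N (\<Sum>i\<in>UNIV. v $ i * \<iota> (b m $ i))"
      unfolding pow by (simp add: norm_extension_mult norm_extension_power)
    also have "\<dots> \<le> (\<Sum>i\<in>UNIV. N (v $ i * \<iota> (b m $ i)))" by (rule norm_extension_sum_le)
    also have "\<dots> \<le> (\<Sum>i\<in>UNIV. N (v $ i) * C)"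
      using bd unfolding norm_extension_mult norm_extension_eq b_def
      by (intro sum_mono mult_left_mono norm_extension_nonneg)
    finally show "N \<mu> ^ m * N (v $ j) \<le> (\<Sum>i\<in>UNIV. N (v $ i) * C)" .
  qed
qed

lemma poly_map_det:
  "poly (map_poly \<iota> (det M)) \<mu> = det (map_matrix (\<lambda>q. poly (map_poly \<iota> q) \<mu>) M)"
proof (rule det_ring_hom)
  interpret map_poly_comm_ring_hom \<iota> ..
  show "comm_ring_hom (\<lambda>q. poly (map_poly \<iota> q) \<mu>)"
    by unfold_locales (simp_all add: hom_distribs)
qed

end

section \<open>Closed subgroups and additive maps\<close>

lemma padic_integer_limit_of_nats:
  fixes c :: "'p::prime_card padic"
  assumes "padic_norm c \<le> 1"
  obtains k :: "nat \<Rightarrow> nat" where "(\<lambda>m. of_nat (k m)) \<longlonglongrightarrow> c"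
proof -
  have "\<exists>k. padic_norm (c - of_nat k) \<le> (1 / CARD('p)) ^ m" for m
    using padic_nat_approx[OF assms, of m] by blast
  then obtain k where k: "\<And>m. padic_norm (c - of_nat (k m)) \<le> (1 / CARD('p)) ^ m" by metis
  have "(\<lambda>m. (1 / real CARD('p)) ^ m) \<longlonglongrightarrow> 0"
    using prime_gt_1_nat[OF prime_card[where 'a='p]] by (intro LIMSEQ_power_zero) simp
  then have "(\<lambda>m. dist (of_nat (k m)) c) \<longlonglongrightarrow> 0"
    by (rule Lim_null_comparison[rotated])
       (use k in \<open>simp add: dist_commute, simp add: dist_padic_def padic_norm_nonneg\<close>)
  then have "(\<lambda>m. of_nat (k m)) \<longlonglongrightarrow> c" by (subst tendsto_dist_iff)
  then show ?thesis by (rule that)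
qed

lemma tendsto_padic_vector_scale:
  fixes x :: "'p::prime_card padic ^ 'n"
  assumes "(f \<longlongrightarrow> c) F"
  shows "((\<lambda>m. f m *s x) \<longlongrightarrow> c *s x) F"
  unfolding vector_scalar_mult_def
  by (intro tendsto_vec_lambda tendsto_padic_mult assms tendsto_const)

lemma additive_of_nat_scale:
  fixes f :: "'a::field ^ 'n \<Rightarrow> 'a ^ 'm"
  assumes "Modules.additive f"
  shows "f (of_nat k *s x) = of_nat k *s f x"
proof -
  interpret f: Modules.additive f by fact
  show ?thesis by (induction k) (simp_all add: f.zero f.add vector_sadd_rdistrib)
qed

text \<open>A closed subgroup is a module over the \<open>p\<close>-adic integers, because the natural numbers are
dense in them.\<close>
lemma closed_subgroup_padic_scale:
  fixes L :: "('p::prime_card padic ^ 'n) set"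
  assumes L: "add_subgroup L" "closed L" and c: "padic_norm c \<le> 1" and x: "x \<in> L"
  shows "c *s x \<in> L"
proof -
  obtain k :: "nat \<Rightarrow> nat" where k: "(\<lambda>m. of_nat (k m)) \<longlonglongrightarrow> c"
    using c by (rule padic_integer_limit_of_nats)
  have nat: "of_nat m *s x \<in> L" for m
    by (induction m) (auto simp: vector_sadd_rdistrib add_subgroup_zero[OF L(1)] intro: add_subgroup_add[OF L(1)] x)
  show ?thesis
    by (rule closed_sequentially[OF L(2) _ tendsto_padic_vector_scale[OF k]]) (rule nat)
qed

lemma padic_scale_into_integers:
  obtains c :: "'p::prime_card padic" where "c \<noteq> 0" "padic_norm c \<le> 1" "padic_norm (c * d) \<le> 1"
proof -
  obtain e :: "'p padic" where e: "e \<noteq> 0" "max 1 (padic_norm d) \<le> padic_norm e" by (rule padic_large_element)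
  have "padic_norm (inverse e) \<le> 1" unfolding padic_norm_inverse
    using e(2) by (intro inverse_le_1_iff[THEN iffD2]) simp
  moreover have "padic_norm (inverse e * d) \<le> 1"
    unfolding padic_norm_mult padic_norm_inverse using e(2) by (simp add: field_simps)
  ultimately show ?thesis using that[of "inverse e"] e(1) by simp
qed

text \<open>Homogeneity under \<open>p\<close>-adic integers again follows by density, and a general scalar \<open>d\<close> is a
quotient of two integers \<open>c * d\<close> and \<open>c\<close>.\<close>
lemma continuous_additive_padic_linear:
  fixes f :: "'p::prime_card padic ^ 'n \<Rightarrow> 'p padic ^ 'm"
  assumes f: "Modules.additive f" and cont: "continuous_on UNIV f"
  shows "Vector_Spaces.linear (*s) (*s) f"
proof -
  interpret f: Modules.additive f by fact
  have int: "f (c *s x) = c *s f x" if c: "padic_norm c \<le> 1" for c x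
  proof -
    obtain k :: "nat \<Rightarrow> nat" where k: "(\<lambda>m. of_nat (k m)) \<longlonglongrightarrow> c"
      using c by (rule padic_integer_limit_of_nats)
    have "(\<lambda>m. f (of_nat (k m) *s x)) \<longlonglongrightarrow> f (c *s x)"
      by (rule continuous_on_tendsto_compose[OF cont tendsto_padic_vector_scale[OF k]]) auto
    then have "(\<lambda>m. of_nat (k m) *s f x) \<longlonglongrightarrow> f (c *s x)"
      by (simp add: additive_of_nat_scale[OF f])
    then show ?thesis using tendsto_padic_vector_scale[OF k] by (rule LIMSEQ_unique)
  qed
  have scale: "f (d *s x) = d *s f x" for d x
  proof -
    obtain c :: "'p padic" where c: "c \<noteq> 0" "padic_norm c \<le> 1" "padic_norm (c * d) \<le> 1"
      by (rule padic_scale_into_integers)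
    have "c *s f (d *s x) = f (c *s (d *s x))" by (rule int[OF c(2), symmetric])
    also have "\<dots> = c *s (d *s f x)" using int[OF c(3), of x] by (simp add: vector_smult_assoc)
    finally show ?thesis using c(1) by (simp add: vec_eq_iff)
  qed
  show ?thesis
    by unfold_locales (auto simp: f.add scale vector_add_ldistrib vector_sadd_rdistrib vector_smult_assoc)
qed

lemma padic_compact_bounded:
  fixes L :: "('p::prime_card padic ^ 'n) set"
  assumes "compact L"
  obtains C where "\<And>x i. x \<in> L \<Longrightarrow> padic_norm (x $ i) \<le> C"
proof -
  obtain C where C: "\<forall>x\<in>L. dist 0 x \<le> C"
    using compact_imp_bounded[OF assms] bounded_any_center by blast
  have "padic_norm (x $ i) \<le> C" if "x \<in> L" for x i
    using dist_vec_nth_le[of 0 i x] C that by (fastforce simp: dist_padic_def padic_norm_minus)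
  then show ?thesis by (rule that)
qed

lemma add_subgroup_sum:
  fixes H :: "'a::ab_group_add set"
  assumes "add_subgroup H" "\<And>i. i \<in> I \<Longrightarrow> f i \<in> H"
  shows "(\<Sum>i\<in>I. f i) \<in> H"
  using assms(2)
  by (induction I rule: infinite_finite_induct)
     (auto intro: add_subgroup_add[OF assms(1)] add_subgroup_zero[OF assms(1)])

lemma open_subgroup:
  fixes H :: "'a::topological_ab_group_add set"
  assumes H: "add_subgroup H" and U: "open U" "0 \<in> U" "U \<subseteq> H"
  shows "open H"
proof -
  have "H = (\<Union>x\<in>H. (+) x ` U)"
  proof (intro equalityI subsetI)
    fix x assume "x \<in> H"
    moreover have "x \<in> (+) x ` U" using U(2) by force
    ultimately show "x \<in> (\<Union>x\<in>H. (+) x ` U)" by blast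
  next
    fix y assume "y \<in> (\<Union>x\<in>H. (+) x ` U)"
    then obtain x u where "x \<in> H" "u \<in> U" "y = x + u" by blast
    then show "y \<in> H" using add_subgroup_add[OF H] U(3) by blast
  qed
  moreover have "open (\<Union>x\<in>H. (+) x ` U)" using open_translation_group[OF U(1)] by blast
  ultimately show ?thesis by simp
qed

section \<open>The expanding part of an automorphism\<close>

text \<open>The group \<open>P\<close> lives in the coordinates in \<open>S\<close> only. It is made open by adding the integral vectors
\<open>W\<close> in the other coordinates, and \<open>A\<close> is replaced there by the identity, which changes neither the
index nor the determinant of the block. The sign of \<open>- A\<close> is harmless for a subgroup and makes the
determinant the constant coefficient of the characteristic polynomial of the block.\<close>
lemma expanding_index_eq_det:
  fixes A :: "'p::prime_card padic ^ 'n ^ 'n" and S :: "'n set"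
  assumes P: "add_subgroup P" "compact P" "P \<subseteq> (*v) A ` P"
    and axisP: "\<And>i. i \<in> S \<Longrightarrow> axis i 1 \<in> P"
    and suppP: "\<And>x i. x \<in> P \<Longrightarrow> i \<notin> S \<Longrightarrow> x $ i = 0"
    and suppAP: "\<And>x i. x \<in> P \<Longrightarrow> i \<notin> S \<Longrightarrow> (A *v x) $ i = 0"
    and det: "det (upper_left_block S (- A)) \<noteq> 0"
  shows "real (add_index ((*v) A ` P) P) = padic_norm (det (upper_left_block S (- A)))"
proof -
  let ?T = "upper_left_block S (- A)"
  define W where "W = {z :: 'p padic ^ 'n. (\<forall>i\<in>S. z $ i = 0) \<and> (\<forall>i. padic_norm (z $ i) \<le> 1)}"
  define M where "M = (\<lambda>(y, z). y + z) ` (P \<times> W)"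
  have O: "(unit_polydisc :: ('p padic ^ 'n) set) \<in> compact_open_subgroups"
    by (rule polydisc_compact_open_subgroup) simp
  have MI: "y + z \<in> M" if "y \<in> P" "z \<in> W" for y z using that unfolding M_def by force
  have ME: "\<exists>y\<in>P. \<exists>z\<in>W. x = y + z" if "x \<in> M" for x using that unfolding M_def by auto
  have W: "add_subgroup W" unfolding add_subgroup_def W_def
    by (auto simp: padic_norm_minus intro: padic_norm_add_le)
  have Wcomp: "compact W"
  proof -
    have "W = unit_polydisc \<inter> (\<Inter>i\<in>S. (\<lambda>z. z $ i) -` {0})" unfolding W_def polydisc_def by auto
    moreover have "compact (unit_polydisc :: ('p padic ^ 'n) set)"
      using O by (simp add: compact_open_subgroups_def)
    ultimately show ?thesis
      by (auto intro!: compact_Int_closed closed_INT closed_vimage_vec_nth)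
  qed
  have Msub: "add_subgroup M"
    unfolding add_subgroup_def
  proof (intro conjI ballI)
    show "0 \<in> M" using MI[OF add_subgroup_zero[OF P(1)] add_subgroup_zero[OF W]] by simp
    fix x assume "x \<in> M"
    then obtain a b where x: "a \<in> P" "b \<in> W" "x = a + b" using ME by blast
    show "- x \<in> M"
      using MI[OF add_subgroup_minus[OF P(1) x(1)] add_subgroup_minus[OF W x(2)]] x(3) by simp
    fix y assume "y \<in> M"
    then obtain c d where y: "c \<in> P" "d \<in> W" "y = c + d" using ME by blast
    show "x + y \<in> M"
      using MI[OF add_subgroup_add[OF P(1) x(1) y(1)] add_subgroup_add[OF W x(2) y(2)]] x(3) y(3)
      by (simp add: algebra_simps)
  qed
  have "compact M" unfolding M_def case_prod_beta'
    by (intro compact_continuous_image compact_Times P Wcomp continuous_intros)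
  moreover have "open M"
  proof (rule open_subgroup[OF Msub])
    show "open (unit_polydisc :: ('p padic ^ 'n) set)" "0 \<in> (unit_polydisc :: ('p padic ^ 'n) set)"
      using O by (auto simp: compact_open_subgroups_def add_subgroup_def)
    show "unit_polydisc \<subseteq> M"
    proof
      fix x :: "'p padic ^ 'n" assume x: "x \<in> unit_polydisc"
      define y where "y = (\<Sum>i\<in>S. x $ i *s axis i 1)"
      have yi: "y $ i = (if i \<in> S then x $ i else 0)" for i
        unfolding y_def sum_component by (simp add: axis_def if_distrib cong: if_cong)
      have "y \<in> P" unfolding y_def
        using x by (intro add_subgroup_sum closed_subgroup_padic_scale P compact_imp_closed axisP)
          (auto simp: polydisc_def)
      moreover have "x - y \<in> W" using x unfolding W_def polydisc_def by (auto simp: yi)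
      ultimately show "x \<in> M" using MI[of y "x - y"] by simp
    qed
  qed
  ultimately have Mc: "M \<in> compact_open_subgroups" using Msub by (simp add: compact_open_subgroups_def)
  have TP: "?T *v y = - (A *v y)" if y: "y \<in> P" for y
    unfolding vec_eq_iff
  proof
    fix i
    show "(?T *v y) $ i = (- (A *v y)) $ i"
    proof (cases "i \<in> S")
      case True
      have "(\<Sum>j\<in>UNIV. ?T $ i $ j * y $ j) = (\<Sum>j\<in>UNIV. - (A $ i $ j * y $ j))"
        using True suppP[OF y] by (intro sum.cong) (auto simp: upper_left_block_def)
      then show ?thesis by (simp add: matrix_vector_mult_def sum_negf)
    next
      case False
      have "(\<Sum>j\<in>UNIV. ?T $ i $ j * y $ j) = (\<Sum>j\<in>UNIV. if j = i then y $ i else 0)"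
        using False by (intro sum.cong) (auto simp: upper_left_block_def)
      then show ?thesis using suppP[OF y False] suppAP[OF y False] by (simp add: matrix_vector_mult_def)
    qed
  qed
  have TW: "?T *v z = z" if z: "z \<in> W" for z
    unfolding vec_eq_iff
  proof
    fix i
    have "(\<Sum>j\<in>UNIV. ?T $ i $ j * z $ j) = (\<Sum>j\<in>UNIV. if j = i then z $ i else 0)"
      using z by (intro sum.cong) (auto simp: upper_left_block_def W_def)
    then show "(?T *v z) $ i = z $ i" by (simp add: matrix_vector_mult_def)
  qed
  have APsub: "add_subgroup ((*v) A ` P)" by (rule add_subgroup_image[OF additive_matrix_vector P(1)])
  have TM_E: "\<exists>y\<in>(*v) A ` P. \<exists>z\<in>W. x = y + z" if x: "x \<in> (*v) ?T ` M" for x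
  proof -
    obtain a b where ab: "a \<in> P" "b \<in> W" "x = ?T *v (a + b)" using x ME by blast
    have "x = A *v (- a) + b"
      unfolding ab(3) matrix_vector_right_distrib TP[OF ab(1)] TW[OF ab(2)]
      using additive.minus[OF additive_matrix_vector, of A a] by simp
    then show ?thesis using ab add_subgroup_minus[OF P(1)] by blast
  qed
  have TM_I: "A *v a + b \<in> (*v) ?T ` M" if "a \<in> P" "b \<in> W" for a b
  proof -
    have a: "- a \<in> P" by (rule add_subgroup_minus[OF P(1) that(1)])
    have "?T *v (- a + b) = A *v a + b"
      unfolding matrix_vector_right_distrib TP[OF a] TW[OF that(2)]
      using additive.minus[OF additive_matrix_vector, of A a] by simp
    then show ?thesis using MI[OF a that(2)] by (metis imageI)
  qed
  have index: "add_index ((*v) ?T ` M) M = add_index ((*v) A ` P) ((*v) A ` P \<inter> M)"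
  proof (rule add_index_sum[OF Msub APsub])
    show "(*v) A ` P \<subseteq> (*v) ?T ` M" using TM_I[OF _ add_subgroup_zero[OF W]] by auto
    fix g assume "g \<in> (*v) ?T ` M"
    then obtain y z where g: "y \<in> (*v) A ` P" "z \<in> W" "g = y + z" using TM_E by blast
    have "g - y \<in> M" using MI[OF add_subgroup_zero[OF P(1)] g(2)] g(3) by simp
    then show "\<exists>g'\<in>(*v) A ` P. g - g' \<in> M" using g(1) by blast
  qed
  have "(*v) A ` P \<inter> M = P"
  proof (intro equalityI subsetI)
    fix x assume x: "x \<in> (*v) A ` P \<inter> M"
    then obtain y z where yz: "y \<in> P" "z \<in> W" "x = y + z" using ME by blast
    have "z $ i = 0" for i
    proof (cases "i \<in> S")
      case False
      have "x $ i = 0" using x suppAP False by blast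
      then show ?thesis using yz suppP[OF yz(1) False] by simp
    qed (use yz in \<open>simp add: W_def\<close>)
    then have "z = 0" by (simp add: vec_eq_iff)
    then show "x \<in> P" using yz by simp
  next
    fix x assume "x \<in> P"
    then show "x \<in> (*v) A ` P \<inter> M" using P(3) MI[OF _ add_subgroup_zero[OF W], of x] by auto
  qed
  moreover have TMc: "(*v) ?T ` M \<in> compact_open_subgroups"
    by (rule compact_open_subgroups_matrix_image[OF det Mc])
  moreover have "M \<subseteq> (*v) ?T ` M"
  proof
    fix x assume "x \<in> M"
    then obtain y z where "y \<in> P" "z \<in> W" "x = y + z" using ME by blast
    then show "x \<in> (*v) ?T ` M" using P(3) TM_I by blast
  qed
  ultimately have "real (add_index ((*v) A ` P) P) * lattice_volume M = lattice_volume ((*v) ?T ` M)"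
    using lattice_volume_index[OF TMc Mc] index by simp
  also have "\<dots> = padic_norm (det ?T) * lattice_volume M"
    by (rule lattice_volume_matrix_image[OF det Mc])
  finally show ?thesis using lattice_volume_pos[OF Mc] by simp
qed

text \<open>The characteristic polynomial of \<open>A\<close> factors as \<open>G * F\<close> with \<open>F\<close> monic and belonging to the block on
\<open>S\<close>. Roots of \<open>F\<close> have norm at least one and roots of \<open>G\<close> at most one, so the product over all eigenvalues of
norm greater than one is the product over the roots of \<open>F\<close>, that is, the norm of \<open>F(0)\<close>.\<close>
lemma expanding_eigenvalue_product:
  fixes A :: "'p::prime_card padic ^ 'n ^ 'n" and S :: "'n set"
    and \<iota> :: "'p padic \<Rightarrow> 'k::field" and N :: "'k \<Rightarrow> real" and ev :: "'n \<Rightarrow> 'k"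
  assumes hom: "field_hom \<iota>" and ext: "is_norm_extension \<iota> N"
    and ev: "is_eigenvalue_family \<iota> A ev" and detA: "det A \<noteq> 0"
    and P: "compact P" "P \<subseteq> (*v) A ` P"
    and axisP: "\<And>i. i \<in> S \<Longrightarrow> axis i 1 \<in> P"
    and suppAP: "\<And>x i. x \<in> P \<Longrightarrow> i \<notin> S \<Longrightarrow> (A *v x) $ i = 0"
    and M: "compact M" "(*v) A ` M \<subseteq> M"
    and axisM: "\<And>i. i \<notin> S \<Longrightarrow> axis i 1 \<in> M"
  shows "(\<Prod>i | N (ev i) > 1. N (ev i)) = padic_norm (det (upper_left_block S (- A)))"
    and "det (upper_left_block S (- A)) \<noteq> 0"
proof -
  interpret \<iota>: field_hom \<iota> by (rule hom)
  interpret \<iota>p: map_poly_idom_hom \<iota> ..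
  have tri: "A $ i $ j = 0" if "i \<notin> S" "j \<in> S" for i j
    using suppAP[OF axisP[OF that(2)] that(1)]
    by (simp add: matrix_vector_mult_def axis_def if_distrib cong: if_cong)
  define X where "X = mat [:0, 1:] - map_matrix (\<lambda>a. [:a:]) A"
  have X: "X $ i $ j = (if i = j then [:0, 1:] else 0) - [:A $ i $ j:]" for i j
    unfolding X_def by (rule charpoly_matrix_entry)
  have Xtri: "X $ i $ j = 0" if "i \<notin> S" "j \<in> S" for i j
    using that tri[OF that] by (auto simp: X)
  define F where "F = det (upper_left_block S X)"
  define G where "G = det (upper_left_unit S X)"
  have "charpoly A = G * F"
    unfolding charpoly_def X_def[symmetric] F_def G_def det_mul[symmetric]
    using block_triangular_factorization[of S X] Xtri by simp
  then have prod: "map_poly \<iota> F * map_poly \<iota> G = (\<Prod>i\<in>UNIV. [:- ev i, 1:])"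
    using ev unfolding is_eigenvalue_family_def by (simp add: \<iota>p.hom_mult mult.commute)
  have F_monic: "lead_coeff F = 1"
  proof -
    let ?d = "\<lambda>i. if i \<in> S then 1 else 0 :: nat"
    have deg: "degree (upper_left_block S X $ i $ j) \<le> ?d i" for i j
      by (auto simp: upper_left_block_def X intro!: degree_diff_le)
    have "(\<chi> i j. poly.coeff (upper_left_block S X $ i $ j) (?d i)) = mat 1"
      by (auto simp: vec_eq_iff mat_def upper_left_block_def X)
    then have c: "poly.coeff F (\<Sum>i\<in>UNIV. ?d i) = 1"
      using det_degree_bound(2)[of "upper_left_block S X" ?d, OF deg] unfolding F_def by simp
    then have "degree F = (\<Sum>i\<in>UNIV. ?d i)"
      using det_degree_bound(1)[of "upper_left_block S X" ?d, OF deg] le_degree[of F "\<Sum>i\<in>UNIV. ?d i"]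
      unfolding F_def by simp
    then show ?thesis using c by simp
  qed
  have "lead_coeff (map_poly \<iota> F) = 1"
    using F_monic by (simp add: \<iota>.hom_lead_coeff)
  then obtain I where I: "I \<subseteq> UNIV" "map_poly \<iota> F = (\<Prod>i\<in>I. [:- ev i, 1:])"
      "map_poly \<iota> G = (\<Prod>i\<in>UNIV - I. [:- ev i, 1:])"
    by (rule monic_factor_of_linear_product[OF finite_class.finite_UNIV prod])
  obtain B where B: "A ** B = mat 1" "B ** A = mat 1" using detA by (rule matrix_inverse_exists)
  obtain CP where CP: "\<And>x i. x \<in> P \<Longrightarrow> padic_norm (x $ i) \<le> CP" using padic_compact_bounded[OF P(1)] by blast
  obtain CM where CM: "\<And>x i. x \<in> M \<Longrightarrow> padic_norm (x $ i) \<le> CM" using padic_compact_bounded[OF M(1)] by blast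
  \<comment> \<open>A root of \<open>F\<close> has an eigenvector supported on \<open>S\<close>, and the inverse \<open>B\<close> of \<open>A\<close> maps \<open>P\<close> into itself.\<close>
  have ge1: "1 \<le> N (ev i)" if i: "i \<in> I" for i
  proof -
    let ?\<mu> = "ev i"
    have "poly (map_poly \<iota> F) ?\<mu> = 0" unfolding I(2) poly_prod using i by (intro prod_zero) auto
    then have "det (map_matrix (\<lambda>q. poly (map_poly \<iota> q) ?\<mu>) (upper_left_block S X)) = 0"
      unfolding F_def poly_map_det[OF hom ext] .
    then obtain v where v: "v \<noteq> 0" and
        null: "map_matrix (\<lambda>q. poly (map_poly \<iota> q) ?\<mu>) (upper_left_block S X) *v v = 0"
      by (rule singular_matrix_null_vector)
    have row: "(\<Sum>j\<in>UNIV. poly (map_poly \<iota> (upper_left_block S X $ k $ j)) ?\<mu> * v $ j) = 0" for k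
      using arg_cong[OF null, of "\<lambda>w. w $ k"] by (simp add: matrix_vector_mult_def)
    have v0: "v $ k = 0" if k: "k \<notin> S" for k
    proof -
      have "(\<Sum>j\<in>UNIV. poly (map_poly \<iota> (upper_left_block S X $ k $ j)) ?\<mu> * v $ j)
          = (\<Sum>j\<in>UNIV. if j = k then v $ k else 0)"
        using k by (intro sum.cong) (auto simp: upper_left_block_def)
      then show ?thesis using row[of k] by simp
    qed
    have entry: "poly (map_poly \<iota> (X $ k $ j)) ?\<mu> = (if k = j then ?\<mu> else 0) - \<iota> (A $ k $ j)" for k j
      by (simp add: X hom_distribs)
    have Av: "map_matrix \<iota> A *v v = ?\<mu> *s v"
      unfolding vec_eq_iff
    proof
      fix k
      have "(\<Sum>j\<in>UNIV. \<iota> (A $ k $ j) * v $ j) = ?\<mu> * v $ k"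
      proof (cases "k \<in> S")
        case True
        have "(\<Sum>j\<in>UNIV. poly (map_poly \<iota> (upper_left_block S X $ k $ j)) ?\<mu> * v $ j)
            = (\<Sum>j\<in>UNIV. (if j = k then ?\<mu> * v $ k else 0) - \<iota> (A $ k $ j) * v $ j)"
        proof (rule sum.cong)
          fix j
          show "poly (map_poly \<iota> (upper_left_block S X $ k $ j)) ?\<mu> * v $ j
              = (if j = k then ?\<mu> * v $ k else 0) - \<iota> (A $ k $ j) * v $ j"
            using True v0[of j] by (cases "j \<in> S") (auto simp: upper_left_block_def entry algebra_simps)
        qed simp
        then show ?thesis using row[of k] by (simp add: sum_subtractf)
      next
        case False
        have "\<iota> (A $ k $ j) * v $ j = 0" for j
          using False v0[of j] tri[of k j] by (cases "j \<in> S") auto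
        then have "(\<Sum>j\<in>UNIV. \<iota> (A $ k $ j) * v $ j) = 0" by (intro sum.neutral ballI)
        then show ?thesis using v0[OF False] by simp
      qed
      then show "(map_matrix \<iota> A *v v) $ k = (?\<mu> *s v) $ k" by (simp add: matrix_vector_mult_def)
    qed
    have BA: "map_matrix \<iota> B ** map_matrix \<iota> A = mat 1"
    proof -
      have "map_matrix \<iota> B ** map_matrix \<iota> A = map_matrix \<iota> (B ** A)"
        by (simp add: vec_eq_iff matrix_matrix_mult_def hom_distribs)
      then show ?thesis unfolding B(2) by (simp add: vec_eq_iff mat_def)
    qed
    have vB: "v = ?\<mu> *s (map_matrix \<iota> B *v v)"
    proof -
      have "v = map_matrix \<iota> B *v (map_matrix \<iota> A *v v)" by (simp add: matrix_vector_mul_assoc BA)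
      then show ?thesis unfolding Av by (simp add: vec.scale)
    qed
    then have \<mu>0: "?\<mu> \<noteq> 0" using v by (metis vector_smult_lzero)
    have Bv: "map_matrix \<iota> B *v v = inverse ?\<mu> *s v"
      using arg_cong[OF vB, of "\<lambda>w. inverse ?\<mu> *s w"] \<mu>0 by (simp add: vector_smult_assoc)
    have "N (inverse ?\<mu>) \<le> 1"
    proof (rule right_eigenvalue_bounded[OF hom ext v Bv])
      fix m k j assume "v $ j \<noteq> 0"
      then have "j \<in> S" using v0 by blast
      have BP: "B *v x \<in> P" if x: "x \<in> P" for x
      proof -
        obtain y where "y \<in> P" "x = A *v y" using P(2) x by blast
        then show ?thesis using B(2) by (simp add: matrix_vector_mul_assoc)
      qed
      have "((*v) B ^^ m) (axis j 1) \<in> P"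
        by (induction m) (auto simp: axisP[OF \<open>j \<in> S\<close>] BP)
      then show "padic_norm (((*v) B ^^ m) (axis j 1) $ k) \<le> CP" by (rule CP)
    qed
    moreover have "N ?\<mu> * N (inverse ?\<mu>) = 1"
      using norm_extension_mult[OF hom ext, of ?\<mu> "inverse ?\<mu>"] norm_extension_1[OF hom ext] \<mu>0 by simp
    ultimately show ?thesis
      using mult_left_mono[of "N (inverse ?\<mu>)" 1 "N ?\<mu>"] norm_extension_nonneg[OF hom ext, of ?\<mu>] by simp
  qed
  \<comment> \<open>A root of \<open>G\<close> has a left eigenvector that vanishes on \<open>S\<close>, and \<open>A\<close> maps \<open>M\<close> into itself.\<close>
  have le1: "N (ev i) \<le> 1" if i: "i \<notin> I" for i
  proof -
    let ?\<mu> = "ev i"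
    let ?G = "map_matrix (\<lambda>q. poly (map_poly \<iota> q) ?\<mu>) (upper_left_unit S X)"
    have "poly (map_poly \<iota> G) ?\<mu> = 0" unfolding I(3) poly_prod using i by (intro prod_zero) auto
    then have "det (transpose ?G) = 0"
      unfolding G_def poly_map_det[OF hom ext] det_transpose .
    then obtain v where v: "v \<noteq> 0" and null: "transpose ?G *v v = 0"
      by (rule singular_matrix_null_vector)
    have col: "(\<Sum>k\<in>UNIV. poly (map_poly \<iota> (upper_left_unit S X $ k $ j)) ?\<mu> * v $ k) = 0" for j
      using arg_cong[OF null, of "\<lambda>w. w $ j"] by (simp add: matrix_vector_mult_def transpose_def)
    have v0: "v $ j = 0" if j: "j \<in> S" for j
    proof -
      have "(\<Sum>k\<in>UNIV. poly (map_poly \<iota> (upper_left_unit S X $ k $ j)) ?\<mu> * v $ k)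
          = (\<Sum>k\<in>UNIV. if k = j then v $ j else 0)"
        using j Xtri by (intro sum.cong) (auto simp: upper_left_unit_def)
      then show ?thesis using col[of j] by simp
    qed
    have entry: "poly (map_poly \<iota> (X $ k $ j)) ?\<mu> = (if k = j then ?\<mu> else 0) - \<iota> (A $ k $ j)" for k j
      by (simp add: X hom_distribs)
    have vA: "v v* map_matrix \<iota> A = ?\<mu> *s v"
      unfolding vec_eq_iff
    proof
      fix j
      have "(\<Sum>k\<in>UNIV. \<iota> (A $ k $ j) * v $ k) = ?\<mu> * v $ j"
      proof (cases "j \<in> S")
        case False
        have "(\<Sum>k\<in>UNIV. poly (map_poly \<iota> (upper_left_unit S X $ k $ j)) ?\<mu> * v $ k)
            = (\<Sum>k\<in>UNIV. (if k = j then ?\<mu> * v $ j else 0) - \<iota> (A $ k $ j) * v $ k)"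
        proof (rule sum.cong)
          fix k
          show "poly (map_poly \<iota> (upper_left_unit S X $ k $ j)) ?\<mu> * v $ k
              = (if k = j then ?\<mu> * v $ j else 0) - \<iota> (A $ k $ j) * v $ k"
            using False by (auto simp: upper_left_unit_def entry algebra_simps)
        qed simp
        then show ?thesis using col[of j] by (simp add: sum_subtractf)
      next
        case True
        have "\<iota> (A $ k $ j) * v $ k = 0" for k
          using True v0[of k] tri[of k j] by (cases "k \<in> S") auto
        then have "(\<Sum>k\<in>UNIV. \<iota> (A $ k $ j) * v $ k) = 0" by (intro sum.neutral ballI)
        then show ?thesis using v0[OF True] by simp
      qed
      then show "(v v* map_matrix \<iota> A) $ j = (?\<mu> *s v) $ j"
        by (simp add: vector_matrix_mult_def mult.commute)
    qed
    obtain j where j: "v $ j \<noteq> 0" using v by (auto simp: vec_eq_iff)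
    then have "j \<notin> S" using v0 by blast
    show ?thesis
    proof (rule left_eigenvalue_bounded[OF hom ext j vA])
      fix m k
      have "((*v) A ^^ m) (axis j 1) \<in> M"
        using M(2) by (induction m) (auto simp: axisM[OF \<open>j \<notin> S\<close>])
      then show "padic_norm (((*v) A ^^ m) (axis j 1) $ k) \<le> CM" by (rule CM)
    qed
  qed
  have "(\<Prod>i | N (ev i) > 1. N (ev i)) = (\<Prod>i\<in>I. N (ev i))"
  proof (rule prod.mono_neutral_left)
    show "{i. 1 < N (ev i)} \<subseteq> I" using le1 by force
    show "\<forall>i\<in>I - {i. 1 < N (ev i)}. N (ev i) = 1" using ge1 by force
  qed simp
  also have "\<dots> = N (\<Prod>i\<in>I. - ev i)"
    by (simp add: norm_extension_prod[OF hom ext] norm_extension_minus[OF hom ext])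
  also have "(\<Prod>i\<in>I. - ev i) = poly (map_poly \<iota> F) 0" unfolding I(2) poly_prod by simp
  also have "\<dots> = \<iota> (poly F 0)" using \<iota>.poly_map_poly[of F 0] by simp
  also have "poly F 0 = det (upper_left_block S (- A))"
  proof -
    have "comm_ring_hom (\<lambda>q. poly q (0 :: 'p padic))" by unfold_locales simp_all
    then have "poly F 0 = det (map_matrix (\<lambda>q. poly q 0) (upper_left_block S X))"
      unfolding F_def by (rule det_ring_hom)
    also have "map_matrix (\<lambda>q. poly q 0) (upper_left_block S X) = upper_left_block S (- A)"
      by (auto simp: vec_eq_iff upper_left_block_def X)
    finally show ?thesis .
  qed
  finally show main: "(\<Prod>i | N (ev i) > 1. N (ev i)) = padic_norm (det (upper_left_block S (- A)))"
    by (simp add: norm_extension_eq[OF hom ext])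
  have "0 < (\<Prod>i | N (ev i) > 1. N (ev i))" by (rule prod_pos) auto
  then show "det (upper_left_block S (- A)) \<noteq> 0" unfolding main by auto
qed

text \<open>A basis of the span of \<open>P\<close> inside \<open>P\<close> is completed by vectors of \<open>M\<close>; a completing vector cannot lie in
\<open>P\<close>. The columns of \<open>Q\<close> are this basis, so \<open>R\<close> computes coordinates with respect to it, and \<open>S\<close>
indexes the part inside \<open>P\<close>.\<close>
lemma adapted_basis:
  fixes P M :: "('a::field ^ 'n) set"
  assumes span: "vec.span (P \<union> M) = UNIV"
  obtains Q R :: "'a ^ 'n ^ 'n" and S where "Q ** R = mat 1" "R ** Q = mat 1"
    "\<forall>i\<in>S. axis i 1 \<in> (*v) R ` P" "\<forall>i\<in>-S. axis i 1 \<in> (*v) R ` M"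
    "\<forall>x\<in>vec.span P. \<forall>i\<in>-S. (R *v x) $ i = 0"
proof -
  obtain B1 where B1: "B1 \<subseteq> P" "vec.independent B1" "P \<subseteq> vec.span B1"
    by (rule vec.maximal_independent_subset)
  obtain B where B: "B1 \<subseteq> B" "B \<subseteq> P \<union> M" "vec.independent B" "P \<union> M \<subseteq> vec.span B"
    using vec.maximal_independent_subset_extend[of B1 "P \<union> M"] B1 by blast
  have spanB: "vec.span B = UNIV"
    using vec.span_mono[OF B(4)] span by (simp add: vec.span_span top.extremum_unique)
  have "card B = CARD('n)"
    using vec.dim_span_eq_card_independent[OF B(3)] unfolding spanB by (simp add: vec.dim_UNIV card_cart_basis)
  then obtain e where e: "bij_betw e (UNIV :: 'n set) B"
    using finite_same_card_bij[of "UNIV :: 'n set" B] vec.finiteI_independent[OF B(3)] by auto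
  define Q :: "'a ^ 'n ^ 'n" where "Q = (\<chi> i j. e j $ i)"
  have Qe: "Q *v axis j 1 = e j" for j
    by (simp add: vec_eq_iff Q_def matrix_vector_mult_def axis_def if_distrib cong: if_cong)
  have "vec.subspace (range ((*v) Q))"
    unfolding vec.subspace_def
    by (auto simp: image_iff)
      (metis matrix_vector_mult_0_right, metis matrix_vector_right_distrib, metis vec.scale)
  moreover have "B \<subseteq> range ((*v) Q)"
  proof
    fix b assume "b \<in> B"
    then obtain j where "b = e j" using e unfolding bij_betw_def by blast
    then show "b \<in> range ((*v) Q)" using Qe[of j] by (metis rangeI)
  qed
  ultimately have "surj ((*v) Q)" using vec.span_minimal[of B "range ((*v) Q)"] spanB by auto
  then obtain R where R: "Q ** R = mat 1" using matrix_right_invertible_surjective[of Q] by blast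
  then have RQ: "R ** Q = mat 1" using matrix_left_right_inverse by blast
  have Re: "R *v e j = axis j 1" for j
    unfolding Qe[symmetric] by (simp add: matrix_vector_mul_assoc RQ)
  define S where "S = {i. e i \<in> B1}"
  have supp: "(R *v x) $ i = 0" if x: "x \<in> vec.span P" and i: "i \<notin> S" for x i
  proof -
    have "vec.subspace {x. (R *v x) $ i = 0}"
      unfolding vec.subspace_def by (auto simp: matrix_vector_right_distrib vec.scale)
    moreover have "B1 \<subseteq> {x. (R *v x) $ i = 0}"
    proof
      fix b assume b: "b \<in> B1"
      then obtain j where j: "b = e j" using B(1) e unfolding bij_betw_def by blast
      then have "j \<noteq> i" using i b unfolding S_def by auto
      then show "b \<in> {x. (R *v x) $ i = 0}" using j by (simp add: Re axis_def)
    qed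
    ultimately have "vec.span B1 \<subseteq> {x. (R *v x) $ i = 0}" by (intro vec.span_minimal)
    moreover have "vec.span P \<subseteq> vec.span B1" using B1(3) by (simp add: vec.span_minimal vec.subspace_span)
    ultimately show ?thesis using x by blast
  qed
  show ?thesis
  proof (rule that[OF R RQ]; intro ballI)
    fix i assume "i \<in> S"
    then show "axis i 1 \<in> (*v) R ` P"
      using B1(1) Re[of i] unfolding S_def by (metis imageI mem_Collect_eq subsetD)
  next
    fix i assume i: "i \<in> - S"
    show "axis i 1 \<in> (*v) R ` M"
    proof -
      have eB: "e i \<in> B" "e i \<notin> B1" using e i unfolding bij_betw_def S_def by auto
      have "e i \<notin> P"
      proof
        assume "e i \<in> P"
        moreover have "vec.span B1 \<subseteq> vec.span (B - {e i})" using B(1) eB(2) by (intro vec.span_mono) auto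
        ultimately have "e i \<in> vec.span (B - {e i})" using B1(3) by blast
        then show False using B(3) eB(1) unfolding vec.dependent_def by blast
      qed
      then have "e i \<in> M" using B(2) eB(1) by blast
      then show ?thesis using Re[of i] by (metis imageI)
    qed
  qed (use supp in simp)
qed

theorem theorem5p2:
  fixes \<phi> :: "'p::prime_card padic ^ 'n \<Rightarrow> 'p padic ^ 'n"
    and \<iota> :: "'p padic \<Rightarrow> 'k::field"
    and N :: "'k \<Rightarrow> real"
    and ev :: "'n \<Rightarrow> 'k"
  assumes "topological_automorphism \<phi>"
    and "finite_field_extension \<iota>"
    and "is_norm_extension \<iota> N"
    and "is_eigenvalue_family \<iota> (matrix \<phi>) ev"
  shows "real (aut_scale \<phi>) = (\<Prod>i | N (ev i) > 1. N (ev i))"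
proof -
  have hom: "field_hom \<iota>" using assms(2) by (simp add: finite_field_extension_def)
  obtain \<psi> where add: "\<And>x y. \<phi> (x + y) = \<phi> x + \<phi> y" and \<psi>: "homeomorphism UNIV UNIV \<phi> \<psi>"
    using assms(1) unfolding topological_automorphism_def by blast
  have add': "Modules.additive \<phi>" by standard (rule add)
  have cont: "continuous_on UNIV \<phi>" and inj: "inj \<phi>"
    using \<psi> unfolding homeomorphism_def by (auto intro: inj_on_inverseI)
  have lin: "Vector_Spaces.linear (*s) (*s) \<phi>"
    by (rule continuous_additive_padic_linear[OF add' cont])
  define A where "A = matrix \<phi>"
  have \<phi>A: "\<phi> = (*v) A" unfolding A_def by (rule ext) (simp add: matrix_works[OF lin])
  have detA: "det A \<noteq> 0"
  proof
    assume "det A = 0"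
    then obtain v where "v \<noteq> 0" "A *v v = 0" by (rule singular_matrix_null_vector)
    then show False using inj unfolding \<phi>A by (metis injD matrix_vector_mult_0_right)
  qed
  have "unit_polydisc \<in> (compact_open_subgroups :: ('p padic ^ 'n) set set)"
    by (rule polydisc_compact_open_subgroup) simp
  then have "(compact_open_subgroups :: ('p padic ^ 'n) set set) \<noteq> {}" by blast
  then obtain U P M where U: "U \<in> compact_open_subgroups"
    and P: "add_subgroup P" "compact P" "P \<subseteq> \<phi> ` P" "\<phi> ` P \<inter> U = P"
    and M: "add_subgroup M" "compact M" "\<phi> ` M \<subseteq> M"
    and dec: "\<forall>x\<in>U. \<exists>y\<in>M. x - y \<in> P"
    and scale: "aut_scale \<phi> = add_index (\<phi> ` P) P"
    by (rule tidy_above_decomposition[OF assms(1)])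
  \<comment> \<open>The open subgroup \<open>U\<close> absorbs every vector; powers of \<open>p\<close> serve as scalars.\<close>
  have small: "\<exists>c. c \<noteq> 0 \<and> padic_norm c \<le> 1 \<and> c *s x \<in> U" for x
  proof -
    have "(\<lambda>m. (of_nat CARD('p) :: 'p padic) ^ m) \<longlonglongrightarrow> 0"
    proof (subst tendsto_dist_iff)
      have "(\<lambda>m. (1 / real CARD('p)) ^ m) \<longlonglongrightarrow> 0"
        using prime_gt_1_nat[OF prime_card[where 'a='p]] by (intro LIMSEQ_power_zero) simp
      then show "(\<lambda>m. dist ((of_nat CARD('p) :: 'p padic) ^ m) 0) \<longlonglongrightarrow> 0"
        by (simp add: dist_padic_def padic_norm_power padic_norm_prime)
    qed
    from tendsto_padic_vector_scale[OF this, of x]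
    have "(\<lambda>m. (of_nat CARD('p) :: 'p padic) ^ m *s x) \<longlonglongrightarrow> 0" by simp
    moreover have "open U" "0 \<in> U" using U by (auto simp: compact_open_subgroups_def add_subgroup_def)
    ultimately have "eventually (\<lambda>m. (of_nat CARD('p) :: 'p padic) ^ m *s x \<in> U) sequentially"
      by (rule topological_tendstoD)
    then obtain m where "(of_nat CARD('p) :: 'p padic) ^ m *s x \<in> U"
      unfolding eventually_sequentially by blast
    moreover have "padic_norm ((of_nat CARD('p) :: 'p padic) ^ m) \<le> 1"
      using padic_norm_of_nat_le_1[of "CARD('p) ^ m", where 'p='p] by simp
    moreover have "(of_nat CARD('p) :: 'p padic) ^ m \<noteq> 0"
      using padic_norm_prime[where 'p='p] prime_gt_1_nat[OF prime_card[where 'a='p]] by auto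
    ultimately show ?thesis by blast
  qed
  have in_span: "x \<in> vec.span V" if "c \<noteq> 0" "c *s x \<in> vec.span V" for c x and V :: "('p padic ^ 'n) set"
  proof -
    have "inverse c *s (c *s x) \<in> vec.span V" by (rule vec.span_scale[OF that(2)])
    then show ?thesis using that(1) by (simp add: vector_smult_assoc)
  qed
  \<comment> \<open>A vector of \<open>\<phi> P\<close> has a nonzero multiple in \<open>\<phi> P \<inter> U = P\<close>.\<close>
  have \<phi>P_span: "y \<in> vec.span P" if y: "y \<in> \<phi> ` P" for y
  proof -
    obtain c where c: "c \<noteq> 0" "padic_norm c \<le> 1" "c *s y \<in> U" using small by blast
    have "add_subgroup (\<phi> ` P)" "compact (\<phi> ` P)"
      by (intro add_subgroup_image add' P compact_continuous_image continuous_on_subset[OF cont] subset_UNIV)+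
    then have "c *s y \<in> \<phi> ` P" by (intro closed_subgroup_padic_scale compact_imp_closed c(2) y)
    then have "c *s y \<in> P" using c(3) P(4) by blast
    then show ?thesis by (rule in_span[OF c(1) vec.span_base])
  qed
  have "vec.span (P \<union> M) = UNIV"
  proof (intro equalityI subset_UNIV subsetI)
    fix x :: "'p padic ^ 'n"
    obtain c where c: "c \<noteq> 0" "c *s x \<in> U" using small by blast
    obtain y where y: "y \<in> M" "c *s x - y \<in> P" using dec c(2) by blast
    have "(c *s x - y) + y \<in> vec.span (P \<union> M)"
      using y by (intro vec.span_add vec.span_base) auto
    then have "c *s x \<in> vec.span (P \<union> M)" by simp
    then show "x \<in> vec.span (P \<union> M)" by (rule in_span[OF c(1)])
  qed
  then obtain Q R :: "'p padic ^ 'n ^ 'n" and S where QR: "Q ** R = mat 1" "R ** Q = mat 1"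
    and basis: "\<forall>i\<in>S. axis i 1 \<in> (*v) R ` P" "\<forall>i\<in>-S. axis i 1 \<in> (*v) R ` M"
    and support: "\<forall>x\<in>vec.span P. \<forall>i\<in>-S. (R *v x) $ i = 0"
    by (rule adapted_basis)
  have axisP: "axis i 1 \<in> (*v) R ` P" if "i \<in> S" for i using basis(1) that by blast
  have axisM: "axis i 1 \<in> (*v) R ` M" if "i \<notin> S" for i using basis(2) that by blast
  have supp: "(R *v x) $ i = 0" if "x \<in> vec.span P" "i \<notin> S" for x i using support that by blast
  define A' where "A' = R ** A ** Q"
  have A'R: "A' *v (R *v x) = R *v \<phi> x" for x
    unfolding A'_def \<phi>A matrix_vector_mul_assoc matrix_mul_assoc[symmetric] QR(1) by simp
  have image: "(*v) A' ` (*v) R ` L = (*v) R ` \<phi> ` L" for L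
    unfolding image_image A'R ..
  have "det R * det Q = 1" using QR(2) by (metis det_I det_mul)
  then have detR: "det R \<noteq> 0" and detA': "det A' \<noteq> 0"
    using detA by (auto simp: A'_def det_mul)
  have ev': "is_eigenvalue_family \<iota> A' ev"
    using assms(4) unfolding is_eigenvalue_family_def A'_def charpoly_conjugate[OF QR(2)] A_def .
  have comp: "compact ((*v) R ` L)" if "compact L" for L
    by (intro compact_continuous_image continuous_on_padic_matrix_vector that)
  have supp1: "x $ i = 0" if "x \<in> (*v) R ` P" "i \<notin> S" for x i
    using that supp vec.span_base by blast
  have supp2: "(A' *v x) $ i = 0" if x: "x \<in> (*v) R ` P" and i: "i \<notin> S" for x i
  proof -
    obtain y where "y \<in> P" "x = R *v y" using x by blast
    then show ?thesis using supp[OF \<phi>P_span i, of "\<phi> y"] A'R by simp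
  qed
  have expand: "(*v) R ` P \<subseteq> (*v) A' ` (*v) R ` P" unfolding image by (intro image_mono P)
  have contract: "(*v) A' ` (*v) R ` M \<subseteq> (*v) R ` M" unfolding image by (intro image_mono M)
  note eig = expanding_eigenvalue_product[OF hom assms(3) ev' detA' comp[OF P(2)] expand axisP supp2
    comp[OF M(2)] contract axisM]
  have "real (aut_scale \<phi>) = real (add_index ((*v) R ` \<phi> ` P) ((*v) R ` P))"
    unfolding scale using add_index_image[OF additive_matrix_vector inj_matrix_vector[OF detR] P(1,3)] by simp
  also have "\<dots> = padic_norm (det (upper_left_block S (- A')))"
    unfolding image[symmetric]
    by (rule expanding_index_eq_det[OF add_subgroup_image[OF additive_matrix_vector P(1)]
          comp[OF P(2)] expand axisP supp1 supp2 eig(2)])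
  also have "\<dots> = (\<Prod>i | N (ev i) > 1. N (ev i))" using eig(1) by simp
  finally show ?thesis .
qed

end
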